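(* Let $K>0$, $\alpha\in[0,1]$ and $s\ge s_0\ge0$ with $|s-s_0|\le K$. Suppose $v_j\in L^\infty(s_0,s;H^\alpha(\mathbb T))$ and $\partial_tv_j\in L^\infty(s_0,s;H^{-\frac{23}{14}}(\mathbb T))$ for $j=1,2,3$. Define $$\mathcal C(v_1,v_2,v_3)=\int_{s_0}^s e^{t\partial_x^3}\,\mathbb P\Big(\mathbb P\big(e^{-t\partial_x^3}v_1(t)\cdot e^{-t\partial_x^3}v_2(t)\big)\cdot e^{-t\partial_x^3}\partial_x^{-1}v_3(t)\Big)\,dt .$$ Then there is a constant $C>0$, independent of $s,s_0$ and $v_1,v_2,v_3$ (it may depend on $K$ and $\alpha$), such that: (1) $$\|\mathcal C(v_1,v_2,v_3)\|_{L^2}\le C|s-s_0|\prod_{j=1}^3\|v_j\|_{X^0([s_0,s])}+C\|v_1\|_{L^\infty(s_0,s;H^{-\frac{23}{14}})}\|v_2\|_{L^\infty(s_0,s;L^2)}\|v_3\|_{L^\infty(s_0,s;L^2)},$$ and the inequality still holds when $v_1,v_2,v_3$ are permuted on the right-hand side. (2) If $v_1,v_2,v_3$ are time-independent, then $$\|\mathcal C(v_1,v_2,v_3)\|_{L^2}\le C|s-s_0|^\alpha\prod_{j=1}^3\|v_j\|_{H^\alpha}.$$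
   Context: $\mathbb T=[0,2\pi]$ is the torus, $\hat f_k=\frac1{2\pi}\int_{\mathbb T}e^{-ikx}f\,dx$, $\|f\|_{H^s}=\sqrt{2\pi}\big(\sum_k(1+|k|^2)^s|\hat f_k|^2\big)^{1/2}$. $\mathbb Pf=f-\frac1{2\pi}\int_{\mathbb T}f\,dx$. $\partial_x^{-1}$ is the Fourier multiplier with symbol $(ik)^{-1}$ for $k\neq0$ and $0$ for $k=0$. $e^{t\partial_x^3}$ is the Fourier multiplier with symbol $e^{-itk^3}$. For $\alpha\in[0,1]$, $$\|v\|_{X^\alpha([s_0,s])}:=\|v\|_{L^\infty(s_0,s;H^\alpha)}+\|\partial_tv\|_{L^\infty(s_0,s;H^{-\frac{23}{14}})}.$$ *)

theory Defs
  imports "HOL-Probability.Essential_Supremum" "HOL-Combinatorics.Permutations"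
begin

section \<open>Periodic distributions\<close>

definition vderiv :: "(real \<Rightarrow> complex) \<Rightarrow> real \<Rightarrow> complex" where
  "vderiv f = (\<lambda>x. vector_derivative f (at x))"

definition smooth :: "(real \<Rightarrow> complex) \<Rightarrow> bool" where
  "smooth f \<longleftrightarrow> (\<forall>n x. (vderiv ^^ n) f differentiable (at x))"

definition periodic_test :: "(real \<Rightarrow> complex) \<Rightarrow> bool" where
  "periodic_test \<phi> \<longleftrightarrow> smooth \<phi> \<and> (\<forall>x. \<phi> (x + 2 * pi) = \<phi> x)"

text \<open>
  A distribution on the torus is a continuous linear functional on the smooth periodic functions.
  HOL functions being total, such a functional also has values outside that space; these values
  are irrelevant, and no notion below depends on them.
\<close>

type_synonym functional = "(real \<Rightarrow> complex) \<Rightarrow> complex"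

definition distribution :: "functional \<Rightarrow> bool" where
  "distribution u \<longleftrightarrow>
     (\<forall>\<phi> \<psi>. periodic_test \<phi> \<longrightarrow> periodic_test \<psi> \<longrightarrow> u (\<lambda>x. \<phi> x + \<psi> x) = u \<phi> + u \<psi>) \<and>
     (\<forall>c \<phi>. periodic_test \<phi> \<longrightarrow> u (\<lambda>x. c * \<phi> x) = c * u \<phi>) \<and>
     (\<exists>B N. \<forall>\<phi>. periodic_test \<phi> \<longrightarrow>
        cmod (u \<phi>) \<le> B * (\<Sum>n\<le>N. SUP x\<in>{0..2*pi}. cmod ((vderiv ^^ n) \<phi> x)))"

abbreviation torus :: "real measure" where
  "torus \<equiv> lebesgue_on {0..2*pi}"

definition of_fun :: "(real \<Rightarrow> complex) \<Rightarrow> functional" where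
  "of_fun f \<phi> = (LINT x|torus. f x * \<phi> x)"

text \<open>Identity of distributions is identity on test functions.\<close>

definition represents :: "(real \<Rightarrow> complex) \<Rightarrow> functional \<Rightarrow> bool" where
  "represents f u \<longleftrightarrow> integrable torus f \<and> (\<forall>\<phi>. periodic_test \<phi> \<longrightarrow> u \<phi> = of_fun f \<phi>)"

text \<open>The almost everywhere unique integrable function representing a regular distribution.\<close>

definition density_of :: "functional \<Rightarrow> real \<Rightarrow> complex" where
  "density_of u = (SOME f. represents f u)"

definition mult :: "functional \<Rightarrow> functional \<Rightarrow> functional" where
  "mult u v = of_fun (\<lambda>x. density_of u x * density_of v x)"

definition in_L2 :: "functional \<Rightarrow> bool" where
  "in_L2 u \<longleftrightarrow> (\<exists>f. represents f u \<and> integrable torus (\<lambda>x. (cmod (f x))\<^sup>2))"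

definition L2_norm :: "functional \<Rightarrow> real" where
  "L2_norm u = sqrt (LINT x|torus. (cmod (density_of u x))\<^sup>2)"

section \<open>Fourier coefficients, Sobolev spaces and Fourier multipliers\<close>

definition fcoeff :: "functional \<Rightarrow> int \<Rightarrow> complex" where
  "fcoeff u k = u (\<lambda>x. cis (- (of_int k * x))) / (2 * pi)"

definition in_H :: "real \<Rightarrow> functional \<Rightarrow> bool" where
  "in_H r u \<longleftrightarrow> distribution u \<and>
     (\<lambda>k. (1 + (of_int k)\<^sup>2) powr r * (cmod (fcoeff u k))\<^sup>2) summable_on UNIV"

definition H_norm :: "real \<Rightarrow> functional \<Rightarrow> real" where
  "H_norm r u =
     sqrt (2 * pi) * sqrt (\<Sum>\<^sub>\<infinity>k. (1 + (of_int k)\<^sup>2) powr r * (cmod (fcoeff u k))\<^sup>2)"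

text \<open>
  The distribution with Fourier series \<open>\<Sum>k. m k * fcoeff u k * exp (i k x)\<close>, the series being
  summed in the sense of distributions: the integral of \<open>exp (i k x) * \<phi> x\<close> over the torus is
  \<open>2 * pi\<close> times the Fourier coefficient of \<open>\<phi>\<close> at \<open>- k\<close>. The series converges absolutely
  if \<open>m\<close> has polynomial growth.
\<close>

definition fmult :: "(int \<Rightarrow> complex) \<Rightarrow> functional \<Rightarrow> functional" where
  "fmult m u \<phi> = (\<Sum>\<^sub>\<infinity>k. m k * fcoeff u k * of_fun (\<lambda>x. cis (of_int k * x)) \<phi>)"

definition dx_inv :: "functional \<Rightarrow> functional" where
  "dx_inv = fmult (\<lambda>k. if k = 0 then 0 else inverse (\<i> * of_int k))"

definition airy :: "real \<Rightarrow> functional \<Rightarrow> functional" where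
  "airy t = fmult (\<lambda>k. cis (- (t * of_int k ^ 3)))"

text \<open>The integral of \<open>u\<close> over the torus is the pairing of \<open>u\<close> with the constant function 1.\<close>

definition mean_free :: "functional \<Rightarrow> functional" where
  "mean_free u = (\<lambda>\<phi>. u \<phi> - of_fun (\<lambda>_. u (\<lambda>_. 1) / (2 * pi)) \<phi>)"

section \<open>Time-dependent distributions\<close>

definition strongly_measurable_H :: "real \<Rightarrow> real \<Rightarrow> real \<Rightarrow> (real \<Rightarrow> functional) \<Rightarrow> bool" where
  "strongly_measurable_H r s0 s v \<longleftrightarrow>
     (\<exists>S. (\<forall>n::nat. simple_function (lebesgue_on {s0..s}) (S n) \<and> (\<forall>t\<in>{s0..s}. in_H r (S n t))) \<and>
          (AE t in lebesgue_on {s0..s}.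
             (\<lambda>n. H_norm r (\<lambda>\<phi>. S n t \<phi> - v t \<phi>)) \<longlonglongrightarrow> 0))"

definition in_Linf_H :: "real \<Rightarrow> real \<Rightarrow> real \<Rightarrow> (real \<Rightarrow> functional) \<Rightarrow> bool" where
  "in_Linf_H r s0 s v \<longleftrightarrow>
     strongly_measurable_H r s0 s v \<and>
     (\<exists>B. AE t in lebesgue_on {s0..s}. in_H r (v t) \<and> H_norm r (v t) \<le> B)"

definition Linf_norm :: "(functional \<Rightarrow> real) \<Rightarrow> real \<Rightarrow> real \<Rightarrow> (real \<Rightarrow> functional) \<Rightarrow> real" where
  "Linf_norm nrm s0 s v = enn2real (esssup (lebesgue_on {s0..s}) (\<lambda>t. ennreal (nrm (v t))))"

definition time_test :: "real \<Rightarrow> real \<Rightarrow> (real \<Rightarrow> complex) \<Rightarrow> bool" where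
  "time_test s0 s \<psi> \<longleftrightarrow> smooth \<psi> \<and> (\<exists>a b. s0 < a \<and> b < s \<and> (\<forall>t. t \<notin> {a..b} \<longrightarrow> \<psi> t = 0))"

definition weak_time_deriv ::
  "real \<Rightarrow> real \<Rightarrow> (real \<Rightarrow> functional) \<Rightarrow> (real \<Rightarrow> functional) \<Rightarrow> bool" where
  "weak_time_deriv s0 s v w \<longleftrightarrow>
     (\<forall>\<psi> \<phi>. time_test s0 s \<psi> \<longrightarrow> periodic_test \<phi> \<longrightarrow>
        (LINT t|lebesgue_on {s0..s}. vderiv \<psi> t * v t \<phi>) =
        - (LINT t|lebesgue_on {s0..s}. \<psi> t * w t \<phi>))"

definition in_X :: "real \<Rightarrow> real \<Rightarrow> real \<Rightarrow> (real \<Rightarrow> functional) \<Rightarrow> bool" where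
  "in_X \<alpha> s0 s v \<longleftrightarrow>
     in_Linf_H \<alpha> s0 s v \<and> (\<exists>w. in_Linf_H (-23/14) s0 s w \<and> weak_time_deriv s0 s v w)"

text \<open>The weak time derivative, unique up to null sets of times.\<close>

definition dt :: "real \<Rightarrow> real \<Rightarrow> (real \<Rightarrow> functional) \<Rightarrow> real \<Rightarrow> functional" where
  "dt s0 s v = (SOME w. in_Linf_H (-23/14) s0 s w \<and> weak_time_deriv s0 s v w)"

definition X_norm :: "real \<Rightarrow> real \<Rightarrow> real \<Rightarrow> (real \<Rightarrow> functional) \<Rightarrow> real" where
  "X_norm \<alpha> s0 s v =
     Linf_norm (H_norm \<alpha>) s0 s v + Linf_norm (H_norm (-23/14)) s0 s (dt s0 s v)"

section \<open>The trilinear operator\<close>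

text \<open>The time integral of distributions is taken by pairing with test functions.\<close>

definition trilin :: "real \<Rightarrow> real \<Rightarrow> (real \<Rightarrow> functional) \<Rightarrow> (real \<Rightarrow> functional) \<Rightarrow>
    (real \<Rightarrow> functional) \<Rightarrow> functional" where
  "trilin s0 s v1 v2 v3 \<phi> =
     (LINT t|lebesgue_on {s0..s}.
        airy t (mean_free
          (mult (mean_free (mult (airy (- t) (v1 t)) (airy (- t) (v2 t))))
                (airy (- t) (dx_inv (v3 t))))) \<phi>)"

end

theory Submission
  imports Defs
begin

text \<open>
  In Fourier variables the integrand at frequency \<open>k\<close> is a sum over \<open>k1 + k2 + k3 = k\<close> of
  \<open>exp (- i t \<Phi>) a1 k1 * a2 k2 * a3 k3 / (i * k3)\<close>, where \<open>a1, a2, a3\<close> are the Fourier coefficients of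
  \<open>v1, v2, v3\<close> at time \<open>t\<close> and
  \<open>\<Phi> = k\<^sup>3 - k1\<^sup>3 - k2\<^sup>3 - k3\<^sup>3 = 3 * (k1 + k2) * (k2 + k3) * (k1 + k3)\<close>. The two mean-free projections
  and the inverse derivative remove \<open>k = 0\<close>, \<open>k1 + k2 = 0\<close> and \<open>k3 = 0\<close>. By duality, a bound for
  the \<open>L\<^sup>2\<close> norm of the operator is a bound for all finite sums of
  \<open>D k * \<bar>tri_coeff (k, k3, k1)\<bar>\<close> with \<open>D\<close> in \<open>\<ell>\<^sup>2\<close>, where \<open>tri_coeff\<close> is the time integral of one
  summand (\<open>fibre_sums_square_summable\<close>, \<open>trilin_L2_bound\<close>).

  Resonant triples have \<open>\<Phi> = 0\<close>. As \<open>k1 + k2 \<noteq> 0\<close>, either \<open>k2 = - k3\<close> and \<open>k1 = k\<close>, or \<open>k1 = - k3\<close> and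
  \<open>k2 = k\<close>. In both cases the sum splits into a product of two \<open>\<ell>\<^sup>2\<close> pairings, and integration in
  time gives \<open>\<bar>s - s0\<bar>\<close> times a product of three \<open>L\<^sup>2\<close> norms (\<open>resonant_part_le\<close>).

  For nonresonant triples one integrates by parts in time and gains \<open>1 / \<Phi>\<close>
  (\<open>oscillatory_integral_le\<close>). The endpoint terms contain no time derivative; they are bounded with
  one factor, any of the three, in \<open>H\<close> of order \<open>- 23 / 14\<close>. The integrated terms contain the time
  derivative of one factor, in the same space. Everything then follows from a bound for the
  multiplier \<open>(1 + \<bar>k\<^sub>j\<bar>) powr (23 / 14) / (\<bar>k3\<bar> * \<bar>\<Phi>\<bar>)\<close>. Its denominator has four linear factors;
  the largest of them are comparable, so that the order \<open>23 / 14 < 2\<close> is absorbed with something to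
  spare, and what is left is dominated by products of the summable weight
  \<open>(1 + \<bar>\<cdot>\<bar>) powr (- 33 / 28)\<close> at two linear forms (\<open>nonresonant_multiplier_le\<close>). Two such weights
  suffice: after fixing two linear forms a single free frequency is left, over which Cauchy--Schwarz
  applies to two of the four sequences (\<open>pair_weights_sum_le\<close>).

  If the factors do not depend on time, the time integral of \<open>exp (- i t \<Phi>)\<close> is at most both \<open>\<bar>s - s0\<bar>\<close> and
  \<open>2 / \<bar>\<Phi>\<bar>\<close>. Interpolation gives \<open>\<bar>s - s0\<bar> powr \<alpha> * \<bar>\<Phi>\<bar> powr (\<alpha> - 1)\<close> up to a constant, and the three
  factors in \<open>H\<close> of order \<open>\<alpha>\<close> contribute \<open>(\<bar>k1\<bar> * \<bar>k2\<bar> * \<bar>k3\<bar>) powr (- \<alpha>)\<close> (with brackets in place of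
  absolute values). As \<open>x powr (1 - \<alpha>) * y powr \<alpha> \<le> x + y\<close>, the two multipliers at \<open>\<alpha> = 0\<close> and
  \<open>\<alpha> = 1\<close> suffice, and both are dominated by the same weights.

  The passage between functionals and coefficients rests on Fourier analysis on the torus:
  uniqueness of Fourier coefficients of integrable functions, the Riesz--Fischer theorem, Parseval's
  identity, the coefficients of a product, and the Fourier series of a distribution. A weak time
  derivative enters through the fact that each coefficient agrees almost everywhere with an
  indefinite integral of the coefficient of the derivative (\<open>weak_derivative_primitive\<close>), for which
  the product rule and integration by parts are available.
\<close>

section \<open>Weighted sums over frequency triples\<close>

text \<open>  Bounds in \<open>\<ell>\<^sup>2\<close> are stated through finite partial sums, so that the multilinear estimates below need
  no convergence arguments.\<close>

definition l2bd :: "(int \<Rightarrow> real) \<Rightarrow> real \<Rightarrow> bool" where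
  "l2bd A a \<longleftrightarrow> (\<forall>n. 0 \<le> A n) \<and> (\<forall>F. finite F \<longrightarrow> L2_set A F \<le> a)"

lemma l2bd_nonneg: "l2bd A a \<Longrightarrow> 0 \<le> A n"
  by (simp add: l2bd_def)

lemma l2bd_bound_nonneg: "l2bd A a \<Longrightarrow> 0 \<le> a"
  unfolding l2bd_def by (metis L2_set_empty finite.emptyI)

lemma l2bd_pointwise:
  assumes "l2bd A a" shows "A n \<le> a"
proof -
  have "L2_set A {n} \<le> a" using assms unfolding l2bd_def by blast
  then show ?thesis using l2bd_nonneg[OF assms] by (simp add: L2_set_def)
qed

lemma l2bd_sum_inj:
  assumes "finite T" "l2bd A a" "l2bd B b" "inj_on \<xi> T" "inj_on \<eta> T"
  shows "(\<Sum>x\<in>T. A (\<xi> x) * B (\<eta> x)) \<le> a * b"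
proof -
  have L: "L2_set (\<lambda>x. C (\<zeta> x)) T \<le> c" if "l2bd C c" "inj_on \<zeta> T" for C c and \<zeta> :: "'a \<Rightarrow> int"
  proof -
    have "L2_set (\<lambda>x. C (\<zeta> x)) T = L2_set C (\<zeta> ` T)"
      by (simp add: L2_set_def sum.reindex[OF that(2)] o_def)
    then show ?thesis using that assms(1) by (simp add: l2bd_def)
  qed
  have "(\<Sum>x\<in>T. A (\<xi> x) * B (\<eta> x)) \<le> (\<Sum>x\<in>T. \<bar>A (\<xi> x)\<bar> * \<bar>B (\<eta> x)\<bar>)"
    by (intro sum_mono) (simp add: abs_mult[symmetric])
  also have "\<dots> \<le> L2_set (\<lambda>x. A (\<xi> x)) T * L2_set (\<lambda>x. B (\<eta> x)) T"
    by (rule L2_set_mult_ineq)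
  also have "\<dots> \<le> a * b"
    using L[OF assms(2,4)] L[OF assms(3,5)] l2bd_bound_nonneg[OF assms(2)]
    by (intro mult_mono) auto
  finally show ?thesis .
qed

text \<open>  The two forms \<open>l1\<close> and \<open>l2\<close> are fixed first. On their common fibre \<open>\<kappa>\<close> and \<open>\<mu>\<close> are injective, so
  Cauchy--Schwarz sums \<open>A\<close> against \<open>B\<close>, while \<open>C\<close> and \<open>D\<close> are bounded pointwise by their \<open>\<ell>\<^sup>2\<close> norms.
  The weights then sum the values of \<open>l1\<close> and \<open>l2\<close>.\<close>

lemma weighted_quadrilinear_sum_le:
  fixes w :: "int \<Rightarrow> real"
  assumes T: "finite T" and A: "l2bd A a" and B: "l2bd B b" and C: "l2bd C c" and D: "l2bd D d"
    and w0: "\<And>n. 0 \<le> w n" and W: "\<And>F. finite F \<Longrightarrow> sum w F \<le> W"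
    and inj1: "inj_on (\<lambda>x. (l1 x, l2 x, \<kappa> x)) T" and inj2: "inj_on (\<lambda>x. (l1 x, l2 x, \<mu> x)) T"
  shows "(\<Sum>x\<in>T. w (l1 x) * w (l2 x) * (A (\<kappa> x) * B (\<mu> x) * C (\<nu> x) * D (\<theta> x))) \<le> W\<^sup>2 * (a * b * c * d)"
proof -
  note nn = l2bd_nonneg[OF A] l2bd_nonneg[OF B] l2bd_nonneg[OF C] l2bd_nonneg[OF D]
  note bn = l2bd_bound_nonneg[OF A] l2bd_bound_nonneg[OF B] l2bd_bound_nonneg[OF C] l2bd_bound_nonneg[OF D]
  define l where "l x = (l1 x, l2 x)" for x
  have W0: "0 \<le> W" using W[of "{}"] by simp
  have fib: "(\<Sum>x\<in>{x\<in>T. l x = y}. w (l1 x) * w (l2 x) * (A (\<kappa> x) * B (\<mu> x) * C (\<nu> x) * D (\<theta> x)))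
      \<le> w (fst y) * w (snd y) * (a * b * c * d)" for y
  proof -
    let ?S = "{x\<in>T. l x = y}"
    have "(\<Sum>x\<in>?S. w (l1 x) * w (l2 x) * (A (\<kappa> x) * B (\<mu> x) * C (\<nu> x) * D (\<theta> x)))
        \<le> (\<Sum>x\<in>?S. (w (fst y) * w (snd y) * (c * d)) * (A (\<kappa> x) * B (\<mu> x)))"
    proof (intro sum_mono)
      fix x assume "x \<in> ?S"
      then have e: "l1 x = fst y" "l2 x = snd y" by (auto simp: l_def)
      have "C (\<nu> x) * D (\<theta> x) \<le> c * d"
        using l2bd_pointwise[OF C] l2bd_pointwise[OF D] nn bn by (intro mult_mono) auto
      then have "(w (fst y) * w (snd y) * (A (\<kappa> x) * B (\<mu> x))) * (C (\<nu> x) * D (\<theta> x))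
          \<le> (w (fst y) * w (snd y) * (A (\<kappa> x) * B (\<mu> x))) * (c * d)"
        using nn w0 by (intro mult_left_mono) auto
      then show "w (l1 x) * w (l2 x) * (A (\<kappa> x) * B (\<mu> x) * C (\<nu> x) * D (\<theta> x))
          \<le> (w (fst y) * w (snd y) * (c * d)) * (A (\<kappa> x) * B (\<mu> x))"
        by (simp add: e algebra_simps)
    qed
    also have "\<dots> = (w (fst y) * w (snd y) * (c * d)) * (\<Sum>x\<in>?S. A (\<kappa> x) * B (\<mu> x))"
      by (simp add: sum_distrib_left)
    also have "\<dots> \<le> (w (fst y) * w (snd y) * (c * d)) * (a * b)"
    proof (intro mult_left_mono l2bd_sum_inj A B)
      show "inj_on \<kappa> ?S" using inj1 by (auto simp: inj_on_def l_def)
      show "inj_on \<mu> ?S" using inj2 by (auto simp: inj_on_def l_def)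
    qed (use T w0 bn in auto)
    finally show ?thesis by (simp add: algebra_simps)
  qed
  have "(\<Sum>x\<in>T. w (l1 x) * w (l2 x) * (A (\<kappa> x) * B (\<mu> x) * C (\<nu> x) * D (\<theta> x)))
      = (\<Sum>y\<in>l ` T. \<Sum>x\<in>{x\<in>T. l x = y}. w (l1 x) * w (l2 x) * (A (\<kappa> x) * B (\<mu> x) * C (\<nu> x) * D (\<theta> x)))"
    by (rule sum.image_gen[OF T])
  also have "\<dots> \<le> (\<Sum>y\<in>l ` T. w (fst y) * w (snd y) * (a * b * c * d))"
    by (intro sum_mono fib)
  also have "\<dots> \<le> (\<Sum>y\<in>(l1 ` T) \<times> (l2 ` T). w (fst y) * w (snd y) * (a * b * c * d))"
    using T w0 bn by (intro sum_mono2) (auto simp: l_def)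
  also have "\<dots> = (sum w (l1 ` T) * sum w (l2 ` T)) * (a * b * c * d)"
    by (subst sum_product) (simp add: sum.cartesian_product sum_distrib_right case_prod_unfold)
  also have "\<dots> \<le> (W * W) * (a * b * c * d)"
    using T W w0 W0 bn by (intro mult_right_mono mult_mono sum_nonneg) auto
  finally show ?thesis by (simp add: power2_eq_square)
qed

definition br :: "int \<Rightarrow> real" where "br n = 1 + \<bar>of_int n\<bar>"

lemma br_ge_1: "1 \<le> br n" by (simp add: br_def)

text \<open>  A multiplier of total decay \<open>3 - 9 / 14 = 33 / 14\<close> spread over two factors leaves \<open>33 / 28\<close> for each,
  and \<open>33 / 28 > 1\<close> makes the weight summable. The number \<open>9 / 14\<close> is \<open>23 / 14 - 1\<close>.\<close>

definition wt :: "int \<Rightarrow> real" where "wt n = br n powr (-33/28)"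

lemma wt_nonneg: "0 \<le> wt n" by (simp add: wt_def)

lemma wt_sums_bounded: "\<exists>W. \<forall>F. finite F \<longrightarrow> sum wt F \<le> W"
proof -
  let ?g = "\<lambda>n. real (Suc n) powr (-33/28)"
  have s: "summable ?g"
    using summable_real_powr_iff[of "-33/28"] summable_Suc_iff[of "\<lambda>n. real n powr (-33/28)"] by simp
  have "sum wt F \<le> 2 * suminf ?g" if F: "finite F" for F :: "int set"
  proof -
    let ?P = "{n\<in>F. 0 \<le> n}" and ?N = "{n\<in>F. n < 0}"
    have half: "sum wt S \<le> suminf ?g" if S: "finite S" "inj_on (\<lambda>n. nat \<bar>n\<bar>) S" for S :: "int set"
    proof -
      have "sum wt S = (\<Sum>n\<in>S. ?g (nat \<bar>n\<bar>))"
        by (intro sum.cong) (auto simp: wt_def br_def)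
      also have "\<dots> = sum ?g ((\<lambda>n. nat \<bar>n\<bar>) ` S)"
        using sum.reindex[OF S(2), of ?g] by (simp add: o_def)
      also have "\<dots> \<le> suminf ?g"
        using S(1) by (intro sum_le_suminf s) auto
      finally show ?thesis .
    qed
    have "sum wt F = sum wt (?P \<union> ?N)" by (rule sum.cong) auto
    also have "\<dots> = sum wt ?P + sum wt ?N" using F by (intro sum.union_disjoint) auto
    also have "\<dots> \<le> 2 * suminf ?g"
    proof -
      have "inj_on (\<lambda>n. nat \<bar>n\<bar>) ?P" "inj_on (\<lambda>n. nat \<bar>n\<bar>) ?N" by (auto simp: inj_on_def)
      then show ?thesis using half[of ?P] half[of ?N] F by auto
    qed
    finally show ?thesis .
  qed
  then show ?thesis by blast
qed

lemma wt_summable: "wt summable_on UNIV"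
proof -
  obtain W where "\<And>F. finite F \<Longrightarrow> sum wt F \<le> W" using wt_sums_bounded by blast
  then show ?thesis by (intro nonneg_bdd_above_summable_on) (auto simp: wt_nonneg bdd_above_def)
qed

definition wt_total :: real where "wt_total = (\<Sum>\<^sub>\<infinity>n. wt n)"

lemma sum_wt_le: "finite F \<Longrightarrow> sum wt F \<le> wt_total"
  unfolding wt_total_def by (intro finite_sum_le_infsum wt_summable) (auto simp: wt_nonneg)

text \<open>  The largest factor \<open>z\<close> absorbs \<open>t powr (9 / 14)\<close>. What remains of it, \<open>z powr (- 5 / 14)\<close>, is shared
  between \<open>x\<close> and \<open>y\<close>: each receives \<open>- 5 / 28\<close>, and \<open>1 + 5 / 28 = 33 / 28\<close>.\<close>

lemma three_factor_bound:
  fixes x y z t :: real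
  assumes "1 \<le> x" "1 \<le> y" "1 \<le> z" "0 \<le> t" "t \<le> 4 * z" "x \<le> z" "y \<le> z"
  shows "t powr (9/14) / (x * y * z) \<le> 4 * (x powr (-33/28) * y powr (-33/28))"
proof -
  have "t powr (9/14) \<le> (4 * z) powr (9/14)" using assms by (intro powr_mono2) auto
  also have "\<dots> = 4 powr (9/14) * z powr (9/14)" using assms by (simp add: powr_mult)
  also have "\<dots> \<le> 4 powr 1 * z powr (9/14)" by (intro mult_right_mono powr_mono) auto
  finally have t: "t powr (9/14) \<le> 4 * z powr (9/14)" by simp
  have xy: "x * y \<le> z * z" using assms by (intro mult_mono) auto
  have "z powr (9/14) / z = z powr (9/14 - 1)" using assms by (subst powr_diff) auto
  also have "\<dots> = (z * z) powr (-5/28)" using assms by (simp add: powr_mult powr_add[symmetric])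
  also have "\<dots> \<le> (x * y) powr (-5/28)" using assms xy by (intro powr_mono2') auto
  finally have z: "z powr (9/14) / z \<le> (x * y) powr (-5/28)" .
  have "t powr (9/14) / (x * y * z) \<le> 4 * z powr (9/14) / (x * y * z)"
    using t assms by (intro divide_right_mono) auto
  also have "\<dots> = 4 * (z powr (9/14) / z) / (x * y)" by simp
  also have "\<dots> \<le> 4 * (x * y) powr (-5/28) / (x * y)"
    using z assms by (intro divide_right_mono mult_left_mono) auto
  also have "\<dots> = 4 * (x * y) powr (-5/28 - 1)"
    using assms by (subst powr_diff) auto
  also have "\<dots> = 4 * (x powr (-33/28) * y powr (-33/28))"
    using assms by (simp add: powr_mult)
  finally show ?thesis .
qed

definition decay_pair :: "real \<Rightarrow> real \<Rightarrow> real" where "decay_pair x y = x powr (-33/28) * y powr (-33/28)"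

lemma decay_pair_nonneg: "0 \<le> decay_pair x y" by (simp add: decay_pair_def)

lemma three_factor_bound_pairs:
  fixes x y z t :: real
  assumes "1 \<le> x" "1 \<le> y" "1 \<le> z" "0 \<le> t" "t \<le> 4 * max x (max y z)"
  shows "t powr (9/14) / (x * y * z) \<le> 4 * (decay_pair x y + decay_pair x z + decay_pair y z)"
proof -
  note g = decay_pair_nonneg[of x y] decay_pair_nonneg[of x z] decay_pair_nonneg[of y z]
  consider "x \<le> z" "y \<le> z" | "x \<le> y" "z \<le> y" | "y \<le> x" "z \<le> x" by linarith
  then show ?thesis
  proof cases
    case 1
    have "t powr (9/14) / (x * y * z) \<le> 4 * decay_pair x y"
      unfolding decay_pair_def using assms 1 by (intro three_factor_bound) auto
    then show ?thesis using g by argo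
  next
    case 2
    have "t powr (9/14) / (x * z * y) \<le> 4 * decay_pair x z"
      unfolding decay_pair_def using assms 2 by (intro three_factor_bound) auto
    then show ?thesis using g by (simp add: mult.commute mult.left_commute)
  next
    case 3
    have "t powr (9/14) / (y * z * x) \<le> 4 * decay_pair y z"
      unfolding decay_pair_def using assms 3 by (intro three_factor_bound) auto
    then show ?thesis using g by (simp add: mult.commute mult.left_commute)
  qed
qed

text \<open>  Here \<open>U\<close> is at most twice the larger of \<open>Z\<close> and \<open>V\<close>, which therefore pays for one power of \<open>U\<close>. The
  power \<open>9 / 14\<close> that is left over is paid for by the other three factors, since by the triangle
  inequalities one of them is comparable to the factor that was spent. The product of the weights
  at \<open>Z\<close> and \<open>V\<close> does not occur on the right because one of the two has been used up.\<close>

lemma four_factor_bound: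
  fixes X Y Z V U :: real
  assumes "1 \<le> X" "1 \<le> Y" "1 \<le> Z" "1 \<le> V" "0 \<le> U" "U \<le> Z + V" "Z \<le> 2 * V + X + Y" "V \<le> X + Y + Z"
  shows "U powr (23/14) / (X * Y * Z * V)
     \<le> 16 * (decay_pair X Y + decay_pair X Z + decay_pair Y Z + decay_pair X V + decay_pair Y V)"
proof -
  note g = decay_pair_nonneg[of X Y] decay_pair_nonneg[of X Z] decay_pair_nonneg[of Y Z] decay_pair_nonneg[of X V] decay_pair_nonneg[of Y V]
  have split: "m powr (23/14) = m * m powr (9/14)" if "1 \<le> m" for m :: real
    using that powr_add[of m 1 "9/14"] by simp
  have U: "U powr (23/14) \<le> 4 * m powr (23/14)" if "U \<le> 2 * m" "1 \<le> m" for m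
  proof -
    have "U powr (23/14) \<le> (2 * m) powr (23/14)" using assms that by (intro powr_mono2) auto
    also have "\<dots> = 2 powr (23/14) * m powr (23/14)" using that by (simp add: powr_mult)
    also have "\<dots> \<le> 2 powr 2 * m powr (23/14)" by (intro mult_right_mono powr_mono) auto
    finally show ?thesis by (simp add: powr_numeral)
  qed
  show ?thesis
  proof (cases "Z \<le> V")
    case True
    have "U powr (23/14) / (X * Y * Z * V) \<le> 4 * (V * V powr (9/14)) / (X * Y * Z * V)"
      using U[of V] True assms split[of V] by (intro divide_right_mono) auto
    also have "\<dots> = 4 * (V powr (9/14) / (X * Y * Z))" using assms by simp
    also have "V powr (9/14) / (X * Y * Z) \<le> 4 * (decay_pair X Y + decay_pair X Z + decay_pair Y Z)"
      using assms by (intro three_factor_bound_pairs) auto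
    finally show ?thesis using g by (simp add: algebra_simps)
  next
    case False
    have "U powr (23/14) / (X * Y * Z * V) \<le> 4 * (Z * Z powr (9/14)) / (X * Y * Z * V)"
      using U[of Z] False assms split[of Z] by (intro divide_right_mono) auto
    also have "\<dots> = 4 * (Z powr (9/14) / (X * Y * V))" using assms by simp
    also have "Z powr (9/14) / (X * Y * V) \<le> 4 * (decay_pair X Y + decay_pair X V + decay_pair Y V)"
      using assms by (intro three_factor_bound_pairs) auto
    finally show ?thesis using g by (simp add: algebra_simps)
  qed
qed

lemma decay_pair_br: "decay_pair (br m) (br n) = wt m * wt n"
  by (simp add: decay_pair_def wt_def)

lemma decay_pair_commute: "decay_pair x y = decay_pair y x"
  by (simp add: decay_pair_def mult.commute)

text \<open>  A point of the hyperplane \<open>k = k1 + k2 + k3\<close> is encoded by \<open>(k, k3, k1)\<close>. The output frequency comes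
  first so that the Fourier coefficient at \<open>k\<close> is the sum over the second component of the pair, and
  \<open>k3\<close> precedes \<open>k1\<close> because the product with the third factor is the outer convolution.\<close>

type_synonym freq = "int \<times> int \<times> int"

fun k0 :: "freq \<Rightarrow> int" where "k0 (k, m, n) = k"
fun k3 :: "freq \<Rightarrow> int" where "k3 (k, m, n) = m"
fun k1 :: "freq \<Rightarrow> int" where "k1 (k, m, n) = n"
fun k2 :: "freq \<Rightarrow> int" where "k2 (k, m, n) = k - m - n"

definition l12 :: "freq \<Rightarrow> int" where "l12 x = k1 x + k2 x"
definition l23 :: "freq \<Rightarrow> int" where "l23 x = k2 x + k3 x"
definition l13 :: "freq \<Rightarrow> int" where "l13 x = k1 x + k3 x"

text \<open>  All pairs of linear forms that occur when one of \<open>k1, k2, k3\<close> carries the negative order, together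
  with the pairs of input frequencies needed for \<open>inverse_freq_product_le\<close>.\<close>

definition pair_weights :: "freq \<Rightarrow> real" where
  "pair_weights x =
     decay_pair (br (l12 x)) (br (l23 x)) + decay_pair (br (l12 x)) (br (l13 x)) + decay_pair (br (l23 x)) (br (l13 x))
   + decay_pair (br (l12 x)) (br (k3 x)) + decay_pair (br (l23 x)) (br (k3 x)) + decay_pair (br (l13 x)) (br (k3 x))
   + decay_pair (br (k1 x)) (br (k2 x)) + decay_pair (br (k1 x)) (br (k3 x)) + decay_pair (br (k2 x)) (br (k3 x))"

definition pair_const :: real where "pair_const = 9 * wt_total\<^sup>2 + 1"

lemma pair_const_pos: "0 < pair_const"
  unfolding pair_const_def by (simp add: add_nonneg_pos)

text \<open>  Each of the nine weights is an instance of \<open>weighted_quadrilinear_sum_le\<close>; they differ in which two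
  of the four frequencies still determine a triple once the two linear forms are fixed.\<close>

lemma pair_weights_sum_le:
  assumes T: "finite T" and A: "l2bd A a" and B: "l2bd B b" and C: "l2bd C c" and D: "l2bd D d"
  shows "(\<Sum>x\<in>T. pair_weights x * (A (k1 x) * B (k2 x) * C (k3 x) * D (k0 x))) \<le> pair_const * (a * b * c * d)"
proof -
  note bn = l2bd_bound_nonneg[OF A] l2bd_bound_nonneg[OF B] l2bd_bound_nonneg[OF C] l2bd_bound_nonneg[OF D]
  let ?P = "\<lambda>x. A (k1 x) * B (k2 x) * C (k3 x) * D (k0 x)"
  \<comment> \<open>\<open>qij\<close> applies Cauchy--Schwarz to the sequences at \<open>ki\<close> and \<open>kj\<close>\<close>
  note q12 = weighted_quadrilinear_sum_le[OF T A B C D wt_nonneg sum_wt_le, where \<kappa> = k1 and \<mu> = k2 and \<nu> = k3 and \<theta> = k0]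
  note q10 = weighted_quadrilinear_sum_le[OF T A D B C wt_nonneg sum_wt_le, where \<kappa> = k1 and \<mu> = k0 and \<nu> = k2 and \<theta> = k3]
  note q20 = weighted_quadrilinear_sum_le[OF T B D A C wt_nonneg sum_wt_le, where \<kappa> = k2 and \<mu> = k0 and \<nu> = k1 and \<theta> = k3]
  note q30 = weighted_quadrilinear_sum_le[OF T C D A B wt_nonneg sum_wt_le, where \<kappa> = k3 and \<mu> = k0 and \<nu> = k1 and \<theta> = k2]
  note ls = l12_def l23_def l13_def
  have 1: "(\<Sum>x\<in>T. decay_pair (br (l12 x)) (br (l23 x)) * ?P x) \<le> wt_total\<^sup>2 * (a * b * c * d)"
    unfolding decay_pair_br by (rule q12) (auto simp: inj_on_def ls)
  have 2: "(\<Sum>x\<in>T. decay_pair (br (l12 x)) (br (l13 x)) * ?P x) \<le> wt_total\<^sup>2 * (a * b * c * d)"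
    unfolding decay_pair_br by (rule q12) (auto simp: inj_on_def ls)
  have 3: "(\<Sum>x\<in>T. decay_pair (br (l23 x)) (br (l13 x)) * ?P x) \<le> wt_total\<^sup>2 * (a * b * c * d)"
    unfolding decay_pair_br by (rule q12) (auto simp: inj_on_def ls)
  have 4: "(\<Sum>x\<in>T. decay_pair (br (l12 x)) (br (k3 x)) * ?P x) \<le> wt_total\<^sup>2 * (a * b * c * d)"
    unfolding decay_pair_br by (rule q12) (auto simp: inj_on_def ls)
  have 5: "(\<Sum>x\<in>T. decay_pair (br (l23 x)) (br (k3 x)) * ?P x) \<le> wt_total\<^sup>2 * (a * b * c * d)"
    proof -
    have "inj_on (\<lambda>x. (l23 x, k3 x, k1 x)) T" "inj_on (\<lambda>x. (l23 x, k3 x, k0 x)) T"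
      by (auto simp: inj_on_def ls)
    from q10[OF _ this] show ?thesis unfolding decay_pair_br by (simp add: mult_ac)
  qed
  have 6: "(\<Sum>x\<in>T. decay_pair (br (l13 x)) (br (k3 x)) * ?P x) \<le> wt_total\<^sup>2 * (a * b * c * d)"
    proof -
    have "inj_on (\<lambda>x. (l13 x, k3 x, k2 x)) T" "inj_on (\<lambda>x. (l13 x, k3 x, k0 x)) T"
      by (auto simp: inj_on_def ls)
    from q20[OF _ this] show ?thesis unfolding decay_pair_br by (simp add: mult_ac)
  qed
  have 7: "(\<Sum>x\<in>T. decay_pair (br (k1 x)) (br (k2 x)) * ?P x) \<le> wt_total\<^sup>2 * (a * b * c * d)"
    proof -
    have "inj_on (\<lambda>x. (k1 x, k2 x, k3 x)) T" "inj_on (\<lambda>x. (k1 x, k2 x, k0 x)) T"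
      by (auto simp: inj_on_def ls)
    from q30[OF _ this] show ?thesis unfolding decay_pair_br by (simp add: mult_ac)
  qed
  have 8: "(\<Sum>x\<in>T. decay_pair (br (k1 x)) (br (k3 x)) * ?P x) \<le> wt_total\<^sup>2 * (a * b * c * d)"
    proof -
    have "inj_on (\<lambda>x. (k1 x, k3 x, k2 x)) T" "inj_on (\<lambda>x. (k1 x, k3 x, k0 x)) T"
      by (auto simp: inj_on_def ls)
    from q20[OF _ this] show ?thesis unfolding decay_pair_br by (simp add: mult_ac)
  qed
  have 9: "(\<Sum>x\<in>T. decay_pair (br (k2 x)) (br (k3 x)) * ?P x) \<le> wt_total\<^sup>2 * (a * b * c * d)"
    proof -
    have "inj_on (\<lambda>x. (k2 x, k3 x, k1 x)) T" "inj_on (\<lambda>x. (k2 x, k3 x, k0 x)) T"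
      by (auto simp: inj_on_def ls)
    from q10[OF _ this] show ?thesis unfolding decay_pair_br by (simp add: mult_ac)
  qed
  have "(\<Sum>x\<in>T. pair_weights x * ?P x) \<le> 9 * (wt_total\<^sup>2 * (a * b * c * d))"
    unfolding pair_weights_def ring_distribs sum.distrib using 1 2 3 4 5 6 7 8 9 by linarith
  also have "\<dots> \<le> (9 * wt_total\<^sup>2 + 1) * (a * b * c * d)" using bn by (simp add: algebra_simps)
  finally show ?thesis unfolding pair_const_def .
qed

text \<open>  A third of the resonance function \<open>k\<^sup>3 - k1\<^sup>3 - k2\<^sup>3 - k3\<^sup>3\<close>, by \<open>resonance_factorization\<close>.\<close>

definition l_prod :: "freq \<Rightarrow> int" where "l_prod x = l12 x * l23 x * l13 x"

lemma resonance_factorization: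
  "(k0 x)^3 - (k1 x)^3 - (k2 x)^3 - (k3 x)^3 = 3 * l_prod x"
  by (cases x) (simp add: l_prod_def l12_def l23_def l13_def power3_eq_cube algebra_simps)

lemma inverse_abs_le_br: "n \<noteq> 0 \<Longrightarrow> inverse \<bar>real_of_int n\<bar> \<le> 2 * inverse (br n)"
  by (simp add: br_def field_simps)

lemma inverse_square_le_wt:
  assumes "k \<noteq> 0" shows "(inverse \<bar>real_of_int k\<bar>)\<^sup>2 \<le> 4 * wt k"
proof -
  have "(inverse \<bar>real_of_int k\<bar>)\<^sup>2 \<le> (2 * inverse (br k))\<^sup>2"
    using inverse_abs_le_br[OF assms] by (intro power_mono) auto
  also have "\<dots> = 4 * br k powr (-2)"
    using br_ge_1[of k] by (simp add: powr_minus power_mult_distrib powr_numeral field_simps)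
  also have "\<dots> \<le> 4 * wt k"
    unfolding wt_def using br_ge_1[of k] by (intro mult_left_mono powr_mono) auto
  finally show ?thesis .
qed

text \<open>  The brackets of \<open>l12, l23, l13, k3\<close> play the roles of \<open>X, Y, Z, V\<close> in \<open>four_factor_bound\<close>: for instance
  \<open>k1 = l13 - k3\<close> and \<open>l13 = 2 * k3 + l12 - l23\<close>. For \<open>k2 = l23 - k3\<close> the roles of \<open>Y\<close> and \<open>Z\<close> are
  exchanged. One factor 16 comes from \<open>four_factor_bound\<close>, the other from replacing four nonzero
  integers by their brackets.\<close>

lemma nonresonant_multiplier_le:
  assumes nz: "k3 x \<noteq> 0" "l_prod x \<noteq> 0" and j: "\<kappa> \<in> {k1, k2, k3}"
  shows "br (\<kappa> x) powr (23/14) / (\<bar>of_int (k3 x)\<bar> * \<bar>of_int (l_prod x)\<bar>) \<le> 256 * pair_weights x"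
proof -
  let ?X = "br (l12 x)" and ?Y = "br (l23 x)" and ?Z = "br (l13 x)" and ?V = "br (k3 x)"
  have nz': "l12 x \<noteq> 0" "l23 x \<noteq> 0" "l13 x \<noteq> 0" using nz by (auto simp: l_prod_def)
  have ge: "1 \<le> ?X" "1 \<le> ?Y" "1 \<le> ?Z" "1 \<le> ?V" "0 \<le> br (k1 x)" "0 \<le> br (k2 x)"
    by (auto simp: br_def)
  have tri: "br (k1 x) \<le> ?Z + ?V" "?Z \<le> 2 * ?V + ?X + ?Y" "?V \<le> ?X + ?Y + ?Z"
      "br (k2 x) \<le> ?Y + ?V" "?Y \<le> 2 * ?V + ?X + ?Z"
    by (cases x; simp add: br_def l12_def l23_def l13_def)+
  have "br (\<kappa> x) powr (23/14) / (?X * ?Y * ?Z * ?V) \<le> 16 * pair_weights x"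
  proof -
    consider "\<kappa> = k1" | "\<kappa> = k3" | "\<kappa> = k2" using j by auto
    then show ?thesis
    proof cases
      case 1
      have "br (k1 x) powr (23/14) / (?X * ?Y * ?Z * ?V)
          \<le> 16 * (decay_pair ?X ?Y + decay_pair ?X ?Z + decay_pair ?Y ?Z + decay_pair ?X ?V + decay_pair ?Y ?V)"
        using ge tri by (intro four_factor_bound) auto
      also have "\<dots> \<le> 16 * pair_weights x" by (simp add: pair_weights_def decay_pair_nonneg)
      finally show ?thesis using 1 by simp
    next
      case 2
      have "br (k3 x) powr (23/14) / (?X * ?Y * ?Z * ?V)
          \<le> 16 * (decay_pair ?X ?Y + decay_pair ?X ?Z + decay_pair ?Y ?Z + decay_pair ?X ?V + decay_pair ?Y ?V)"
        using ge tri by (intro four_factor_bound) auto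
      also have "\<dots> \<le> 16 * pair_weights x" by (simp add: pair_weights_def decay_pair_nonneg)
      finally show ?thesis using 2 by simp
    next
      case 3
      have "br (k2 x) powr (23/14) / (?X * ?Z * ?Y * ?V)
          \<le> 16 * (decay_pair ?X ?Z + decay_pair ?X ?Y + decay_pair ?Z ?Y + decay_pair ?X ?V + decay_pair ?Z ?V)"
        using ge tri by (intro four_factor_bound) auto
      also have "\<dots> \<le> 16 * pair_weights x" by (simp add: pair_weights_def decay_pair_nonneg decay_pair_commute[of ?Z ?Y])
      finally show ?thesis using 3 by (simp add: mult_ac)
    qed
  qed
  moreover have "inverse (\<bar>of_int (k3 x)\<bar> * \<bar>of_int (l_prod x)\<bar>) \<le> 16 * inverse (?X * ?Y * ?Z * ?V)"
  proof -
    have "inverse \<bar>real_of_int (l12 x)\<bar> * inverse \<bar>real_of_int (l23 x)\<bar> * inverse \<bar>real_of_int (l13 x)\<bar> * inverse \<bar>real_of_int (k3 x)\<bar>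
      \<le> (2 * inverse ?X) * (2 * inverse ?Y) * (2 * inverse ?Z) * (2 * inverse ?V)"
      using nz nz' ge by (intro mult_mono inverse_abs_le_br) auto
    then show ?thesis by (simp add: l_prod_def abs_mult mult_ac)
  qed
  then have "br (\<kappa> x) powr (23/14) * inverse (\<bar>of_int (k3 x)\<bar> * \<bar>of_int (l_prod x)\<bar>)
      \<le> br (\<kappa> x) powr (23/14) * (16 * inverse (?X * ?Y * ?Z * ?V))"
    by (intro mult_left_mono) auto
  ultimately show ?thesis unfolding divide_inverse by argo
qed

text \<open>  The multiplier of the time-independent estimate at \<open>\<alpha> = 1\<close>: the case \<open>t = 1\<close> of
  \<open>three_factor_bound_pairs\<close>.\<close>

lemma inverse_freq_product_le:
  "1 / (br (k1 x) * br (k2 x) * br (k3 x)) \<le> 4 * pair_weights x"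
proof -
  have "1 powr (9/14) / (br (k1 x) * br (k2 x) * br (k3 x))
     \<le> 4 * (decay_pair (br (k1 x)) (br (k2 x)) + decay_pair (br (k1 x)) (br (k3 x)) + decay_pair (br (k2 x)) (br (k3 x)))"
    by (intro three_factor_bound_pairs) (auto simp: br_def max_def)
  also have "\<dots> \<le> 4 * pair_weights x" by (simp add: pair_weights_def decay_pair_nonneg)
  finally show ?thesis by simp
qed

lemma l2bd_reflect: "l2bd A a \<Longrightarrow> l2bd (\<lambda>n. A (- n)) a"
proof -
  assume A: "l2bd A a"
  have "L2_set (\<lambda>n. A (- n)) F \<le> a" if "finite F" for F
  proof -
    have "L2_set (\<lambda>n. A (- n)) F = L2_set A (uminus ` F)"
      by (simp add: L2_set_def sum.reindex o_def)
    then show ?thesis using A that by (simp add: l2bd_def)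
  qed
  then show ?thesis using A by (simp add: l2bd_def)
qed

text \<open>  On the plane \<open>l23 = 0\<close> one has \<open>k1 = k\<close> and \<open>k2 = - k3\<close>, so the sum is a product of a pairing of \<open>A\<close>
  with \<open>D\<close> and a pairing of the reflected \<open>B\<close> with \<open>C\<close>. The plane \<open>l13 = 0\<close> exchanges \<open>A\<close> and \<open>B\<close>.\<close>

lemma resonant_sum_le:
  assumes T: "finite T" and A: "l2bd A a" and B: "l2bd B b" and C: "l2bd C c" and D: "l2bd D d"
    and res: "\<And>x. x \<in> T \<Longrightarrow> l23 x = 0 \<or> l13 x = 0"
  shows "(\<Sum>x\<in>T. A (k1 x) * B (k2 x) * C (k3 x) * D (k0 x)) \<le> 2 * (a * b * c * d)"
proof -
  note nn = l2bd_nonneg[OF A] l2bd_nonneg[OF B] l2bd_nonneg[OF C] l2bd_nonneg[OF D]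
  note bn = l2bd_bound_nonneg[OF A] l2bd_bound_nonneg[OF B] l2bd_bound_nonneg[OF C] l2bd_bound_nonneg[OF D]
  have plane: "(\<Sum>x\<in>S. (E (k0 x) * D (k0 x)) * (F (- k3 x) * C (k3 x))) \<le> (e * d) * (f * c)"
    if S: "finite S" "inj_on (\<lambda>x. (k0 x, k3 x)) S" and E: "l2bd E e" and F: "l2bd F f" for S E F e f
  proof -
    note nn' = l2bd_nonneg[OF E] l2bd_nonneg[OF F] nn
    have "(\<Sum>x\<in>S. (E (k0 x) * D (k0 x)) * (F (- k3 x) * C (k3 x)))
        = (\<Sum>y\<in>(\<lambda>x. (k0 x, k3 x)) ` S. (E (fst y) * D (fst y)) * (F (- snd y) * C (snd y)))"
      by (simp add: sum.reindex[OF S(2)] o_def)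
    also have "\<dots> \<le> (\<Sum>y\<in>(k0 ` S) \<times> (k3 ` S). (E (fst y) * D (fst y)) * (F (- snd y) * C (snd y)))"
      using S nn' by (intro sum_mono2) auto
    also have "\<dots> = (\<Sum>k\<in>k0 ` S. E k * D k) * (\<Sum>m\<in>k3 ` S. F (- m) * C m)"
      by (subst sum_product) (simp add: sum.cartesian_product case_prod_unfold)
    also have "\<dots> \<le> (e * d) * (f * c)"
      using S nn' l2bd_sum_inj[OF _ E D, of "k0 ` S" id id] l2bd_sum_inj[OF _ l2bd_reflect[OF F] C, of "k3 ` S" id id]
        l2bd_bound_nonneg[OF E] l2bd_bound_nonneg[OF D]
      by (intro mult_mono sum_nonneg) auto
    finally show ?thesis .
  qed
  let ?T1 = "{x\<in>T. l23 x = 0}" and ?T2 = "{x\<in>T. l23 x \<noteq> 0}"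
  let ?P = "\<lambda>x. A (k1 x) * B (k2 x) * C (k3 x) * D (k0 x)"
  have "sum ?P T = sum ?P (?T1 \<union> ?T2)" by (rule sum.cong) auto
  also have "\<dots> = sum ?P ?T1 + sum ?P ?T2" using T by (intro sum.union_disjoint) auto
  also have "sum ?P ?T1 = (\<Sum>x\<in>?T1. (A (k0 x) * D (k0 x)) * (B (- k3 x) * C (k3 x)))"
    by (intro sum.cong refl) (auto simp: l23_def)
  also have "\<dots> \<le> (a * d) * (b * c)"
    using T A B by (intro plane) (auto simp: inj_on_def l23_def)
  also have "sum ?P ?T2 = (\<Sum>x\<in>?T2. (B (k0 x) * D (k0 x)) * (A (- k3 x) * C (k3 x)))"
  proof (intro sum.cong refl)
    fix x assume "x \<in> ?T2"
    then have "l13 x = 0" using res[of x] by blast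
    then have "k1 x = - k3 x" "k2 x = k0 x" by (cases x; simp add: l13_def)+
    then show "?P x = (B (k0 x) * D (k0 x)) * (A (- k3 x) * C (k3 x))" by simp
  qed
  also have "\<dots> \<le> (b * d) * (a * c)"
  proof (intro plane A B)
    show "inj_on (\<lambda>x. (k0 x, k3 x)) ?T2"
    proof (intro inj_onI)
      fix x y assume "x \<in> ?T2" "y \<in> ?T2" and e: "(k0 x, k3 x) = (k0 y, k3 y)"
      then have "l13 x = 0" "l13 y = 0" using res[of x] res[of y] by blast+
      then show "x = y" using e by (cases x; cases y) (simp add: l13_def)
    qed
  qed (use T in auto)
  finally show ?thesis by (simp add: algebra_simps)
qed

section \<open>Lebesgue integrals over a compact interval\<close>

lemma finite_measure_lebesgue_on_Icc: "finite_measure (lebesgue_on {a..b::real})"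
  by (intro finite_measure_lebesgue_on) auto

lemma AE_lebesgue_on_not_eq: "AE t in lebesgue_on {a..b}. t \<noteq> (c::real)"
proof -
  have "{c} \<inter> {a..b} \<in> null_sets (lebesgue_on {a..b})"
    by (cases "c \<in> {a..b}") (auto simp: null_sets_restrict_space)
  then show ?thesis by (rule AE_I') auto
qed

lemma AE_lebesgue_on_const:
  assumes "a < (b::real)" and "AE t in lebesgue_on {a..b}. P" shows P
proof (rule ccontr)
  assume "\<not> P"
  then have "ae_filter (lebesgue_on {a..b}) = bot" using assms(2) unfolding trivial_limit_def by simp
  then have "emeasure (lebesgue_on {a..b}) {a..b} = 0" by (simp add: ae_filter_eq_bot_iff)
  then show False using assms(1) by (simp add: emeasure_restrict_space)
qed

text \<open>  The rays form an intersection-stable generator of the Borel sets, so the integral over every Borel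
  set vanishes; Lebesgue measurable sets differ from Borel sets by null sets.\<close>

lemma integral_zero_if_intervals_zero:
  fixes f :: "real \<Rightarrow> complex"
  assumes ab: "a < b" and f: "integrable (lebesgue_on {a..b}) f"
    and z: "\<And>x. a < x \<Longrightarrow> x \<le> b \<Longrightarrow> (LINT t:{a<..<x}|lebesgue_on {a..b}. f t) = 0"
  shows "AE t in lebesgue_on {a..b}. f t = 0"
proof -
  let ?M = "lebesgue_on {a..b}"
  have bm: "A \<inter> {a..b} \<in> sets ?M" if "A \<in> sets borel" for A
    using that by (auto simp: sets_restrict_space)
  have si: "set_integrable ?M A f" if "A \<in> sets borel" for A
  proof -
    have "integrable ?M (\<lambda>t. indicator (A \<inter> {a..b}) t *\<^sub>R f t)"
      by (intro integrable_mult_indicator bm that f)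
    then show ?thesis unfolding set_integrable_def
      by (rule Bochner_Integration.integrable_cong[THEN iffD1, rotated 2]) (auto simp: indicator_def)
  qed
  have meas: "f \<in> borel_measurable ?M" using f by auto
  have ae_set: "set_lebesgue_integral ?M A f = set_lebesgue_integral ?M B f"
    if "A \<inter> {a..b} \<in> sets ?M" "B \<inter> {a..b} \<in> sets ?M" "AE t in ?M. t \<in> A \<longleftrightarrow> t \<in> B" for A B
  proof -
    have "set_lebesgue_integral ?M (A \<inter> {a..b}) f = set_lebesgue_integral ?M (B \<inter> {a..b}) f"
      using that meas by (intro set_integral_cong_set) (auto simp: set_borel_measurable_def)
    moreover have "set_lebesgue_integral ?M (A \<inter> {a..b}) f = set_lebesgue_integral ?M A f" for A
      unfolding set_lebesgue_integral_def
      by (intro Bochner_Integration.integral_cong refl) (auto simp: indicator_def)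
    ultimately show ?thesis by simp
  qed
  have half: "set_lebesgue_integral ?M {..<x} f = 0" for x
  proof -
    consider "x \<le> a" | "a < x" "x \<le> b" | "b < x" by linarith
    then show ?thesis
    proof cases
      case 1
      have "set_lebesgue_integral ?M {..<x} f = set_lebesgue_integral ?M {} f"
        using 1 by (intro ae_set bm) auto
      then show ?thesis by (simp add: set_lebesgue_integral_def)
    next
      case 2
      have "set_lebesgue_integral ?M {..<x} f = set_lebesgue_integral ?M {a<..<x} f"
      proof (intro ae_set bm)
        show "AE t in ?M. (t \<in> {..<x}) = (t \<in> {a<..<x})"
          using AE_space AE_lebesgue_on_not_eq[where c=a] by eventually_elim auto
      qed auto
      then show ?thesis using z 2 by simp
    next
      case 3
      have "set_lebesgue_integral ?M {..<x} f = set_lebesgue_integral ?M {a<..<b} f"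
      proof (intro ae_set bm)
        show "AE t in ?M. (t \<in> {..<x}) = (t \<in> {a<..<b})"
          using AE_space AE_lebesgue_on_not_eq[where c=a] AE_lebesgue_on_not_eq[where c=b]
          by eventually_elim (use 3 in auto)
      qed auto
      then show ?thesis using z ab by simp
    qed
  qed
  have borel: "set_lebesgue_integral ?M A f = 0" if "A \<in> sets borel" for A
  proof -
    have "Int_stable (range lessThan :: real set set)"
    proof (rule Int_stableI)
      fix A B :: "real set" assume "A \<in> range lessThan" "B \<in> range lessThan"
      then obtain x y where "A = {..<x}" "B = {..<y}" by blast
      then have "A \<inter> B = {..<min x y}" by auto
      then show "A \<inter> B \<in> range lessThan" by blast
    qed
    moreover have "range lessThan \<subseteq> Pow (UNIV :: real set)" by simp
    moreover have "A \<in> sigma_sets UNIV (range lessThan)" using that by (simp add: borel_Iio)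
    ultimately show ?thesis
    proof (induction rule: sigma_sets_induct_disjoint)
      case (basic A) then show ?case using half by auto
    next
      case empty show ?case by (simp add: set_lebesgue_integral_def)
    next
      case (compl A)
      then have Ab: "A \<in> sets borel" by (simp add: borel_Iio)
      have "set_lebesgue_integral ?M (A \<union> (UNIV - A)) f
         = set_lebesgue_integral ?M A f + set_lebesgue_integral ?M (UNIV - A) f"
        using Ab by (intro set_integral_Un si) auto
      moreover have "set_lebesgue_integral ?M (A \<union> (UNIV - A)) f = set_lebesgue_integral ?M {..<b+1} f"
      proof (intro ae_set)
        show "AE t in ?M. (t \<in> A \<union> (UNIV - A)) = (t \<in> {..<b+1})"
          using AE_space by eventually_elim auto
      qed (auto intro!: bm)
      ultimately show ?case using compl half by simp
    next
      case (union A)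
      then have Ab: "A i \<in> sets borel" for i by (auto simp: borel_Iio)
      let ?A = "\<lambda>i. A i \<inter> {a..b}"
      have eq: "set_lebesgue_integral ?M (X \<inter> {a..b}) f = set_lebesgue_integral ?M X f" for X
        unfolding set_lebesgue_integral_def
        by (intro Bochner_Integration.integral_cong refl) (auto simp: indicator_def)
      have "set_lebesgue_integral ?M (\<Union>i. ?A i) f = (\<Sum>i. set_lebesgue_integral ?M (?A i) f)"
      proof (intro lebesgue_integral_countable_add)
        show "?A i \<in> sets ?M" for i using Ab by (rule bm)
        show "?A i \<inter> ?A j = {}" if "i \<noteq> j" for i j
          using union(1) that by (auto simp: disjoint_family_on_def)
        have "(\<Union>i. A i) \<inter> {a..b} \<in> sets borel" using Ab by auto
        from si[OF this] show "set_integrable ?M (\<Union>i. ?A i) f" by simp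
      qed
      also have "\<dots> = 0" using union(3) by (simp add: eq)
      finally show ?case using eq[of "\<Union>i. A i"] by simp
    qed
  qed
  show ?thesis
  proof (rule sigma_finite_measure.density_zero[OF finite_measure.axioms(1)[OF finite_measure_lebesgue_on_Icc] f])
    fix A assume "A \<in> sets ?M"
    then have AL: "A \<in> sets lebesgue" "A \<subseteq> {a..b}" by (auto simp: sets_restrict_space)
    then obtain S N N' where *: "A = S \<union> N" "N \<subseteq> N'" "N' \<in> null_sets lborel" "S \<in> sets lborel"
      by (auto elim: sets_completionE)
    have "AE t in lborel. t \<notin> N'" using *(3) by (rule AE_not_in)
    then have "AE t in lebesgue. t \<notin> N'" by (rule AE_completion)
    then have "AE t in ?M. t \<notin> N'" by (subst AE_restrict_space_iff) auto
    then have "AE t in ?M. t \<in> A \<longleftrightarrow> t \<in> S" by eventually_elim (use * in auto)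
    then have "set_lebesgue_integral ?M A f = set_lebesgue_integral ?M S f"
    proof (intro ae_set)
      show "A \<inter> {a..b} \<in> sets ?M" using AL \<open>A \<in> sets ?M\<close> by (simp add: Int_absorb2)
      show "S \<inter> {a..b} \<in> sets ?M" using * by (intro bm) simp
    qed
    then show "set_lebesgue_integral ?M A f = 0" using borel * by simp
  qed
qed

lemma finite_int_set_in_interval:
  assumes "finite X" and "nat (\<Sum>k\<in>X. \<bar>k\<bar>) \<le> n" shows "X \<subseteq> {- int n..int n}"
proof
  fix k assume "k \<in> X"
  then have "\<bar>k\<bar> \<le> (\<Sum>k\<in>X. \<bar>k\<bar>)" using assms(1) by (intro member_le_sum) auto
  also have "\<dots> \<le> int n" using assms(2) by (simp add: nat_le_iff)
  finally show "k \<in> {- int n..int n}" by auto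
qed

lemma cont_integrable_Icc:
  fixes f :: "real \<Rightarrow> complex"
  shows "continuous_on {a..b} f \<Longrightarrow> integrable (lebesgue_on {a..b}) f"
  by (rule continuous_imp_integrable_real)

lemma cont_LINT_Icc:
  fixes f :: "real \<Rightarrow> complex"
  shows "continuous_on {a..b} f \<Longrightarrow> (LINT x|lebesgue_on {a..b}. f x) = integral {a..b} f"
  by (intro lebesgue_integral_eq_integral cont_integrable_Icc) auto

lemma integrable_mult_cont:
  fixes f g :: "real \<Rightarrow> complex"
  assumes f: "integrable (lebesgue_on {a..b}) f" and g: "continuous_on {a..b} g"
  shows "integrable (lebesgue_on {a..b}) (\<lambda>x. f x * g x)"
proof -
  have gm: "g \<in> borel_measurable (lebesgue_on {a..b})" using cont_integrable_Icc[OF g] by auto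
  have "bounded (g ` {a..b})" using g by (intro compact_imp_bounded compact_continuous_image) auto
  then obtain B where B: "\<And>x. x \<in> {a..b} \<Longrightarrow> norm (g x) \<le> B" by (fastforce simp: bounded_iff)
  show ?thesis
  proof (rule Bochner_Integration.integrable_bound)
    show "integrable (lebesgue_on {a..b}) (\<lambda>x. norm (f x) * B)" using f by auto
    show "(\<lambda>x. f x * g x) \<in> borel_measurable (lebesgue_on {a..b})" using f gm by measurable
    show "AE x in lebesgue_on {a..b}. norm (f x * g x) \<le> norm (norm (f x) * B)"
    proof (rule AE_I2)
      fix x assume "x \<in> space (lebesgue_on {a..b})"
      then have "norm (g x) \<le> B" using B by simp
      then have "norm (f x) * norm (g x) \<le> norm (f x) * \<bar>B\<bar>" by (intro mult_left_mono) auto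
      then show "norm (f x * g x) \<le> norm (norm (f x) * B)" by (simp add: norm_mult abs_mult)
    qed
  qed
qed

text \<open>  Completeness of Lebesgue measure. It is needed for the integrand of the trilinear operator, which
  is known only almost everywhere to agree with an expression whose measurability is clear.\<close>

lemma borel_measurable_lebesgue_on_AE:
  fixes f g :: "real \<Rightarrow> 'b::euclidean_space"
  assumes f: "f \<in> borel_measurable (lebesgue_on {a..b})" and ae: "AE x in lebesgue_on {a..b}. f x = g x"
  shows "g \<in> borel_measurable (lebesgue_on {a..b})"
proof -
  have "(\<lambda>x. if x \<in> {a..b} then g x else 0) \<in> borel_measurable lebesgue"
  proof (rule borel_measurable_AE)
    show "(\<lambda>x. if x \<in> {a..b} then f x else 0) \<in> borel_measurable lebesgue"
      using f by (subst borel_measurable_if) auto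
    have "AE x in lebesgue. x \<in> {a..b} \<longrightarrow> f x = g x"
      using ae by (subst (asm) AE_restrict_space_iff) auto
    then show "AE x in lebesgue. (if x \<in> {a..b} then f x else 0) = (if x \<in> {a..b} then g x else 0)"
      by eventually_elim auto
  qed
  then show ?thesis by (subst (asm) borel_measurable_if) auto
qed

lemma borel_measurable_lebesgue_on_AE_lim:
  fixes f :: "nat \<Rightarrow> real \<Rightarrow> 'b::euclidean_space"
  assumes f: "\<And>n. f n \<in> borel_measurable (lebesgue_on {a..b})"
    and ae: "AE x in lebesgue_on {a..b}. (\<lambda>n. f n x) \<longlonglongrightarrow> g x"
  shows "g \<in> borel_measurable (lebesgue_on {a..b})"
proof (rule borel_measurable_lebesgue_on_AE)
  show "(\<lambda>x. lim (\<lambda>n. f n x)) \<in> borel_measurable (lebesgue_on {a..b})"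
    using f by (rule borel_measurable_lim_metric)
  show "AE x in lebesgue_on {a..b}. lim (\<lambda>n. f n x) = g x"
    using ae by eventually_elim (rule limI)
qed

text \<open>  Dominated convergence for unordered sums, in the form that matches \<open>fmult\<close>, which is defined by an
  unordered sum. An enumeration of the index type reduces it to series.\<close>

lemma has_sum_lebesgue_integral:
  fixes g :: "'i::countable \<Rightarrow> real \<Rightarrow> complex" and a b :: real
  defines "M \<equiv> lebesgue_on {a..b}"
  assumes inf: "infinite (UNIV :: 'i set)"
    and meas: "\<And>i. g i \<in> borel_measurable M"
    and B: "integrable M B"
    and bd: "AE x in M. \<forall>F. finite F \<longrightarrow> (\<Sum>i\<in>F. norm (g i x)) \<le> B x"
  shows "((\<lambda>i. integral\<^sup>L M (g i)) has_sum (LINT x|M. (\<Sum>\<^sub>\<infinity>i. g i x))) UNIV"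
    and "AE x in M. (\<lambda>i. norm (g i x)) summable_on UNIV"
    and "integrable M (\<lambda>x. \<Sum>\<^sub>\<infinity>i. g i x)"
    and "(\<lambda>i. norm (integral\<^sup>L M (g i))) summable_on UNIV"
proof -
  define e :: "nat \<Rightarrow> 'i" where "e = from_nat_into UNIV"
  have bij: "bij e" unfolding e_def using inf by (intro bij_betw_from_nat_into) auto
  have gi: "integrable M (g i)" for i
  proof (rule Bochner_Integration.integrable_bound[OF B meas])
    show "AE x in M. norm (g i x) \<le> norm (B x)" using bd
      by eventually_elim (auto dest: spec[of _ "{i}"])
  qed
  have absg: "(\<lambda>i. norm (g i x)) summable_on UNIV"
    if h: "\<forall>F. finite F \<longrightarrow> (\<Sum>i\<in>F. norm (g i x)) \<le> B x" for x
    using h by (intro nonneg_bdd_above_summable_on) (auto simp: bdd_above_def)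
  show 2: "AE x in M. (\<lambda>i. norm (g i x)) summable_on UNIV"
    using bd by eventually_elim (rule absg)
  have red: "(\<Sum>\<^sub>\<infinity>i. g i x) = (\<Sum>n. g (e n) x)" "summable (\<lambda>n. norm (g (e n) x))"
    if s: "(\<lambda>i. norm (g i x)) summable_on UNIV" for x
  proof -
    have "(\<lambda>i. norm (g i x)) summable_on e ` UNIV" using s bij by (simp add: bij_is_surj)
    then have "(\<lambda>n. norm (g (e n) x)) summable_on UNIV"
      using summable_on_reindex[of e UNIV "\<lambda>i. norm (g i x)"] bij by (simp add: o_def bij_is_inj)
    then show sn: "summable (\<lambda>n. norm (g (e n) x))" by (rule summable_on_imp_summable)
    have "((\<lambda>n. g (e n) x) has_sum (\<Sum>n. g (e n) x)) UNIV"
      by (intro norm_summable_imp_has_sum sn summable_sums summable_norm_cancel)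
    then have "((\<lambda>i. g i x) has_sum (\<Sum>n. g (e n) x)) (e ` UNIV)"
      using has_sum_reindex[of e UNIV "\<lambda>i. g i x"] bij by (simp add: o_def bij_is_inj)
    then show "(\<Sum>\<^sub>\<infinity>i. g i x) = (\<Sum>n. g (e n) x)"
      using bij by (simp add: bij_is_surj infsumI)
  qed
  have s1: "AE x in M. summable (\<lambda>n. norm (g (e n) x))"
    using 2 by eventually_elim (rule red)
  have finle: "(\<Sum>i\<in>F. (LINT x|M. norm (g i x))) \<le> integral\<^sup>L M B" if F: "finite F" for F
  proof -
    have "(\<Sum>i\<in>F. (LINT x|M. norm (g i x))) = (LINT x|M. (\<Sum>i\<in>F. norm (g i x)))"
      using gi by (intro Bochner_Integration.integral_sum[symmetric]) auto
    also have "\<dots> \<le> integral\<^sup>L M B"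
      using gi B bd F by (intro integral_mono_AE) (auto elim!: eventually_mono)
    finally show ?thesis .
  qed
  have absn: "(\<lambda>i. LINT x|M. norm (g i x)) summable_on UNIV"
    using finle by (intro nonneg_bdd_above_summable_on) (auto simp: bdd_above_def)
  then have "(\<lambda>i. LINT x|M. norm (g i x)) summable_on e ` UNIV" using bij by (simp add: bij_is_surj)
  then have "(\<lambda>n. LINT x|M. norm (g (e n) x)) summable_on UNIV"
    using summable_on_reindex[of e UNIV "\<lambda>i. LINT x|M. norm (g i x)"] bij by (simp add: o_def bij_is_inj)
  then have s2: "summable (\<lambda>n. LINT x|M. norm (g (e n) x))" by (rule summable_on_imp_summable)
  show 4: "(\<lambda>i. norm (integral\<^sup>L M (g i))) summable_on UNIV"
    by (rule Infinite_Sum.abs_summable_on_comparison_test[where g="\<lambda>i. LINT x|M. norm (g i x)"])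
       (use absn in \<open>auto simp: integral_nonneg\<close>)
  have ii: "integrable M (\<lambda>x. \<Sum>n. g (e n) x)"
    using gi s1 s2 by (intro integrable_suminf) auto
  have ae: "AE x in M. (\<Sum>\<^sub>\<infinity>i. g i x) = (\<Sum>n. g (e n) x)"
    using 2 by eventually_elim (rule red)
  have m: "(\<lambda>x. \<Sum>\<^sub>\<infinity>i. g i x) \<in> borel_measurable M"
    unfolding M_def
  proof (rule borel_measurable_lebesgue_on_AE)
    show "(\<lambda>x. \<Sum>n. g (e n) x) \<in> borel_measurable (lebesgue_on {a..b})"
      using ii by (auto simp: M_def)
    show "AE x in lebesgue_on {a..b}. (\<Sum>n. g (e n) x) = (\<Sum>\<^sub>\<infinity>i. g i x)"
      using ae unfolding M_def by eventually_elim simp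
  qed
  show "integrable M (\<lambda>x. \<Sum>\<^sub>\<infinity>i. g i x)"
    using ii ae m by (subst integrable_cong_AE) auto
  have "integral\<^sup>L M (\<lambda>x. \<Sum>n. g (e n) x) = (\<Sum>n. integral\<^sup>L M (g (e n)))"
    using gi s1 s2 by (intro integral_suminf) auto
  moreover have "((\<lambda>i. integral\<^sup>L M (g i)) has_sum (\<Sum>\<^sub>\<infinity>i. integral\<^sup>L M (g i))) UNIV"
    using abs_summable_summable[OF 4] by simp
  moreover have "(\<Sum>\<^sub>\<infinity>i. integral\<^sup>L M (g i)) = (\<Sum>n. integral\<^sup>L M (g (e n)))"
  proof -
    have "((\<lambda>i. integral\<^sup>L M (g i)) has_sum (\<Sum>\<^sub>\<infinity>i. integral\<^sup>L M (g i))) (e ` UNIV)"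
      using abs_summable_summable[OF 4] bij by (simp add: bij_is_surj)
    then have "((\<lambda>n. integral\<^sup>L M (g (e n))) has_sum (\<Sum>\<^sub>\<infinity>i. integral\<^sup>L M (g i))) UNIV"
      using has_sum_reindex[of e UNIV "\<lambda>i. integral\<^sup>L M (g i)"] bij by (simp add: o_def bij_is_inj)
    then show ?thesis by (metis has_sum_imp_sums sums_unique)
  qed
  ultimately show "((\<lambda>i. integral\<^sup>L M (g i)) has_sum (LINT x|M. (\<Sum>\<^sub>\<infinity>i. g i x))) UNIV"
    using integral_cong_AE[OF m _ ae] ii by auto
qed

section \<open>Trigonometric polynomials and uniqueness of Fourier coefficients\<close>

lemma borel_measurable_lebesgue_onI:
  "f \<in> borel_measurable borel \<Longrightarrow> f \<in> borel_measurable (lebesgue_on S)"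
  by (intro measurable_restrict_space1 measurable_completion) simp

text \<open>  Smoothness is the largest property that implies differentiability and passes to the derivative.
  This avoids formulas for iterated derivatives of sums, products and bumps.\<close>

lemma smooth_coinduct:
  assumes "P f" and step: "\<And>f. P f \<Longrightarrow> (\<forall>x. f differentiable (at x)) \<and> P (vderiv f)"
  shows "smooth f"
proof -
  have "P ((vderiv ^^ n) f)" for n by (induction n) (use assms in auto)
  then show ?thesis using step by (simp add: smooth_def)
qed

lemma smooth_vderiv: "smooth f \<Longrightarrow> smooth (vderiv f)"
  unfolding smooth_def by (metis funpow_Suc_right o_apply)

lemma smooth_differentiable: "smooth f \<Longrightarrow> f differentiable (at x)"
  unfolding smooth_def by (metis funpow_0)

lemma smooth_has_vderiv: "smooth f \<Longrightarrow> (f has_vector_derivative vderiv f x) (at x)"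
  unfolding vderiv_def using smooth_differentiable vector_derivative_works by blast

lemma smooth_continuous_on: "smooth f \<Longrightarrow> continuous_on S f"
  by (meson smooth_differentiable differentiable_imp_continuous_within continuous_at_imp_continuous_on)

lemma vderiv_eqI: "(\<And>x. (f has_vector_derivative g x) (at x)) \<Longrightarrow> vderiv f = g"
  unfolding vderiv_def using vector_derivative_at by blast

lemma differentiableI_vderiv: "(f has_vector_derivative d) (at x) \<Longrightarrow> f differentiable (at x)"
  using differentiableI_vector by blast

lemma vderiv_add_cmult:
  assumes "smooth f" "smooth g"
  shows "vderiv (\<lambda>x. f x + c * g x) = (\<lambda>x. vderiv f x + c * vderiv g x)"
  by (intro vderiv_eqI has_vector_derivative_add has_vector_derivative_mult_right smooth_has_vderiv assms)

lemma smooth_add_cmult: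
  assumes "smooth f" "smooth g" shows "smooth (\<lambda>x. f x + c * g x)"
proof (rule smooth_coinduct[where P="\<lambda>h. \<exists>f g. smooth f \<and> smooth g \<and> h = (\<lambda>x. f x + c * g x)"])
  fix h assume "\<exists>f g. smooth f \<and> smooth g \<and> h = (\<lambda>x. f x + c * g x)"
  then obtain f g where fg: "smooth f" "smooth g" and h: "h = (\<lambda>x. f x + c * g x)" by blast
  have "(h has_vector_derivative (vderiv f x + c * vderiv g x)) (at x)" for x
    unfolding h by (intro has_vector_derivative_add has_vector_derivative_mult_right smooth_has_vderiv fg)
  then show "(\<forall>x. h differentiable (at x)) \<and> (\<exists>f g. smooth f \<and> smooth g \<and> vderiv h = (\<lambda>x. f x + c * g x))"
    using vderiv_add_cmult[OF fg, of c] fg smooth_vderiv differentiableI_vderiv unfolding h by blast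
qed (use assms in blast)

lemma smooth_zero: "smooth (\<lambda>x. 0)"
  by (rule smooth_coinduct[where P="\<lambda>f. f = (\<lambda>x. 0)"]) (auto intro!: vderiv_eqI)

lemma smooth_sum_cmult:
  "finite F \<Longrightarrow> (\<And>k. k \<in> F \<Longrightarrow> smooth (g k)) \<Longrightarrow> smooth (\<lambda>x. \<Sum>k\<in>F. c k * g k x)"
proof (induction F rule: finite_induct)
  case empty then show ?case by (simp add: smooth_zero)
next
  case (insert j F)
  then have "smooth (\<lambda>x. (\<Sum>k\<in>F. c k * g k x) + c j * g j x)" by (intro smooth_add_cmult) auto
  then show ?case using insert by (simp add: add.commute)
qed

definition ek :: "int \<Rightarrow> real \<Rightarrow> complex" where "ek k x = cis (of_int k * x)"

lemma norm_ek [simp]: "cmod (ek k x) = 1" by (simp add: ek_def)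

lemma ek_mult: "ek j x * ek k x = ek (j + k) x" by (simp add: ek_def cis_mult algebra_simps)

lemma ek_0 [simp]: "ek 0 x = 1" by (simp add: ek_def)

lemma cnj_ek: "cnj (ek k x) = ek (- k) x" by (simp add: ek_def cis_cnj)

lemma ek_vderiv: "(ek k has_vector_derivative (\<i> * of_int k * ek k x)) (at x)"
proof -
  have "((\<lambda>z. exp (\<i> * (of_int k * z))) has_field_derivative
     (\<i> * of_int k * exp (\<i> * (of_int k * complex_of_real x)))) (at (complex_of_real x))"
    by (auto intro!: derivative_eq_intros)
  from has_vector_derivative_real_field[OF this]
  have "((\<lambda>x. exp (\<i> * (of_int k * complex_of_real x))) has_vector_derivative
     (\<i> * of_int k * exp (\<i> * (of_int k * complex_of_real x)))) (at x)" .
  then show ?thesis unfolding ek_def cis_conv_exp by simp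
qed

lemma continuous_on_ek [continuous_intros]: "continuous_on S (ek k)"
  by (meson ek_vderiv has_vector_derivative_continuous continuous_at_imp_continuous_on)

lemma smooth_ek: "smooth (ek k)"
proof (rule smooth_coinduct[where P="\<lambda>f. \<exists>c. f = (\<lambda>x. c * ek k x)"])
  show "\<exists>c. ek k = (\<lambda>x. c * ek k x)" by (rule exI[of _ 1]) simp
  fix f assume "\<exists>c. f = (\<lambda>x. c * ek k x)"
  then obtain c where f: "f = (\<lambda>x. c * ek k x)" by blast
  have d: "(f has_vector_derivative (c * (\<i> * of_int k)) * ek k x) (at x)" for x
    unfolding f using has_vector_derivative_mult_right[OF ek_vderiv, of c k x] by (simp add: mult.assoc)
  then show "(\<forall>x. f differentiable (at x)) \<and> (\<exists>c. vderiv f = (\<lambda>x. c * ek k x))"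
    using differentiableI_vderiv vderiv_eqI[OF d] by blast
qed

lemma vderiv_ek: "vderiv (ek k) = (\<lambda>x. \<i> * of_int k * ek k x)"
  by (intro vderiv_eqI ek_vderiv)

lemma periodic_test_ek: "periodic_test (ek k)"
proof -
  have "ek k (x + 2 * pi) = ek k x" for x
  proof -
    have "ek k (x + 2 * pi) = ek k x * cis (2 * pi * of_int k)"
      by (simp add: ek_def cis_mult algebra_simps)
    then show ?thesis by simp
  qed
  then show ?thesis by (simp add: periodic_test_def smooth_ek)
qed

lemma periodic_vderiv:
  assumes "periodic_test \<phi>" shows "periodic_test (vderiv \<phi>)"
proof -
  have s: "smooth \<phi>" and p: "\<And>x. \<phi> (x + 2 * pi) = \<phi> x" using assms by (auto simp: periodic_test_def)
  have "vderiv \<phi> (x + 2 * pi) = vderiv \<phi> x" for x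
  proof -
    have "((\<lambda>x. \<phi> (x + 2 * pi)) has_vector_derivative vderiv \<phi> (x + 2 * pi)) (at x)"
    proof -
      have "((\<lambda>x. x + 2 * pi) has_vector_derivative 1) (at x)"
        unfolding has_real_derivative_iff_has_vector_derivative[symmetric]
        by (auto intro!: derivative_eq_intros)
      from vector_diff_chain_at[OF this smooth_has_vderiv[OF s]] show ?thesis by (simp add: o_def)
    qed
    then have "(\<phi> has_vector_derivative vderiv \<phi> (x + 2 * pi)) (at x)" by (simp add: p)
    then show ?thesis using smooth_has_vderiv[OF s] vector_derivative_unique_at by blast
  qed
  then show ?thesis using s smooth_vderiv by (simp add: periodic_test_def)
qed

lemma periodic_add_cmult:
  "periodic_test f \<Longrightarrow> periodic_test g \<Longrightarrow> periodic_test (\<lambda>x. f x + c * g x)"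
  by (simp add: periodic_test_def smooth_add_cmult)

lemma periodic_sum_cmult:
  "finite F \<Longrightarrow> (\<And>k. k \<in> F \<Longrightarrow> periodic_test (g k)) \<Longrightarrow> periodic_test (\<lambda>x. \<Sum>k\<in>F. c k * g k x)"
  unfolding periodic_test_def by (auto intro!: smooth_sum_cmult)

lemma periodic_continuous_on: "periodic_test \<phi> \<Longrightarrow> continuous_on S \<phi>"
  by (simp add: periodic_test_def smooth_continuous_on)

text \<open>  Integration by parts without boundary terms, by periodicity.\<close>

lemma periodic_vderiv_mult_integral:
  assumes f: "periodic_test f" and g: "periodic_test g"
  shows "(LINT x|torus. f x * vderiv g x) = - (LINT x|torus. vderiv f x * g x)"
proof -
  note per = periodic_continuous_on[OF f] periodic_continuous_on[OF g]
    periodic_continuous_on[OF periodic_vderiv[OF f]] periodic_continuous_on[OF periodic_vderiv[OF g]]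
  have d: "((\<lambda>x. f x * g x) has_vector_derivative (f x * vderiv g x + vderiv f x * g x)) (at x within {0..2*pi})" for x
    using f g unfolding periodic_test_def
    by (intro has_vector_derivative_at_within[OF has_vector_derivative_mult] smooth_has_vderiv) auto
  have "((\<lambda>x. f x * vderiv g x + vderiv f x * g x) has_integral (f (2*pi) * g (2*pi) - f 0 * g 0)) {0..2*pi}"
    by (intro fundamental_theorem_of_calculus d) auto
  moreover have "f (2 * pi) = f 0" "g (2 * pi) = g 0"
    using f g unfolding periodic_test_def by (metis add_0)+
  ultimately have "integral {0..2*pi} (\<lambda>x. f x * vderiv g x + vderiv f x * g x) = 0"
    by (simp add: integral_unique)
  then have "(LINT x|torus. f x * vderiv g x + vderiv f x * g x) = 0"
    by (subst cont_LINT_Icc) (intro continuous_intros per, simp)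
  moreover have "(LINT x|torus. f x * vderiv g x + vderiv f x * g x)
     = (LINT x|torus. f x * vderiv g x) + (LINT x|torus. vderiv f x * g x)"
    by (intro Bochner_Integration.integral_add cont_integrable_Icc continuous_intros per)
  ultimately show ?thesis by (simp add: add_eq_0_iff)
qed

lemma ek_integral: "(LINT x|torus. ek k x) = (if k = 0 then 2 * pi else 0)"
proof (cases "k = 0")
  case True
  then show ?thesis by (simp add: measure_restrict_space scaleR_conv_of_real)
next
  case False
  have "(LINT x|torus. ek 0 x * vderiv (ek k) x) = - (LINT x|torus. vderiv (ek 0) x * ek k x)"
    by (intro periodic_vderiv_mult_integral periodic_test_ek)
  then have "(LINT x|torus. \<i> * of_int k * ek k x) = 0" by (simp add: vderiv_ek)
  then show ?thesis using False by simp
qed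

inductive trig :: "(real \<Rightarrow> complex) \<Rightarrow> bool" where
  base: "trig (\<lambda>x. c * ek k x)"
| add: "trig f \<Longrightarrow> trig g \<Longrightarrow> trig (\<lambda>x. f x + g x)"

lemma trig_mult:
  assumes "trig f" "trig g" shows "trig (\<lambda>x. f x * g x)"
  using assms
proof (induction f arbitrary: g rule: trig.induct)
  case (base c k)
  from base show ?case
  proof (induction g rule: trig.induct)
    case (base d j)
    have "(\<lambda>x. c * ek k x * (d * ek j x)) = (\<lambda>x. (c * d) * ek (k + j) x)"
      by (simp add: ek_mult[symmetric] mult_ac)
    then show ?case by (simp add: trig.base)
  next
    case (add f g)
    then show ?case using trig.add by (simp add: distrib_left)
  qed
next
  case (add f h)
  then show ?case using trig.add by (simp add: distrib_right)
qed

lemma trig_continuous: "trig f \<Longrightarrow> continuous_on S f"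
  by (induction rule: trig.induct) (auto intro!: continuous_intros)

text \<open>  This is what makes the Stone--Weierstrass theorem on the unit circle applicable: in its version for
  real polynomial functions, the restrictions to the circle are exactly trigonometric polynomials.\<close>

lemma trig_of_polynomial:
  assumes "real_polynomial_function p" shows "trig (\<lambda>x. complex_of_real (p (cis x)))"
  using assms
proof (induction rule: real_polynomial_function.induct)
  case (linear f)
  interpret bounded_linear f by fact
  have "complex_of_real (f (cis x)) = ((f 1 - \<i> * f \<i>) / 2) * ek 1 x + ((f 1 + \<i> * f \<i>) / 2) * ek (-1) x" for x
  proof -
    have "cis x = cos x *\<^sub>R 1 + sin x *\<^sub>R \<i>" by (simp add: complex_eq_iff)
    then have "f (cis x) = cos x * f 1 + sin x * f \<i>" by (simp add: add scaleR)
    then show ?thesis by (simp add: ek_def complex_eq_iff field_simps)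
  qed
  then show ?case by (simp only:) (intro trig.intros)
next
  case (const c)
  show ?case using trig.base[of c 0] by simp
next
  case (add f g) then show ?case using trig.add by simp
next
  case (mult f g) then show ?case using trig_mult by simp
qed

lemma trig_integral_zero:
  assumes f: "integrable torus f" and z: "\<And>k. (LINT x|torus. f x * ek k x) = 0" and g: "trig g"
  shows "(LINT x|torus. f x * g x) = 0"
  using g
proof (induction rule: trig.induct)
  case (base c k)
  have "(LINT x|torus. f x * (c * ek k x)) = c * (LINT x|torus. f x * ek k x)"
    by (simp add: mult.left_commute)
  then show ?case using z by simp
next
  case (add g h)
  have "(LINT x|torus. f x * g x + f x * h x) = (LINT x|torus. f x * g x) + (LINT x|torus. f x * h x)"
    using add trig_continuous by (intro Bochner_Integration.integral_add integrable_mult_cont f) auto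
  then show ?case using add by (simp add: distrib_left)
qed

text \<open>  The indicator function of \<open>{0<..<y}\<close> is a bounded pointwise limit of continuous functions on the circle,
  built from the distance to the complementary arc, and these are uniform limits of trigonometric
  polynomials. Dominated convergence shows that \<open>f\<close> has vanishing integral over every such interval.\<close>

lemma fourier_uniqueness:
  assumes f: "integrable torus f" and z: "\<And>k. (LINT x|torus. f x * ek k x) = 0"
  shows "AE x in torus. f x = 0"
proof (rule integral_zero_if_intervals_zero)
  show "integrable torus f" by fact
  fix y :: real assume y: "0 < y" "y \<le> 2 * pi"
  define K where "K = cis ` (insert 0 {y..2*pi})"
  have cisc: "continuous_on S cis" for S using continuous_on_ek[of S 1] by (simp add: ek_def[abs_def])
  have clK: "closed K" unfolding K_def
    by (intro compact_imp_closed compact_continuous_image cisc compact_insert) auto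
  have neK: "K \<noteq> {}" by (simp add: K_def)
  have inK: "cis x \<in> K \<longleftrightarrow> x \<notin> {0<..<y}" if "x \<in> {0..2*pi}" for x
  proof
    assume "x \<notin> {0<..<y}" then show "cis x \<in> K" using that by (auto simp: K_def)
  next
    assume "cis x \<in> K"
    then obtain z where z: "z \<in> insert 0 {y..2*pi}" "cis x = cis z" unfolding K_def by blast
    show "x \<notin> {0<..<y}"
    proof
      assume x: "x \<in> {0<..<y}"
      have "cis (z - x) = 1" using z by (simp add: cis_divide[symmetric])
      then have "cos (z - x) = 1" by (simp add: complex_eq_iff)
      then obtain n :: int where n: "z - x = of_int n * 2 * pi" by (auto simp: cos_one_2pi_int)
      have "z - x > -(2 * pi)" "z - x < 2 * pi" "z - x \<noteq> 0" using x z y by auto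
      then have "-1 < real_of_int n" "real_of_int n < 1" "n \<noteq> 0"
        using n mult_less_cancel_right_pos[of "2 * pi" "-1" "real_of_int n"]
          mult_less_cancel_right_pos[of "2 * pi" "real_of_int n" 1] by (auto simp: mult.assoc)
      then show False by linarith
    qed
  qed
  define h where "h n z = min 1 (real n * infdist z K)" for n z
  have hc: "continuous_on (sphere 0 1) (h n)" for n
    unfolding h_def by (intro continuous_intros)
  have "\<exists>p. real_polynomial_function p \<and> (\<forall>z\<in>sphere 0 1. \<bar>h n z - p z\<bar> < 1 / Suc n)" for n
  proof -
    have "0 < 1 / real (Suc n)" by simp
    from Stone_Weierstrass_real_polynomial_function[OF compact_sphere hc[of n] this]
    show ?thesis by metis
  qed
  then obtain p where p: "\<And>n. real_polynomial_function (p n)"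
     "\<And>n z. z \<in> sphere 0 1 \<Longrightarrow> \<bar>h n z - p n z\<bar> < 1 / Suc n" by metis
  have hlim: "(\<lambda>n. h n (cis x)) \<longlonglongrightarrow> indicator {0<..<y} x" if x: "x \<in> {0..2*pi}" for x
  proof (cases "x \<in> {0<..<y}")
    case True
    then have "infdist (cis x) K > 0"
      using inK[OF x] in_closed_iff_infdist_zero[OF clK neK, of "cis x"] infdist_nonneg[of "cis x" K] by force
    then obtain N where N: "1 < real N * infdist (cis x) K" using reals_Archimedean3 by blast
    have "\<forall>\<^sub>F n in sequentially. real n * infdist (cis x) K \<ge> 1"
      using eventually_ge_at_top[of N]
    proof eventually_elim
      case (elim n)
      then have "real N * infdist (cis x) K \<le> real n * infdist (cis x) K"
        by (intro mult_right_mono) (auto simp: infdist_nonneg)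
      then show ?case using N by linarith
    qed
    then have "\<forall>\<^sub>F n in sequentially. h n (cis x) = 1" by eventually_elim (simp add: h_def)
    then show ?thesis using True by (simp add: tendsto_eventually)
  next
    case False
    then have "infdist (cis x) K = 0" using inK[OF x] by auto
    then show ?thesis using False by (simp add: h_def)
  qed
  have plim: "(\<lambda>n. p n (cis x)) \<longlonglongrightarrow> indicator {0<..<y} x" if x: "x \<in> {0..2*pi}" for x
  proof -
    have "(\<lambda>n. h n (cis x) - p n (cis x)) \<longlonglongrightarrow> 0"
    proof (rule Lim_null_comparison)
      show "\<forall>\<^sub>F n in sequentially. norm (h n (cis x) - p n (cis x)) \<le> 1 / Suc n"
        using p(2)[of "cis x"] by (auto intro!: always_eventually less_imp_le)
      show "(\<lambda>n. 1 / real (Suc n)) \<longlonglongrightarrow> 0" by (rule LIMSEQ_Suc[OF lim_1_over_n])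
    qed
    from tendsto_diff[OF hlim[OF x] this] show ?thesis by simp
  qed
  have pbd: "\<bar>p n (cis x)\<bar> \<le> 2" for n x
  proof -
    have "\<bar>h n (cis x) - p n (cis x)\<bar> < 1 / Suc n" using p(2) by simp
    moreover have "1 / real (Suc n) \<le> 1" by simp
    moreover have "\<bar>h n (cis x)\<bar> \<le> 1" by (simp add: h_def infdist_nonneg)
    ultimately show ?thesis by linarith
  qed
  have "(\<lambda>n. LINT x|torus. f x * complex_of_real (p n (cis x))) \<longlonglongrightarrow> (LINT x|torus. f x * of_real (indicator {0<..<y} x))"
  proof (rule integral_dominated_convergence)
    show "integrable torus (\<lambda>x. norm (f x) * 2)" using f by auto
    show "(\<lambda>x. f x * complex_of_real (p n (cis x))) \<in> borel_measurable torus" for n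
      using integrable_mult_cont[OF f trig_continuous[OF trig_of_polynomial[OF p(1)]]] by auto
    show "(\<lambda>x. f x * complex_of_real (indicator {0<..<y} x)) \<in> borel_measurable torus"
      by (rule borel_measurable_times[OF borel_measurable_integrable[OF f] borel_measurable_lebesgue_onI]) auto
    show "AE x in torus. (\<lambda>n. f x * complex_of_real (p n (cis x))) \<longlonglongrightarrow> f x * complex_of_real (indicator {0<..<y} x)"
      by (rule AE_I2) (auto intro!: tendsto_intros plim)
    show "AE x in torus. norm (f x * complex_of_real (p n (cis x))) \<le> norm (f x) * 2" for n
      by (rule AE_I2) (simp add: norm_mult mult_left_mono pbd)
  qed
  moreover have "(LINT x|torus. f x * complex_of_real (p n (cis x))) = 0" for n
    by (rule trig_integral_zero[OF f z trig_of_polynomial[OF p(1)]])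
  ultimately have "(\<lambda>n. 0) \<longlonglongrightarrow> (LINT x|torus. f x * of_real (indicator {0<..<y} x))" by simp
  then have "(LINT x|torus. f x * of_real (indicator {0<..<y} x)) = 0"
    using LIMSEQ_unique tendsto_const by blast
  then show "(LINT x:{0<..<y}|torus. f x) = 0"
    by (simp add: set_lebesgue_integral_def scaleR_conv_of_real mult.commute)
qed simp

section \<open>Bessel's inequality and the Riesz--Fischer theorem\<close>

text \<open>  Fourier coefficients of a function; \<open>represents_fcoeff\<close> relates them to those of functionals.\<close>

definition fc :: "(real \<Rightarrow> complex) \<Rightarrow> int \<Rightarrow> complex" where
  "fc f k = (LINT x|torus. f x * ek (- k) x) / (2 * pi)"

definition square_integrable :: "(real \<Rightarrow> complex) \<Rightarrow> bool" where
  "square_integrable f \<longleftrightarrow> integrable torus f \<and> integrable torus (\<lambda>x. (cmod (f x))\<^sup>2)"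

lemma integral_fc: "(LINT x|torus. f x * ek (- k) x) = 2 * pi * fc f k"
  by (simp add: fc_def)

lemma trig_sum_continuous: "continuous_on S (\<lambda>x. \<Sum>k\<in>F. c k * ek k x)"
  by (intro continuous_intros)

lemma integral_mult_cnj_trig_sum:
  assumes f: "integrable torus f"
  shows "(LINT x|torus. f x * cnj (\<Sum>k\<in>F. c k * ek k x)) = 2 * pi * (\<Sum>k\<in>F. fc f k * cnj (c k))"
proof -
  have "(LINT x|torus. f x * cnj (\<Sum>k\<in>F. c k * ek k x)) = (LINT x|torus. (\<Sum>k\<in>F. cnj (c k) * (f x * ek (- k) x)))"
    by (simp add: cnj_ek sum_distrib_left mult_ac)
  also have "\<dots> = (\<Sum>k\<in>F. cnj (c k) * (LINT x|torus. f x * ek (- k) x))"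
    using integrable_mult_cont[OF f continuous_on_ek] by (subst Bochner_Integration.integral_sum) auto
  also have "\<dots> = 2 * pi * (\<Sum>k\<in>F. fc f k * cnj (c k))"
    unfolding integral_fc by (simp add: sum_distrib_left mult_ac)
  finally show ?thesis .
qed

lemma fc_trig_sum:
  assumes F: "finite F"
  shows "fc (\<lambda>x. \<Sum>k\<in>F. c k * ek k x) j = (if j \<in> F then c j else 0)"
proof -
  have "(LINT x|torus. (\<Sum>k\<in>F. c k * ek k x) * ek (- j) x) = (LINT x|torus. (\<Sum>k\<in>F. c k * ek (k - j) x))"
    by (simp add: sum_distrib_right mult.assoc ek_mult)
  also have "\<dots> = (\<Sum>k\<in>F. c k * (LINT x|torus. ek (k - j) x))"
    by (subst Bochner_Integration.integral_sum) (auto intro!: cont_integrable_Icc continuous_intros)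
  also have "\<dots> = (\<Sum>k\<in>F. if k = j then c k * (2 * pi) else 0)"
    by (intro sum.cong) (auto simp: ek_integral)
  also have "\<dots> = (if j \<in> F then c j * (2 * pi) else 0)" using F by (simp add: sum.delta)
  finally show ?thesis by (simp add: fc_def)
qed

lemma trig_sum_L2:
  assumes F: "finite F"
  shows "(LINT x|torus. (cmod (\<Sum>k\<in>F. c k * ek k x))\<^sup>2) = 2 * pi * (\<Sum>k\<in>F. (cmod (c k))\<^sup>2)"
proof -
  let ?S = "\<lambda>x. \<Sum>k\<in>F. c k * ek k x"
  have "complex_of_real (LINT x|torus. (cmod (?S x))\<^sup>2) = (LINT x|torus. complex_of_real ((cmod (?S x))\<^sup>2))"
    by (rule integral_complex_of_real[symmetric])
  also have "\<dots> = (LINT x|torus. ?S x * cnj (?S x))" by (simp only: complex_norm_square)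
  also have "\<dots> = 2 * pi * (\<Sum>k\<in>F. fc ?S k * cnj (c k))"
    by (intro integral_mult_cnj_trig_sum cont_integrable_Icc trig_sum_continuous)
  also have "(\<Sum>k\<in>F. fc ?S k * cnj (c k)) = (\<Sum>k\<in>F. complex_of_real ((cmod (c k))\<^sup>2))"
    by (intro sum.cong refl) (simp add: fc_trig_sum[OF F] complex_norm_square del: of_real_power)
  finally show ?thesis by (simp flip: of_real_mult of_real_sum of_real_power)
qed

lemma cmod_diff_square_le: "(cmod (a - b))\<^sup>2 \<le> 2 * (cmod a)\<^sup>2 + 2 * (cmod b)\<^sup>2"
proof -
  have "(cmod (a - b))\<^sup>2 \<le> (cmod a + cmod b)\<^sup>2"
    by (intro power_mono norm_triangle_ineq4) auto
  also have "\<dots> \<le> 2 * (cmod a)\<^sup>2 + 2 * (cmod b)\<^sup>2"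
    using sum_squares_bound[of "cmod a" "cmod b"] by (simp add: power2_sum)
  finally show ?thesis .
qed

lemma square_integrable_diff_trig_sum:
  assumes f: "square_integrable f"
  shows "square_integrable (\<lambda>x. f x - (\<Sum>k\<in>F. c k * ek k x))"
proof -
  let ?S = "\<lambda>x. \<Sum>k\<in>F. c k * ek k x"
  have fi: "integrable torus f" and f2: "integrable torus (\<lambda>x. (cmod (f x))\<^sup>2)"
    using f by (auto simp: square_integrable_def)
  have Si: "integrable torus ?S" by (intro cont_integrable_Icc trig_sum_continuous)
  have "integrable torus (\<lambda>x. (cmod (f x - ?S x))\<^sup>2)"
  proof (rule Bochner_Integration.integrable_bound)
    have "integrable torus (\<lambda>x. (cmod (?S x))\<^sup>2)"
      by (intro continuous_imp_integrable_real continuous_intros)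
    then show "integrable torus (\<lambda>x. 2 * (cmod (f x))\<^sup>2 + 2 * (cmod (?S x))\<^sup>2)" using f2 by auto
    show "(\<lambda>x. (cmod (f x - ?S x))\<^sup>2) \<in> borel_measurable torus" using fi Si by measurable
    show "AE x in torus. norm ((cmod (f x - ?S x))\<^sup>2) \<le> norm (2 * (cmod (f x))\<^sup>2 + 2 * (cmod (?S x))\<^sup>2)"
      using cmod_diff_square_le by (intro AE_I2) simp
  qed
  then show ?thesis using fi Si by (simp add: square_integrable_def)
qed

lemma integral_norm_diff_square:
  fixes f g :: "'a \<Rightarrow> complex"
  assumes "integrable M (\<lambda>x. (cmod (f x))\<^sup>2)" "integrable M (\<lambda>x. (cmod (g x))\<^sup>2)" "integrable M (\<lambda>x. f x * cnj (g x))"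
  shows "(LINT x|M. (cmod (f x - g x))\<^sup>2)
    = (LINT x|M. (cmod (f x))\<^sup>2) - 2 * Re (LINT x|M. f x * cnj (g x)) + (LINT x|M. (cmod (g x))\<^sup>2)"
proof -
  have "(cmod (a - b))\<^sup>2 = (cmod a)\<^sup>2 - 2 * Re (a * cnj b) + (cmod b)\<^sup>2" for a b
    by (simp only: cmod_power2) (simp add: power2_eq_square algebra_simps)
  then have "(LINT x|M. (cmod (f x - g x))\<^sup>2) = (LINT x|M. (cmod (f x))\<^sup>2 - 2 * Re (f x * cnj (g x)) + (cmod (g x))\<^sup>2)"
    by presburger
  also have "\<dots> = (LINT x|M. (cmod (f x))\<^sup>2) - 2 * (LINT x|M. Re (f x * cnj (g x))) + (LINT x|M. (cmod (g x))\<^sup>2)"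
    using assms(1,2) integrable_Re[OF assms(3)] by (simp del: times_complex.simps)
  also have "(LINT x|M. Re (f x * cnj (g x))) = Re (LINT x|M. f x * cnj (g x))"
    by (rule integral_Re[OF assms(3)])
  finally show ?thesis .
qed

text \<open>  The partial sum is the orthogonal projection of \<open>f\<close>, so the squared norms add up.\<close>

lemma bessel_identity:
  assumes f: "square_integrable f" and F: "finite F"
  shows "(LINT x|torus. (cmod (f x - (\<Sum>k\<in>F. fc f k * ek k x)))\<^sup>2)
    = (LINT x|torus. (cmod (f x))\<^sup>2) - 2 * pi * (\<Sum>k\<in>F. (cmod (fc f k))\<^sup>2)"
proof -
  let ?S = "\<lambda>x. \<Sum>k\<in>F. fc f k * ek k x"
  have fi: "integrable torus f" and f2: "integrable torus (\<lambda>x. (cmod (f x))\<^sup>2)"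
    using f by (auto simp: square_integrable_def)
  have c: "continuous_on {0..2*pi} (\<lambda>x. cnj (?S x))" by (intro continuous_intros)
  have i1: "integrable torus (\<lambda>x. f x * cnj (?S x))" by (rule integrable_mult_cont[OF fi c])
  have i3: "integrable torus (\<lambda>x. (cmod (?S x))\<^sup>2)"
    using square_integrable_diff_trig_sum[of "\<lambda>x. 0" "\<lambda>k. - fc f k" F]
    by (simp add: square_integrable_def sum_negf)
  have "(LINT x|torus. (cmod (f x - ?S x))\<^sup>2)
      = (LINT x|torus. (cmod (f x))\<^sup>2) - 2 * Re (LINT x|torus. f x * cnj (?S x)) + (LINT x|torus. (cmod (?S x))\<^sup>2)"
    by (rule integral_norm_diff_square[OF f2 i3 i1])
  also have "(LINT x|torus. f x * cnj (?S x)) = complex_of_real (2 * pi * (\<Sum>k\<in>F. (cmod (fc f k))\<^sup>2))"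
    unfolding integral_mult_cnj_trig_sum[OF fi] by (simp flip: complex_norm_square)
  finally show ?thesis by (simp only: trig_sum_L2[OF F] Re_complex_of_real)
qed

lemma bessel_inequality:
  assumes f: "square_integrable f" and F: "finite F"
  shows "2 * pi * (\<Sum>k\<in>F. (cmod (fc f k))\<^sup>2) \<le> (LINT x|torus. (cmod (f x))\<^sup>2)"
proof -
  have "0 \<le> (LINT x|torus. (cmod (f x - (\<Sum>k\<in>F. fc f k * ek k x)))\<^sup>2)"
    by (rule Bochner_Integration.integral_nonneg) simp
  then show ?thesis using bessel_identity[OF f F] by simp
qed

lemma fc_square_summable:
  assumes f: "square_integrable f" shows "(\<lambda>k. (cmod (fc f k))\<^sup>2) summable_on UNIV"
proof (rule nonneg_bdd_above_summable_on)
  show "bdd_above (sum (\<lambda>k. (cmod (fc f k))\<^sup>2) ` {F. F \<subseteq> UNIV \<and> finite F})"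
    using bessel_inequality[OF f] pi_gt_zero
    by (intro bdd_aboveI2[where M="(LINT x|torus. (cmod (f x))\<^sup>2) / (2 * pi)"]) (auto simp: field_simps)
qed simp

text \<open>  The completeness of \<open>L\<^sup>2\<close> in disguise. Along a sparse sequence of partial sums the increments have
  \<open>L\<^sup>2\<close> norms, hence also \<open>L\<^sup>1\<close> norms, of geometric decay; the series of increments therefore
  converges absolutely almost everywhere, to a function \<open>f\<close> with an integrable majorant. Dominated
  convergence identifies its coefficients and Fatou's lemma bounds its \<open>L\<^sup>2\<close> norm from above; Bessel's
  inequality gives the reverse bound.\<close>

lemma riesz_fischer:
  assumes c: "(\<lambda>k. (cmod (c k))\<^sup>2) summable_on UNIV"
  shows "\<exists>f. square_integrable f \<and> (\<forall>k. fc f k = c k)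
           \<and> (LINT x|torus. (cmod (f x))\<^sup>2) = 2 * pi * (\<Sum>\<^sub>\<infinity>k. (cmod (c k))\<^sup>2)"
proof -
  define s where "s = (\<Sum>\<^sub>\<infinity>k. (cmod (c k))\<^sup>2)"
  have le_s: "(\<Sum>k\<in>F. (cmod (c k))\<^sup>2) \<le> s" if "finite F" for F
    unfolding s_def using that by (intro finite_sum_le_infsum c) auto
  \<comment> \<open>squared norms \<open>4\<^sup>-\<^sup>n\<close>, so that the norms are summable\<close>
  have "\<exists>N. \<forall>M\<ge>N. s - (\<Sum>k\<in>{-int M..int M}. (cmod (c k))\<^sup>2) \<le> (1/4) ^ n" for n :: nat
  proof -
    have "((\<lambda>k. (cmod (c k))\<^sup>2) has_sum s) UNIV" unfolding s_def using c by simp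
    then have "\<forall>\<^sub>F F in finite_subsets_at_top UNIV. dist (\<Sum>k\<in>F. (cmod (c k))\<^sup>2) s < (1/4) ^ n"
      unfolding has_sum_def by (rule tendstoD) simp
    then obtain F0 where F0: "finite F0" "\<And>F. finite F \<Longrightarrow> F0 \<subseteq> F \<Longrightarrow> dist (\<Sum>k\<in>F. (cmod (c k))\<^sup>2) s < (1/4) ^ n"
      unfolding eventually_finite_subsets_at_top by auto
    define N where "N = nat (\<Sum>k\<in>F0. \<bar>k\<bar>)"
    have "F0 \<subseteq> {-int M..int M}" if "N \<le> M" for M
      using finite_int_set_in_interval[OF F0(1)] that by (simp add: N_def)
    then have "dist (\<Sum>k\<in>{-int M..int M}. (cmod (c k))\<^sup>2) s < (1/4) ^ n" if "N \<le> M" for M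
      using F0(2) that by simp
    then show ?thesis by (intro exI[of _ N]) (force simp: dist_real_def)
  qed
  then obtain N where N: "\<And>n M. N n \<le> M \<Longrightarrow> s - (\<Sum>k\<in>{-int M..int M}. (cmod (c k))\<^sup>2) \<le> (1/4) ^ n"
    by metis
  \<comment> \<open>increasing, at least \<open>N n\<close>, and unbounded\<close>
  define M where "M n = n + (\<Sum>i\<le>n. N i)" for n
  define F where "F n = {-int (M n)..int (M n)}" for n
  define S where "S n x = (\<Sum>k\<in>F n. c k * ek k x)" for n x
  define g where "g n x = (\<Sum>k\<in>F (Suc n) - F n. c k * ek k x)" for n x
  have finF: "finite (F n)" for n by (simp add: F_def)
  have MN: "N n \<le> M n" for n
    unfolding M_def using member_le_sum[of n "{..n}" N] by simp
  have Fmono: "F n \<subseteq> F (Suc n)" for n by (auto simp: F_def M_def)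
  have Sg: "S (Suc n) x = S n x + g n x" for n x
    unfolding S_def g_def using sum.subset_diff[OF Fmono finF, of "\<lambda>k. c k * ek k x" n] by simp
  have Ssum: "S n x = S 0 x + (\<Sum>i<n. g i x)" for n x
    by (induction n) (simp_all add: Sg)
  have ci: "integrable torus (S n)" "integrable torus (g n)" for n
    unfolding S_def g_def by (intro cont_integrable_Icc trig_sum_continuous)+
  have g2: "(LINT x|torus. (cmod (g n x))\<^sup>2) \<le> 2 * pi * (1/4) ^ n" for n
  proof -
    have "(\<Sum>k\<in>F (Suc n) - F n. (cmod (c k))\<^sup>2) = (\<Sum>k\<in>F (Suc n). (cmod (c k))\<^sup>2) - (\<Sum>k\<in>F n. (cmod (c k))\<^sup>2)"
      by (intro sum_diff finF Fmono)
    also have "\<dots> \<le> (1/4) ^ n"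
      using le_s[OF finF[of "Suc n"]] N[OF MN[of n]] unfolding F_def by linarith
    finally show ?thesis unfolding g_def using finF by (subst trig_sum_L2) auto
  qed
  have g2i: "integrable torus (\<lambda>x. (cmod (g n x))\<^sup>2)" for n
    using square_integrable_diff_trig_sum[of "\<lambda>x. 0" "\<lambda>k. - c k" "F (Suc n) - F n"]
    by (simp add: square_integrable_def sum_negf g_def)
  have g1: "(LINT x|torus. cmod (g n x)) \<le> 2 * pi * (1/2) ^ n" for n
  proof -
    let ?e = "(1/2::real) ^ n"
    have "(LINT x|torus. cmod (g n x)) \<le> (LINT x|torus. (?e + (cmod (g n x))\<^sup>2 / ?e) / 2)"
    proof (rule integral_mono)
      show "integrable torus (\<lambda>x. (?e + (cmod (g n x))\<^sup>2 / ?e) / 2)"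
        using g2i finite_measure.integrable_const[OF finite_measure_lebesgue_on_Icc]
        by (intro integrable_divide Bochner_Integration.integrable_add) auto
      fix x
      \<comment> \<open>Young's inequality with parameter \<open>2\<^sup>-\<^sup>n\<close> balances the two terms\<close>
      have "2 * ?e * cmod (g n x) \<le> ?e\<^sup>2 + (cmod (g n x))\<^sup>2" by (rule sum_squares_bound)
      then show "cmod (g n x) \<le> (?e + (cmod (g n x))\<^sup>2 / ?e) / 2"
        by (simp add: field_simps power2_eq_square)
    qed (use ci in auto)
    also have "\<dots> = (2 * pi * ?e + (LINT x|torus. (cmod (g n x))\<^sup>2) / ?e) / 2"
      using g2i finite_measure.integrable_const[OF finite_measure_lebesgue_on_Icc]
      by (simp add: measure_restrict_space)
    also have "\<dots> \<le> (2 * pi * ?e + (2 * pi * (1/4) ^ n) / ?e) / 2"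
      using g2 by (intro divide_right_mono add_left_mono) auto
    also have "(1/4::real) ^ n = ?e * ?e" by (simp flip: power_mult_distrib)
    finally show ?thesis by simp
  qed
  have sumi: "summable (\<lambda>n. LINT x|torus. cmod (g n x))"
    by (rule summable_comparison_test'[where g="\<lambda>n. 2 * pi * (1/2) ^ n" and N=0])
       (use g1 in \<open>auto intro!: summable_mult summable_geometric\<close>)
  have aes: "AE x in torus. summable (\<lambda>n. cmod (g n x))"
  proof -
    have "(\<integral>\<^sup>+x. (\<Sum>n. ennreal (cmod (g n x))) \<partial>torus) = (\<Sum>n. \<integral>\<^sup>+x. ennreal (cmod (g n x)) \<partial>torus)"
      using ci by (intro nn_integral_suminf) auto
    also have "\<dots> = (\<Sum>n. ennreal (LINT x|torus. cmod (g n x)))"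
      using ci by (intro suminf_cong nn_integral_eq_integral) auto
    also have "\<dots> = ennreal (\<Sum>n. (LINT x|torus. cmod (g n x)))"
      by (intro suminf_ennreal2 sumi) simp
    finally have "(\<integral>\<^sup>+x. (\<Sum>n. ennreal (cmod (g n x))) \<partial>torus) \<noteq> \<infinity>" by simp
    then have "AE x in torus. (\<Sum>n. ennreal (cmod (g n x))) \<noteq> \<infinity>"
      using ci by (intro nn_integral_PInf_AE) auto
    then show ?thesis by eventually_elim (auto intro: summable_suminf_not_top)
  qed
  define f where "f x = S 0 x + (\<Sum>n. g n x)" for x
  define G where "G x = cmod (S 0 x) + (\<Sum>n. cmod (g n x))" for x
  have Gi: "integrable torus G"
    unfolding G_def
  proof (intro Bochner_Integration.integrable_add)
    show "integrable torus (\<lambda>x. \<Sum>n. cmod (g n x))"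
      by (rule integrable_suminf) (use ci(2) aes sumi in simp_all)
  qed (use ci(1) in simp)
  have fi: "integrable torus f"
    unfolding f_def by (rule Bochner_Integration.integrable_add[OF ci(1) integrable_suminf[OF ci(2) aes sumi]])
  have lim: "AE x in torus. (\<lambda>n. S n x) \<longlonglongrightarrow> f x"
    using aes
  proof eventually_elim
    case (elim x)
    then have "(\<lambda>n. \<Sum>i<n. g i x) \<longlonglongrightarrow> (\<Sum>n. g n x)"
      by (rule summable_LIMSEQ[OF summable_norm_cancel])
    then have "(\<lambda>n. S 0 x + (\<Sum>i<n. g i x)) \<longlonglongrightarrow> f x" unfolding f_def by (rule tendsto_add[OF tendsto_const])
    then show ?case by (simp only: Ssum[symmetric])
  qed
  have dom: "AE x in torus. cmod (S n x) \<le> G x" for n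
    using aes
  proof eventually_elim
    case (elim x)
    have "cmod (S n x) \<le> cmod (S 0 x) + cmod (\<Sum>i<n. g i x)"
      using Ssum[of n x] norm_triangle_ineq by metis
    also have "cmod (\<Sum>i<n. g i x) \<le> (\<Sum>i<n. cmod (g i x))" by (rule norm_sum)
    also have "\<dots> \<le> (\<Sum>i. cmod (g i x))" using elim by (intro sum_le_suminf) auto
    finally show ?case by (simp add: G_def)
  qed
  have ekm: "ek k \<in> borel_measurable torus" for k
    by (intro borel_measurable_integrable cont_integrable_Icc continuous_on_ek)
  have coef: "fc f k = c k" for k
  proof -
    have "(\<lambda>n. LINT x|torus. S n x * ek (- k) x) \<longlonglongrightarrow> (LINT x|torus. f x * ek (- k) x)"
    proof (rule integral_dominated_convergence[where w=G])
      show "AE x in torus. (\<lambda>n. S n x * ek (- k) x) \<longlonglongrightarrow> f x * ek (- k) x"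
        using lim by eventually_elim (intro tendsto_intros)
      show "AE x in torus. norm (S n x * ek (- k) x) \<le> G x" for n
        using dom by (simp add: norm_mult)
    qed (use fi ci ekm Gi in auto)
    moreover have "\<forall>\<^sub>F n in sequentially. (LINT x|torus. S n x * ek (- k) x) = 2 * pi * c k"
      using eventually_ge_at_top[of "nat \<bar>k\<bar>"]
    proof eventually_elim
      case (elim n)
      moreover have "n \<le> M n" by (simp add: M_def)
      ultimately have "k \<in> F n" by (auto simp: F_def)
      then show ?case unfolding integral_fc S_def using fc_trig_sum[OF finF] by simp
    qed
    from LIMSEQ_unique[OF calculation tendsto_eventually[OF this]]
    have "(LINT x|torus. f x * ek (- k) x) = 2 * pi * c k" .
    then show ?thesis by (simp add: fc_def)
  qed
  have fatou: "(\<integral>\<^sup>+x. ennreal ((cmod (f x))\<^sup>2) \<partial>torus) \<le> ennreal (2 * pi * s)"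
  proof -
    have "(\<integral>\<^sup>+x. ennreal ((cmod (f x))\<^sup>2) \<partial>torus) = (\<integral>\<^sup>+x. liminf (\<lambda>n. ennreal ((cmod (S n x))\<^sup>2)) \<partial>torus)"
    proof (rule nn_integral_cong_AE)
      show "AE x in torus. ennreal ((cmod (f x))\<^sup>2) = liminf (\<lambda>n. ennreal ((cmod (S n x))\<^sup>2))"
        using lim
      proof eventually_elim
        case (elim x)
        then have "(\<lambda>n. ennreal ((cmod (S n x))\<^sup>2)) \<longlonglongrightarrow> ennreal ((cmod (f x))\<^sup>2)"
          by (intro tendsto_intros)
        from lim_imp_Liminf[OF sequentially_bot this] show ?case by simp
      qed
    qed
    also have "\<dots> \<le> liminf (\<lambda>n. \<integral>\<^sup>+x. ennreal ((cmod (S n x))\<^sup>2) \<partial>torus)"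
      using ci by (intro nn_integral_liminf) auto
    also have "\<dots> \<le> liminf (\<lambda>n::nat. ennreal (2 * pi * s))"
    proof (intro Liminf_mono always_eventually allI)
      fix n
      have "integrable torus (\<lambda>x. (cmod (S n x))\<^sup>2)"
        using square_integrable_diff_trig_sum[of "\<lambda>x. 0" "\<lambda>k. - c k" "F n"]
        by (simp add: square_integrable_def sum_negf S_def)
      then have "(\<integral>\<^sup>+x. ennreal ((cmod (S n x))\<^sup>2) \<partial>torus) = ennreal (LINT x|torus. (cmod (S n x))\<^sup>2)"
        by (intro nn_integral_eq_integral) auto
      also have "\<dots> \<le> ennreal (2 * pi * s)"
        unfolding S_def using trig_sum_L2[OF finF] le_s[OF finF] by (intro ennreal_leI) simp
      finally show "(\<integral>\<^sup>+x. ennreal ((cmod (S n x))\<^sup>2) \<partial>torus) \<le> ennreal (2 * pi * s)" .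
    qed
    finally show ?thesis by (simp add: Liminf_const)
  qed
  have f2i: "integrable torus (\<lambda>x. (cmod (f x))\<^sup>2)"
  proof (rule integrableI_bounded)
    show "(\<lambda>x. (cmod (f x))\<^sup>2) \<in> borel_measurable torus" using fi by measurable
    show "(\<integral>\<^sup>+x. ennreal (norm ((cmod (f x))\<^sup>2)) \<partial>torus) < \<infinity>"
      using order_le_less_trans[OF fatou ennreal_less_top] by simp
  qed
  have sq: "square_integrable f" using fi f2i by (simp add: square_integrable_def)
  have "(LINT x|torus. (cmod (f x))\<^sup>2) \<le> 2 * pi * s"
  proof -
    have "0 \<le> s" using le_s[of "{}"] by simp
    have "ennreal (LINT x|torus. (cmod (f x))\<^sup>2) \<le> ennreal (2 * pi * s)"
      using fatou nn_integral_eq_integral[OF f2i] by simp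
    then show ?thesis using \<open>0 \<le> s\<close> by (simp add: ennreal_le_iff)
  qed
  moreover have "2 * pi * s \<le> (LINT x|torus. (cmod (f x))\<^sup>2)"
  proof -
    have "s \<le> (LINT x|torus. (cmod (f x))\<^sup>2) / (2 * pi)"
      unfolding s_def
    proof (intro infsum_le_finite_sums c)
      fix F :: "int set" assume "finite F"
      from bessel_inequality[OF sq this]
      show "(\<Sum>k\<in>F. (cmod (c k))\<^sup>2) \<le> (LINT x|torus. (cmod (f x))\<^sup>2) / (2 * pi)"
        by (simp add: coef field_simps)
    qed
    then show ?thesis by (simp add: field_simps)
  qed
  ultimately show ?thesis using sq coef s_def by (intro exI[of _ f]) auto
qed

section \<open>Parseval's identity and Fourier coefficients of products\<close>

corollary fc_determines_function:
  assumes f: "integrable torus f" and g: "integrable torus g" and eq: "\<And>k. fc f k = fc g k"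
  shows "AE x in torus. f x = g x"
proof -
  have "AE x in torus. f x - g x = 0"
  proof (rule fourier_uniqueness)
    show "integrable torus (\<lambda>x. f x - g x)" using f g by simp
    fix k
    have "(LINT x|torus. (f x - g x) * ek k x) = (LINT x|torus. f x * ek (- (- k)) x) - (LINT x|torus. g x * ek (- (- k)) x)"
      using integrable_mult_cont[OF f continuous_on_ek] integrable_mult_cont[OF g continuous_on_ek]
      by (simp add: left_diff_distrib)
    then show "(LINT x|torus. (f x - g x) * ek k x) = 0" unfolding integral_fc eq by simp
  qed
  then show ?thesis by eventually_elim simp
qed

text \<open>  An integrable function with square summable coefficients is almost everywhere the function supplied
  by the Riesz--Fischer theorem. Square integrability is thus a conclusion; this matters because the
  density of a functional is only known to be integrable.\<close>

lemma parseval: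
  assumes f: "integrable torus f" and c: "(\<lambda>k. (cmod (fc f k))\<^sup>2) summable_on UNIV"
  shows "square_integrable f"
    and "(LINT x|torus. (cmod (f x))\<^sup>2) = 2 * pi * (\<Sum>\<^sub>\<infinity>k. (cmod (fc f k))\<^sup>2)"
proof -
  obtain g where g: "square_integrable g" "\<And>k. fc g k = fc f k"
    "(LINT x|torus. (cmod (g x))\<^sup>2) = 2 * pi * (\<Sum>\<^sub>\<infinity>k. (cmod (fc f k))\<^sup>2)"
    using riesz_fischer[OF c] by blast
  have gi: "integrable torus g" and g2: "integrable torus (\<lambda>x. (cmod (g x))\<^sup>2)"
    using g(1) by (auto simp: square_integrable_def)
  have "AE x in torus. g x = f x" by (rule fc_determines_function[OF gi f g(2)])
  then have ae: "AE x in torus. (cmod (g x))\<^sup>2 = (cmod (f x))\<^sup>2" by eventually_elim simp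
  have m: "(\<lambda>x. (cmod (f x))\<^sup>2) \<in> borel_measurable torus" using f by measurable
  show "square_integrable f"
    using integrable_cong_AE_imp[OF g2 m ae] f by (simp add: square_integrable_def)
  have "(LINT x|torus. (cmod (g x))\<^sup>2) = (LINT x|torus. (cmod (f x))\<^sup>2)"
    using g2 by (intro integral_cong_AE m ae) auto
  then show "(LINT x|torus. (cmod (f x))\<^sup>2) = 2 * pi * (\<Sum>\<^sub>\<infinity>k. (cmod (fc f k))\<^sup>2)"
    using g(3) by simp
qed

lemma integral_cauchy_schwarz:
  fixes f g :: "'a \<Rightarrow> complex"
  assumes f: "f \<in> borel_measurable M" "integrable M (\<lambda>x. (cmod (f x))\<^sup>2)"
    and g: "g \<in> borel_measurable M" "integrable M (\<lambda>x. (cmod (g x))\<^sup>2)"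
  shows "integrable M (\<lambda>x. f x * g x)"
    and "(LINT x|M. cmod (f x * g x))\<^sup>2 \<le> (LINT x|M. (cmod (f x))\<^sup>2) * (LINT x|M. (cmod (g x))\<^sup>2)"
proof -
  have m: "(\<lambda>x. f x * g x) \<in> borel_measurable M" using f g by measurable
  have "(\<integral>\<^sup>+x. ennreal (cmod (f x * g x)) \<partial>M)\<^sup>2
      = (\<integral>\<^sup>+x. ennreal (cmod (f x)) * ennreal (cmod (g x)) \<partial>M)\<^sup>2"
    by (simp add: norm_mult ennreal_mult)
  also have "\<dots> \<le> (\<integral>\<^sup>+x. (ennreal (cmod (f x)))\<^sup>2 \<partial>M) * (\<integral>\<^sup>+x. (ennreal (cmod (g x)))\<^sup>2 \<partial>M)"
    using f g by (intro Cauchy_Schwarz_nn_integral) auto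
  also have "\<dots> = (\<integral>\<^sup>+x. ennreal ((cmod (f x))\<^sup>2) \<partial>M) * (\<integral>\<^sup>+x. ennreal ((cmod (g x))\<^sup>2) \<partial>M)"
    by (simp add: ennreal_power)
  also have "\<dots> = ennreal ((LINT x|M. (cmod (f x))\<^sup>2) * (LINT x|M. (cmod (g x))\<^sup>2))"
    using f g by (simp add: nn_integral_eq_integral ennreal_mult)
  finally have *: "(\<integral>\<^sup>+x. ennreal (cmod (f x * g x)) \<partial>M)\<^sup>2
      \<le> ennreal ((LINT x|M. (cmod (f x))\<^sup>2) * (LINT x|M. (cmod (g x))\<^sup>2))" .
  have "(\<integral>\<^sup>+x. ennreal (cmod (f x * g x)) \<partial>M)\<^sup>2 < \<infinity>"
    using * by (rule order_le_less_trans) simp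
  then have "(\<integral>\<^sup>+x. ennreal (cmod (f x * g x)) \<partial>M) < \<infinity>" by (simp add: power_less_top_ennreal)
  then show i: "integrable M (\<lambda>x. f x * g x)" using m by (intro integrableI_bounded) auto
  have "(\<integral>\<^sup>+x. ennreal (cmod (f x * g x)) \<partial>M) = ennreal (LINT x|M. cmod (f x * g x))"
    using i by (intro nn_integral_eq_integral) auto
  then show "(LINT x|M. cmod (f x * g x))\<^sup>2 \<le> (LINT x|M. (cmod (f x))\<^sup>2) * (LINT x|M. (cmod (g x))\<^sup>2)"
    using * by (simp add: ennreal_power ennreal_le_iff)
qed

lemma square_integrable_mult:
  assumes "square_integrable f" "square_integrable g" shows "integrable torus (\<lambda>x. f x * g x)"
  using assms by (intro integral_cauchy_schwarz) (auto simp: square_integrable_def)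

lemma fourier_partial_sums_L2:
  assumes f: "square_integrable f"
  shows "((\<lambda>F. LINT x|torus. (cmod (f x - (\<Sum>k\<in>F. fc f k * ek k x)))\<^sup>2) \<longlongrightarrow> 0) (finite_subsets_at_top UNIV)"
proof -
  let ?s = "\<Sum>\<^sub>\<infinity>k. (cmod (fc f k))\<^sup>2"
  have fi: "integrable torus f" using f by (simp add: square_integrable_def)
  note c = fc_square_summable[OF f]
  have "((\<lambda>F. \<Sum>k\<in>F. (cmod (fc f k))\<^sup>2) \<longlongrightarrow> ?s) (finite_subsets_at_top UNIV)"
    using c by (simp add: has_sum_def[symmetric])
  then have "((\<lambda>F. 2 * pi * ?s - 2 * pi * (\<Sum>k\<in>F. (cmod (fc f k))\<^sup>2)) \<longlongrightarrow> 2 * pi * ?s - 2 * pi * ?s) (finite_subsets_at_top UNIV)"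
    by (intro tendsto_intros)
  moreover have "\<forall>\<^sub>F F in finite_subsets_at_top UNIV. 2 * pi * ?s - 2 * pi * (\<Sum>k\<in>F. (cmod (fc f k))\<^sup>2)
      = (LINT x|torus. (cmod (f x - (\<Sum>k\<in>F. fc f k * ek k x)))\<^sup>2)"
  proof (rule eventually_finite_subsets_at_top_weakI)
    fix F :: "int set" assume "finite F"
    then show "2 * pi * ?s - 2 * pi * (\<Sum>k\<in>F. (cmod (fc f k))\<^sup>2)
      = (LINT x|torus. (cmod (f x - (\<Sum>k\<in>F. fc f k * ek k x)))\<^sup>2)"
      using bessel_identity[OF f] parseval(2)[OF fi c] by simp
  qed
  ultimately show ?thesis using Lim_transform_eventually by fastforce
qed

lemma ek_diff: "ek (k - n) x = ek k x * ek (- n) x" by (simp add: ek_mult)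

text \<open>  Exact for a trigonometric polynomial in place of \<open>f\<close>; in general the error is at most the \<open>L\<^sup>2\<close>
  distance of \<open>f\<close> to its partial sum times the \<open>L\<^sup>2\<close> norm of \<open>g\<close>.\<close>

lemma fc_mult_has_sum:
  assumes f: "square_integrable f" and g: "square_integrable g"
  shows "((\<lambda>k. fc f k * fc g (n - k)) has_sum fc (\<lambda>x. f x * g x) n) UNIV"
proof -
  let ?S = "\<lambda>F x. \<Sum>k\<in>F. fc f k * ek k x"
  have gi: "integrable torus g" and g2: "integrable torus (\<lambda>x. (cmod (g x))\<^sup>2)"
    using g by (auto simp: square_integrable_def)
  have fg: "integrable torus (\<lambda>x. f x * g x)" by (rule square_integrable_mult[OF f g])
  have i0: "integrable torus (\<lambda>x. f x * g x * ek (- n) x)"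
    by (rule integrable_mult_cont[OF fg continuous_on_ek])
  have iS: "integrable torus (\<lambda>x. g x * (?S F x * ek (- n) x))" for F
    by (rule integrable_mult_cont[OF gi]) (intro continuous_intros)
  have eq: "(LINT x|torus. g x * (?S F x * ek (- n) x)) = 2 * pi * (\<Sum>k\<in>F. fc f k * fc g (n - k))" for F
  proof -
    have "(LINT x|torus. g x * (?S F x * ek (- n) x)) = (LINT x|torus. (\<Sum>k\<in>F. fc f k * (g x * ek (- (n - k)) x)))"
      by (intro Bochner_Integration.integral_cong refl)
         (simp add: sum_distrib_left sum_distrib_right mult_ac ek_diff)
    also have "\<dots> = (\<Sum>k\<in>F. fc f k * (LINT x|torus. g x * ek (- (n - k)) x))"
      using integrable_mult_cont[OF gi continuous_on_ek] by (subst Bochner_Integration.integral_sum) auto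
    also have "\<dots> = 2 * pi * (\<Sum>k\<in>F. fc f k * fc g (n - k))"
      unfolding integral_fc by (simp add: sum_distrib_left mult_ac)
    finally show ?thesis .
  qed
  let ?G = "LINT x|torus. (cmod (g x))\<^sup>2"
  have bound: "cmod ((\<Sum>k\<in>F. fc f k * fc g (n - k)) - fc (\<lambda>x. f x * g x) n)
      \<le> sqrt ((LINT x|torus. (cmod (f x - ?S F x))\<^sup>2) * ?G) / (2 * pi)" for F
  proof -
    have d: "square_integrable (\<lambda>x. f x - ?S F x)" by (rule square_integrable_diff_trig_sum[OF f])
    have "2 * pi * fc (\<lambda>x. f x * g x) n - 2 * pi * (\<Sum>k\<in>F. fc f k * fc g (n - k))
        = (LINT x|torus. f x * g x * ek (- n) x - g x * (?S F x * ek (- n) x))"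
      using i0 iS eq integral_fc[of "\<lambda>x. f x * g x" n] by simp
    also have "\<dots> = (LINT x|torus. (f x - ?S F x) * g x * ek (- n) x)"
      by (intro Bochner_Integration.integral_cong refl) (simp add: algebra_simps)
    finally have e: "2 * pi * fc (\<lambda>x. f x * g x) n - 2 * pi * (\<Sum>k\<in>F. fc f k * fc g (n - k))
        = (LINT x|torus. (f x - ?S F x) * g x * ek (- n) x)" .
    have "cmod (LINT x|torus. (f x - ?S F x) * g x * ek (- n) x) \<le> (LINT x|torus. cmod ((f x - ?S F x) * g x * ek (- n) x))"
      by (rule integral_norm_bound)
    also have "\<dots> = (LINT x|torus. cmod ((f x - ?S F x) * g x))" by (simp add: norm_mult)
    also have "\<dots> \<le> sqrt ((LINT x|torus. (cmod (f x - ?S F x))\<^sup>2) * ?G)"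
      using d gi g2 by (intro real_le_rsqrt integral_cauchy_schwarz(2)) (auto simp: square_integrable_def)
    finally have "cmod (2 * pi * ((\<Sum>k\<in>F. fc f k * fc g (n - k)) - fc (\<lambda>x. f x * g x) n))
       \<le> sqrt ((LINT x|torus. (cmod (f x - ?S F x))\<^sup>2) * ?G)"
      unfolding e[symmetric] by (simp add: norm_minus_commute right_diff_distrib)
    moreover have "cmod z \<le> R / r" if "cmod (complex_of_real r * z) \<le> R" "0 < r" for z R r
      using that by (simp add: norm_mult field_simps)
    ultimately show ?thesis by simp
  qed
  have "((\<lambda>F. (\<Sum>k\<in>F. fc f k * fc g (n - k)) - fc (\<lambda>x. f x * g x) n) \<longlongrightarrow> 0) (finite_subsets_at_top UNIV)"
  proof (rule Lim_null_comparison)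
    show "\<forall>\<^sub>F F in finite_subsets_at_top UNIV. norm ((\<Sum>k\<in>F. fc f k * fc g (n - k)) - fc (\<lambda>x. f x * g x) n)
      \<le> sqrt ((LINT x|torus. (cmod (f x - ?S F x))\<^sup>2) * ?G) / (2 * pi)"
      by (intro always_eventually allI bound)
    have "((\<lambda>F. sqrt ((LINT x|torus. (cmod (f x - ?S F x))\<^sup>2) * ?G) / (2 * pi)) \<longlongrightarrow> sqrt (0 * ?G) / (2 * pi)) (finite_subsets_at_top UNIV)"
      by (intro tendsto_intros fourier_partial_sums_L2[OF f]) auto
    then show "((\<lambda>F. sqrt ((LINT x|torus. (cmod (f x - ?S F x))\<^sup>2) * ?G) / (2 * pi)) \<longlongrightarrow> 0) (finite_subsets_at_top UNIV)" by simp
  qed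
  then show ?thesis unfolding has_sum_def by (rule LIM_zero_cancel)
qed

lemma infinite_int: "infinite (UNIV :: int set)" by (rule infinite_UNIV_char_0)

text \<open>  The product of two square integrable functions is in general only integrable, so
  \<open>fc_mult_has_sum\<close> cannot be iterated. For the third factor of the trilinear operator the inverse
  derivative makes the Fourier series absolutely convergent, and such a series may multiply any
  integrable \<open>h\<close>.\<close>

lemma fc_mult_abs_summable:
  assumes c: "(\<lambda>k. cmod (c k)) summable_on UNIV" and h: "integrable torus h"
  shows "integrable torus (\<lambda>x. (\<Sum>\<^sub>\<infinity>k. c k * ek k x))"
    and "integrable torus (\<lambda>x. h x * (\<Sum>\<^sub>\<infinity>k. c k * ek k x))"
    and "((\<lambda>k. c k * fc h (n - k)) has_sum fc (\<lambda>x. h x * (\<Sum>\<^sub>\<infinity>k. c k * ek k x)) n) UNIV"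
proof -
  let ?C = "\<Sum>\<^sub>\<infinity>k. cmod (c k)"
  have abs: "(\<lambda>k. norm (c k * ek k x)) summable_on UNIV" for x using c by (simp add: norm_mult)
  have mult: "(\<lambda>x. g x * (\<Sum>\<^sub>\<infinity>k. c k * ek k x)) = (\<lambda>x. (\<Sum>\<^sub>\<infinity>k. g x * (c k * ek k x)))" for g :: "real \<Rightarrow> complex"
    using infsum_cmult_right[OF abs_summable_summable[OF abs]] by auto
  have mm: "(\<lambda>x. g x * (c k * ek k x)) \<in> borel_measurable torus" if "integrable torus g" for g k
    using that by (intro borel_measurable_times borel_measurable_const
        borel_measurable_integrable[OF cont_integrable_Icc[OF continuous_on_ek]]) auto
  have Bi: "integrable torus (\<lambda>x. cmod (g x) * ?C)" if "integrable torus g" for g using that by simp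
  have bd: "AE x in torus. \<forall>F. finite F \<longrightarrow> (\<Sum>k\<in>F. norm (g x * (c k * ek k x))) \<le> cmod (g x) * ?C"
    for g :: "real \<Rightarrow> complex"
    using finite_sum_le_infsum[OF c]
    by (intro AE_I2 allI impI) (auto simp: norm_mult sum_distrib_left[symmetric] intro!: mult_left_mono)
  note A = has_sum_lebesgue_integral[OF infinite_int mm Bi bd]
  have i: "integrable torus (\<lambda>x. g x * (\<Sum>\<^sub>\<infinity>k. c k * ek k x))" if g: "integrable torus g" for g
    unfolding mult by (rule A(3)[OF g g])
  show "integrable torus (\<lambda>x. h x * (\<Sum>\<^sub>\<infinity>k. c k * ek k x))" by (rule i[OF h])
  show "integrable torus (\<lambda>x. (\<Sum>\<^sub>\<infinity>k. c k * ek k x))"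
    using i[OF finite_measure.integrable_const[OF finite_measure_lebesgue_on_Icc, of 0 "2*pi" 1]] by simp
  have hn: "integrable torus (\<lambda>x. h x * ek (- n) x)" by (rule integrable_mult_cont[OF h continuous_on_ek])
  have "((\<lambda>k. LINT x|torus. h x * ek (- n) x * (c k * ek k x)) has_sum
      (LINT x|torus. h x * ek (- n) x * (\<Sum>\<^sub>\<infinity>k. c k * ek k x))) UNIV"
    unfolding mult by (rule A(1)[OF hn hn])
  moreover have "(LINT x|torus. h x * ek (- n) x * (c k * ek k x)) = c k * (LINT x|torus. h x * ek (- (n - k)) x)" for k
  proof -
    have *: "h x * ek (- n) x * (c k * ek k x) = c k * (h x * ek (- (n - k)) x)" for x
      by (simp add: ek_diff mult_ac)
    show ?thesis unfolding * by (rule integral_mult_right_zero)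
  qed
  ultimately have "((\<lambda>k. c k * (LINT x|torus. h x * ek (- (n - k)) x)) has_sum
      (LINT x|torus. h x * ek (- n) x * (\<Sum>\<^sub>\<infinity>k. c k * ek k x))) UNIV"
    by (simp only:)
  moreover have "h x * ek (- n) x * (\<Sum>\<^sub>\<infinity>k. c k * ek k x) = (h x * (\<Sum>\<^sub>\<infinity>k. c k * ek k x)) * ek (- n) x" for x
    by (simp only: mult_ac)
  ultimately have "((\<lambda>k. c k * (LINT x|torus. h x * ek (- (n - k)) x)) has_sum
      (LINT x|torus. (h x * (\<Sum>\<^sub>\<infinity>k. c k * ek k x)) * ek (- n) x)) UNIV"
    by (simp only:)
  then have "((\<lambda>k. 2 * pi * (c k * fc h (n - k))) has_sum (2 * pi * fc (\<lambda>x. h x * (\<Sum>\<^sub>\<infinity>k. c k * ek k x)) n)) UNIV"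
    unfolding integral_fc by (simp add: mult_ac)
  from has_sum_cmult_right[OF this, of "1 / (2 * pi)"]
  show "((\<lambda>k. c k * fc h (n - k)) has_sum fc (\<lambda>x. h x * (\<Sum>\<^sub>\<infinity>k. c k * ek k x)) n) UNIV" by simp
qed

lemma fc_abs_summable_series:
  assumes c: "(\<lambda>k. cmod (c k)) summable_on UNIV"
  shows "fc (\<lambda>x. (\<Sum>\<^sub>\<infinity>k. c k * ek k x)) n = c n"
proof -
  have "integrable torus (\<lambda>x. 1::complex)"
    by (rule finite_measure.integrable_const[OF finite_measure_lebesgue_on_Icc])
  from fc_mult_abs_summable(3)[OF c this, of n]
  have "((\<lambda>k. c k * fc (\<lambda>x. 1) (n - k)) has_sum fc (\<lambda>x. (\<Sum>\<^sub>\<infinity>k. c k * ek k x)) n) UNIV" by simp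
  moreover have "fc (\<lambda>x. 1) j = (if j = 0 then 1 else 0)" for j by (simp add: fc_def ek_integral)
  ultimately have "((\<lambda>k. if k = n then c n else 0) has_sum fc (\<lambda>x. (\<Sum>\<^sub>\<infinity>k. c k * ek k x)) n) UNIV"
    by (elim has_sum_cong[THEN iffD1, rotated]) auto
  moreover have "((\<lambda>k. if k = n then c n else 0) has_sum c n) UNIV"
    by (rule has_sum_finite_neutralI[of "{n}"]) auto
  ultimately show ?thesis using has_sum_unique by blast
qed

section \<open>Fourier series of test functions and distributions\<close>

lemma fcoeff_alt: "fcoeff u k = u (ek (- k)) / (2 * pi)"
  by (simp add: fcoeff_def ek_def[abs_def])

lemma of_fun_cis: "of_fun (\<lambda>x. cis (of_int k * x)) \<phi> = 2 * pi * fc \<phi> (- k)"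
  by (simp add: of_fun_def fc_def ek_def mult.commute)

lemma fc_vderiv:
  assumes "periodic_test \<phi>" shows "fc (vderiv \<phi>) k = \<i> * of_int k * fc \<phi> k"
proof -
  have "(LINT x|torus. ek (- k) x * vderiv \<phi> x) = - (LINT x|torus. vderiv (ek (- k)) x * \<phi> x)"
    by (intro periodic_vderiv_mult_integral periodic_test_ek assms)
  also have "\<dots> = \<i> * of_int k * (LINT x|torus. ek (- k) x * \<phi> x)"
    by (simp add: vderiv_ek mult.assoc)
  finally show ?thesis by (simp add: fc_def mult.commute)
qed

lemma fc_bound:
  assumes "integrable torus f" shows "cmod (fc f k) \<le> (LINT x|torus. cmod (f x)) / (2 * pi)"
proof -
  have "cmod (LINT x|torus. f x * ek (- k) x) \<le> (LINT x|torus. cmod (f x * ek (- k) x))"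
    by (rule integral_norm_bound)
  then show ?thesis by (simp add: fc_def norm_mult norm_divide divide_right_mono)
qed

text \<open>  Two derivatives give decay of order two, which beats the summable weight.\<close>

lemma test_fc_summable:
  assumes \<phi>: "periodic_test \<phi>" shows "(\<lambda>k. cmod (fc \<phi> k)) summable_on UNIV"
proof -
  define B where "B = (LINT x|torus. cmod (vderiv (vderiv \<phi>) x)) / (2 * pi)"
  have bd: "cmod (fc (vderiv (vderiv \<phi>)) k) \<le> B" for k
    unfolding B_def by (intro fc_bound cont_integrable_Icc periodic_continuous_on periodic_vderiv \<phi>)
  have B0: "0 \<le> B" using bd[of 0] norm_ge_zero order_trans by blast
  show ?thesis
  proof (rule summable_on_comparison_test)
    show "(\<lambda>k. (cmod (fc \<phi> 0) + 4 * B) * wt k) summable_on UNIV"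
      by (intro summable_on_cmult_right wt_summable)
    fix k :: int
    show "cmod (fc \<phi> k) \<le> (cmod (fc \<phi> 0) + 4 * B) * wt k"
    proof (cases "k = 0")
      case True
      then show ?thesis using B0 by (simp add: wt_def br_def)
    next
      case False
      have "\<bar>of_int k\<bar>\<^sup>2 * cmod (fc \<phi> k) \<le> B"
        using bd[of k] by (simp add: fc_vderiv \<phi> periodic_vderiv norm_mult power2_eq_square mult.assoc)
      then have "cmod (fc \<phi> k) \<le> B * (inverse \<bar>of_int k\<bar>)\<^sup>2"
        using False by (simp add: field_simps)
      also have "\<dots> \<le> B * (4 * wt k)"
        using B0 by (intro mult_left_mono inverse_square_le_wt False) auto
      also have "\<dots> \<le> (cmod (fc \<phi> 0) + 4 * B) * wt k"
        by (simp add: algebra_simps wt_nonneg)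
      finally show ?thesis .
    qed
  qed auto
qed

lemma AE_zero_continuous:
  fixes h :: "real \<Rightarrow> complex"
  assumes c: "continuous_on {a..b} h" and ab: "a < b" and z: "AE x in lebesgue_on {a..b}. h x = 0"
    and x: "x \<in> {a..b}"
  shows "h x = 0"
proof -
  have cn: "continuous_on {a..b} (\<lambda>x. cmod (h x))" using c by (intro continuous_intros)
  have "integral\<^sup>L (lebesgue_on {a..b}) (\<lambda>x. cmod (h x)) = 0"
    using z by (intro integral_eq_zero_AE) (auto elim: eventually_mono)
  then have "integral {a..b} (\<lambda>x. cmod (h x)) = 0"
    using lebesgue_integral_eq_integral[OF continuous_imp_integrable_real[OF cn]] by simp
  moreover have "(\<lambda>x. cmod (h x)) integrable_on {a..b}" by (intro integrable_continuous_interval cn)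
  ultimately have "((\<lambda>x. cmod (h x)) has_integral 0) {a..b}" by (metis integrable_integral)
  then have "cmod (h x) = 0"
    using has_integral_0_cbox_imp_0[of a b "\<lambda>x. cmod (h x)" x] cn ab x by (simp add: box_real cbox_interval)
  then show ?thesis by simp
qed

lemma abs_summable_series_continuous:
  assumes c: "(\<lambda>k. cmod (c k)) summable_on UNIV"
  shows "continuous_on S (\<lambda>x. (\<Sum>\<^sub>\<infinity>k. c k * ek k x))"
proof (rule uniform_limit_theorem)
  show "uniform_limit S (\<lambda>F x. \<Sum>k\<in>F. c k * ek k x) (\<lambda>x. (\<Sum>\<^sub>\<infinity>k. c k * ek k x)) (finite_subsets_at_top UNIV)"
    by (rule Weierstrass_m_test_general[OF _ c]) (simp add: norm_mult)
  show "\<forall>\<^sub>F F in finite_subsets_at_top UNIV. continuous_on S (\<lambda>x. \<Sum>k\<in>F. c k * ek k x)"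
    by (intro always_eventually allI trig_sum_continuous)
qed simp

text \<open>  The absolutely convergent series is continuous and has the coefficients of \<open>\<phi>\<close>, so the two agree
  almost everywhere and, being continuous, everywhere.\<close>

lemma test_fourier_series:
  assumes \<phi>: "periodic_test \<phi>" and x: "x \<in> {0..2*pi}"
  shows "((\<lambda>k. fc \<phi> k * ek k x) has_sum \<phi> x) UNIV"
proof -
  note c = test_fc_summable[OF \<phi>]
  let ?g = "\<lambda>x. (\<Sum>\<^sub>\<infinity>k. fc \<phi> k * ek k x)"
  have i: "integrable torus \<phi>" by (intro cont_integrable_Icc periodic_continuous_on \<phi>)
  have gi: "integrable torus ?g" by (intro cont_integrable_Icc abs_summable_series_continuous c)
  have "\<phi> x - ?g x = 0"
  proof (rule AE_zero_continuous[OF _ _ _ x])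
    show "continuous_on {0..2*pi} (\<lambda>x. \<phi> x - ?g x)"
      by (intro continuous_intros abs_summable_series_continuous c periodic_continuous_on \<phi>)
    show "AE x in torus. \<phi> x - ?g x = 0"
      using fc_determines_function[OF i gi fc_abs_summable_series[OF c, symmetric]] by eventually_elim simp
  qed simp
  moreover have "((\<lambda>k. fc \<phi> k * ek k x) has_sum ?g x) UNIV"
  proof (rule has_sum_infsum, rule abs_summable_summable)
    show "(\<lambda>k. norm (fc \<phi> k * ek k x)) summable_on UNIV" using c by (simp add: norm_mult)
  qed
  ultimately show ?thesis by simp
qed

lemma test_partial_sum_error:
  assumes \<phi>: "periodic_test \<phi>" and x: "x \<in> {0..2*pi}" and F: "finite F"
  shows "cmod (\<phi> x - (\<Sum>k\<in>F. fc \<phi> k * ek k x)) \<le> (\<Sum>\<^sub>\<infinity>k. cmod (fc \<phi> k)) - (\<Sum>k\<in>F. cmod (fc \<phi> k))"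
proof -
  note c = test_fc_summable[OF \<phi>]
  have s: "(\<lambda>k. fc \<phi> k * ek k x) summable_on UNIV" "(\<Sum>\<^sub>\<infinity>k. fc \<phi> k * ek k x) = \<phi> x"
    using test_fourier_series[OF \<phi> x] by (auto simp: has_sum_iff)
  have c': "(\<lambda>k. cmod (fc \<phi> k)) summable_on (UNIV - F)" by (rule summable_on_subset[OF c]) simp
  have "\<phi> x - (\<Sum>k\<in>F. fc \<phi> k * ek k x) = (\<Sum>\<^sub>\<infinity>k\<in>UNIV - F. fc \<phi> k * ek k x)"
    using infsum_Diff[OF s(1), of F] F s(2) by simp
  also have "cmod \<dots> \<le> (\<Sum>\<^sub>\<infinity>k\<in>UNIV - F. cmod (fc \<phi> k * ek k x))"
    by (rule norm_infsum_bound) (use c' in \<open>simp add: norm_mult\<close>)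
  also have "\<dots> = (\<Sum>\<^sub>\<infinity>k. cmod (fc \<phi> k)) - (\<Sum>k\<in>F. cmod (fc \<phi> k))"
    using infsum_Diff[OF c, of F] F by (simp add: norm_mult)
  finally show ?thesis .
qed

lemma periodic_test_funpow: "periodic_test \<phi> \<Longrightarrow> periodic_test ((vderiv ^^ n) \<phi>)"
  by (induction n) (auto intro: periodic_vderiv)

lemma vderiv_trig_sum:
  "finite F \<Longrightarrow> vderiv (\<lambda>x. \<Sum>k\<in>F. c k * ek k x) = (\<lambda>x. \<Sum>k\<in>F. \<i> * of_int k * c k * ek k x)"
  by (rule vderiv_eqI)
     (auto intro!: has_vector_derivative_sum has_vector_derivative_mult_right[THEN has_vector_derivative_eq_rhs] ek_vderiv)

text \<open>  Differentiation commutes with taking partial sums of the Fourier series. Hence every derivative of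
  the error is again an error of the kind bounded in \<open>test_partial_sum_error\<close>.\<close>

lemma funpow_vderiv_test_error:
  assumes \<phi>: "periodic_test \<phi>" and F: "finite F"
  shows "(vderiv ^^ n) (\<lambda>x. \<phi> x + (-1) * (\<Sum>k\<in>F. fc \<phi> k * ek k x))
    = (\<lambda>x. (vderiv ^^ n) \<phi> x + (-1) * (\<Sum>k\<in>F. fc ((vderiv ^^ n) \<phi>) k * ek k x))"
proof (induction n)
  case 0 then show ?case by simp
next
  case (Suc n)
  have p: "periodic_test ((vderiv ^^ n) \<phi>)" by (rule periodic_test_funpow[OF \<phi>])
  have "vderiv (\<lambda>x. (vderiv ^^ n) \<phi> x + (-1) * (\<Sum>k\<in>F. fc ((vderiv ^^ n) \<phi>) k * ek k x))
     = (\<lambda>x. vderiv ((vderiv ^^ n) \<phi>) x + (-1) * vderiv (\<lambda>x. \<Sum>k\<in>F. fc ((vderiv ^^ n) \<phi>) k * ek k x) x)"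
    using p by (intro vderiv_add_cmult smooth_sum_cmult F smooth_ek) (auto simp: periodic_test_def)
  then show ?case
    by (simp only: funpow.simps o_apply Suc.IH vderiv_trig_sum[OF F] fc_vderiv[OF p])
qed

lemma distribution_sum:
  assumes u: "distribution u" and F: "finite F" and \<phi>: "periodic_test \<phi>"
  shows "u (\<lambda>x. \<phi> x + (-1) * (\<Sum>k\<in>F. c k * ek k x)) = u \<phi> - (\<Sum>k\<in>F. c k * u (ek k))"
proof -
  have add: "u (\<lambda>x. f x + g x) = u f + u g" if "periodic_test f" "periodic_test g" for f g
    using u that by (auto simp: distribution_def)
  have cm: "u (\<lambda>x. c * f x) = c * u f" if "periodic_test f" for c f
    using u that by (auto simp: distribution_def)
  have pc: "periodic_test (\<lambda>x. c * f x)" if "periodic_test f" for c f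
    using periodic_sum_cmult[of "{()}" "\<lambda>_. f" "\<lambda>_. c"] that by simp
  have ps: "periodic_test (\<lambda>x. \<Sum>k\<in>G. c k * ek k x)" if "finite G" for G
    by (rule periodic_sum_cmult[OF that periodic_test_ek])
  have s: "u (\<lambda>x. \<Sum>k\<in>F. c k * ek k x) = (\<Sum>k\<in>F. c k * u (ek k))"
    using F
  proof (induction F rule: finite_induct)
    case empty
    have "u (\<lambda>x. 0 * ek 0 x) = 0 * u (ek 0)" by (rule cm[OF periodic_test_ek])
    then show ?case by simp
  next
    case (insert j G)
    have "u (\<lambda>x. c j * ek j x + (\<Sum>k\<in>G. c k * ek k x)) = c j * u (ek j) + u (\<lambda>x. \<Sum>k\<in>G. c k * ek k x)"
      using add[OF pc[OF periodic_test_ek] ps[OF insert(1)]] cm[OF periodic_test_ek] by simp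
    then show ?case using insert by simp
  qed
  show ?thesis
    using add[OF \<phi> pc[OF ps[OF F]], of "-1"] cm[OF ps[OF F], of "-1"] s by simp
qed

text \<open>  The Fourier series of \<open>\<phi>\<close> converges uniformly together with all derivatives, and \<open>u\<close> is continuous with
  respect to finitely many of them.\<close>

lemma distribution_fourier:
  assumes u: "distribution u" and \<phi>: "periodic_test \<phi>"
  shows "((\<lambda>k. fcoeff u k * of_fun (\<lambda>x. cis (of_int k * x)) \<phi>) has_sum u \<phi>) UNIV"
proof -
  obtain B N where B: "\<And>\<phi>. periodic_test \<phi> \<Longrightarrow>
        cmod (u \<phi>) \<le> B * (\<Sum>n\<le>N. SUP x\<in>{0..2*pi}. cmod ((vderiv ^^ n) \<phi> x))"
    using u unfolding distribution_def by blast
  let ?D = "\<lambda>n. (vderiv ^^ n) \<phi>"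
  define tail where "tail n F = (\<Sum>\<^sub>\<infinity>k. cmod (fc (?D n) k)) - (\<Sum>k\<in>F. cmod (fc (?D n) k))" for n F
  have tail0: "(tail n \<longlongrightarrow> 0) (finite_subsets_at_top UNIV)" for n
  proof -
    have "((\<lambda>F. \<Sum>k\<in>F. cmod (fc (?D n) k)) \<longlongrightarrow> (\<Sum>\<^sub>\<infinity>k. cmod (fc (?D n) k))) (finite_subsets_at_top UNIV)"
      using test_fc_summable[OF periodic_test_funpow[OF \<phi>]] by (simp add: has_sum_def[symmetric])
    from tendsto_diff[OF tendsto_const[of "\<Sum>\<^sub>\<infinity>k. cmod (fc (?D n) k)"] this]
    show ?thesis by (simp add: tail_def[abs_def])
  qed
  have bound: "cmod ((\<Sum>k\<in>F. fc \<phi> k * u (ek k)) - u \<phi>) \<le> \<bar>B\<bar> * (\<Sum>n\<le>N. tail n F)" if F: "finite F" for F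
  proof -
    let ?\<psi> = "\<lambda>x. \<phi> x + (-1) * (\<Sum>k\<in>F. fc \<phi> k * ek k x)"
    have p: "periodic_test ?\<psi>" by (intro periodic_add_cmult \<phi> periodic_sum_cmult F periodic_test_ek)
    have pt: "cmod ((vderiv ^^ n) ?\<psi> x) \<le> tail n F" if "x \<in> {0..2*pi}" for n x
      using test_partial_sum_error[OF periodic_test_funpow[OF \<phi>] that F, of n]
      unfolding funpow_vderiv_test_error[OF \<phi> F] tail_def by simp
    have sup: "(SUP x\<in>{0..2*pi}. cmod ((vderiv ^^ n) ?\<psi> x)) \<le> tail n F" for n
      using pt by (intro cSUP_least) auto
    have sup0: "0 \<le> (SUP x\<in>{0..2*pi}. cmod ((vderiv ^^ n) ?\<psi> x))" for n
    proof (rule order_trans)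
      show "cmod ((vderiv ^^ n) ?\<psi> 0) \<le> (SUP x\<in>{0..2*pi}. cmod ((vderiv ^^ n) ?\<psi> x))"
        by (intro cSUP_upper bdd_aboveI2[where M="tail n F"] pt) auto
    qed simp
    have "cmod (u ?\<psi>) \<le> B * (\<Sum>n\<le>N. SUP x\<in>{0..2*pi}. cmod ((vderiv ^^ n) ?\<psi> x))" by (rule B[OF p])
    also have "\<dots> \<le> \<bar>B\<bar> * (\<Sum>n\<le>N. SUP x\<in>{0..2*pi}. cmod ((vderiv ^^ n) ?\<psi> x))"
      by (intro mult_right_mono sum_nonneg sup0) auto
    also have "\<dots> \<le> \<bar>B\<bar> * (\<Sum>n\<le>N. tail n F)" by (intro mult_left_mono sum_mono sup) auto
    finally show ?thesis unfolding distribution_sum[OF u F \<phi>] by (simp add: norm_minus_commute)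
  qed
  have "((\<lambda>F. (\<Sum>k\<in>F. fc \<phi> k * u (ek k)) - u \<phi>) \<longlongrightarrow> 0) (finite_subsets_at_top UNIV)"
  proof (rule Lim_null_comparison)
    show "\<forall>\<^sub>F F in finite_subsets_at_top UNIV. norm ((\<Sum>k\<in>F. fc \<phi> k * u (ek k)) - u \<phi>) \<le> \<bar>B\<bar> * (\<Sum>n\<le>N. tail n F)"
      by (rule eventually_finite_subsets_at_top_weakI) (rule bound)
    have "((\<lambda>F. \<bar>B\<bar> * (\<Sum>n\<le>N. tail n F)) \<longlongrightarrow> \<bar>B\<bar> * (\<Sum>n\<le>N. 0)) (finite_subsets_at_top UNIV)"
      by (intro tendsto_mult_left tendsto_sum tail0)
    then show "((\<lambda>F. \<bar>B\<bar> * (\<Sum>n\<le>N. tail n F)) \<longlongrightarrow> 0) (finite_subsets_at_top UNIV)" by simp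
  qed
  then have "((\<lambda>k. fc \<phi> k * u (ek k)) has_sum u \<phi>) UNIV"
    unfolding has_sum_def by (rule LIM_zero_cancel)
  then have "((\<lambda>k. fc \<phi> k * u (ek k)) has_sum u \<phi>) (uminus ` UNIV)" by (simp add: surj_uminus)
  then have "((\<lambda>k. fc \<phi> (- k) * u (ek (- k))) has_sum u \<phi>) UNIV"
    by (subst (asm) has_sum_reindex) (auto simp: o_def)
  moreover have "fcoeff u k * of_fun (\<lambda>x. cis (of_int k * x)) \<phi> = fc \<phi> (- k) * u (ek (- k))" for k
    unfolding of_fun_cis fcoeff_alt by simp
  ultimately show ?thesis by (simp only:)
qed

section \<open>Fourier coefficients of the trilinear integrand\<close>

lemma fcoeff_fmult: "fcoeff (fmult m u) k = m k * fcoeff u k"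
proof -
  have "fmult m u (ek (- k)) = (\<Sum>\<^sub>\<infinity>j. m j * fcoeff u j * of_fun (\<lambda>x. cis (of_int j * x)) (ek (- k)))"
    by (simp add: fmult_def)
  also have "\<dots> = (\<Sum>\<^sub>\<infinity>j. if j = k then m k * fcoeff u k * (2 * pi) else 0)"
  proof (rule infsum_cong)
    fix j
    have "of_fun (\<lambda>x. cis (of_int j * x)) (ek (- k)) = (LINT x|torus. ek (j - k) x)"
      by (simp add: of_fun_def ek_diff) (simp add: ek_def)
    then show "m j * fcoeff u j * of_fun (\<lambda>x. cis (of_int j * x)) (ek (- k))
        = (if j = k then m k * fcoeff u k * (2 * pi) else 0)" by (simp add: ek_integral)
  qed
  also have "\<dots> = m k * fcoeff u k * (2 * pi)"
    by (rule infsumI) (rule has_sum_finite_neutralI[of "{k}"], auto)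
  finally show ?thesis by (simp add: fcoeff_alt)
qed

lemma represents_fcoeff:
  assumes "represents f u" shows "fcoeff u k = fc f k"
  using assms periodic_test_ek[of "- k"] by (simp add: represents_def fcoeff_alt of_fun_def fc_def)

lemma represents_density_of:
  assumes "represents f u" shows "represents (density_of u) u"
  unfolding density_of_def using assms by (rule someI[where P="\<lambda>f. represents f u"])

lemma square_integrable_test: "periodic_test \<phi> \<Longrightarrow> square_integrable \<phi>"
  unfolding square_integrable_def
  by (intro conjI cont_integrable_Icc continuous_imp_integrable_real continuous_intros periodic_continuous_on)

lemma of_fun_fourier:
  assumes f: "square_integrable f" and \<phi>: "periodic_test \<phi>"
  shows "((\<lambda>k. fc f k * of_fun (\<lambda>x. cis (of_int k * x)) \<phi>) has_sum of_fun f \<phi>) UNIV"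
proof -
  have "((\<lambda>k. 2 * pi * (fc f k * fc \<phi> (0 - k))) has_sum (2 * pi * fc (\<lambda>x. f x * \<phi> x) 0)) UNIV"
    by (intro has_sum_cmult_right fc_mult_has_sum f square_integrable_test \<phi>)
  moreover have "2 * pi * fc (\<lambda>x. f x * \<phi> x) 0 = of_fun f \<phi>"
    by (simp add: fc_def of_fun_def)
  moreover have "2 * pi * (fc f k * fc \<phi> (0 - k)) = fc f k * of_fun (\<lambda>x. cis (of_int k * x)) \<phi>" for k
    unfolding of_fun_cis by simp
  ultimately show ?thesis by (simp only:)
qed

text \<open>  All functionals met below are given by their Fourier series. This lemma turns square summability of
  the coefficients into representability, and computes the norm.\<close>

lemma square_summable_represented:
  assumes c: "(\<lambda>k. (cmod (c k))\<^sup>2) summable_on UNIV"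
    and u: "\<And>\<phi>. periodic_test \<phi> \<Longrightarrow> u \<phi> = (\<Sum>\<^sub>\<infinity>k. c k * of_fun (\<lambda>x. cis (of_int k * x)) \<phi>)"
  shows "in_L2 u" "represents (density_of u) u" "square_integrable (density_of u)"
    "fc (density_of u) k = c k" "L2_norm u = sqrt (2 * pi * (\<Sum>\<^sub>\<infinity>k. (cmod (c k))\<^sup>2))"
proof -
  obtain f where f: "square_integrable f" "\<And>k. fc f k = c k"
    using riesz_fischer[OF c] by blast
  have r: "represents f u"
    unfolding represents_def
  proof (intro conjI allI impI)
    show "integrable torus f" using f by (simp add: square_integrable_def)
    fix \<phi> assume "periodic_test \<phi>"
    from of_fun_fourier[OF f(1) this] u[OF this] show "u \<phi> = of_fun f \<phi>"
      by (simp add: f(2) infsumI)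
  qed
  then show "in_L2 u" using f(1) by (auto simp: in_L2_def square_integrable_def)
  show d: "represents (density_of u) u" using r by (rule represents_density_of)
  have cd: "fc (density_of u) k = c k" for k
    using represents_fcoeff[OF d] represents_fcoeff[OF r] f(2) by simp
  then show "fc (density_of u) k = c k" .
  have di: "integrable torus (density_of u)" using d by (simp add: represents_def)
  show "square_integrable (density_of u)" using parseval(1)[OF di] c by (simp add: cd)
  show "L2_norm u = sqrt (2 * pi * (\<Sum>\<^sub>\<infinity>k. (cmod (c k))\<^sup>2))"
    unfolding L2_norm_def using parseval(2)[OF di] c by (simp add: cd)
qed

lemma in_H_0_iff: "in_H 0 u \<longleftrightarrow> distribution u \<and> (\<lambda>k. (cmod (fcoeff u k))\<^sup>2) summable_on UNIV"
proof -
  have "(1 + (real_of_int k)\<^sup>2) powr 0 = 1" for k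
    using zero_le_power2[of "real_of_int k"] by (simp add: add_nonneg_eq_0_iff)
  then show ?thesis unfolding in_H_def by simp
qed

lemma H_norm_0: "H_norm 0 u = sqrt (2 * pi * (\<Sum>\<^sub>\<infinity>k. (cmod (fcoeff u k))\<^sup>2))"
proof -
  have "(1 + (real_of_int k)\<^sup>2) powr 0 = 1" for k
    using zero_le_power2[of "real_of_int k"] by (simp add: add_nonneg_eq_0_iff)
  then show ?thesis unfolding H_norm_def by (simp add: real_sqrt_mult)
qed

lemma L2_norm_eq_H_norm:
  assumes "in_H 0 u" shows "L2_norm u = H_norm 0 u"
proof -
  have u: "distribution u" and c: "(\<lambda>k. (cmod (fcoeff u k))\<^sup>2) summable_on UNIV"
    using assms by (auto simp: in_H_0_iff)
  show ?thesis
    unfolding H_norm_0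
    by (rule square_summable_represented(5)[OF c]) (simp add: infsumI[OF distribution_fourier[OF u]])
qed

lemma mean_free_of_fun:
  assumes q: "integrable torus q"
  shows "represents (\<lambda>x. q x - fc q 0) (mean_free (of_fun q))"
proof -
  have ci: "integrable torus (\<lambda>x. fc q 0)"
    by (rule finite_measure.integrable_const[OF finite_measure_lebesgue_on_Icc])
  have c: "of_fun q (\<lambda>_. 1) / (2 * pi) = fc q 0" by (simp add: of_fun_def fc_def)
  have "mean_free (of_fun q) \<phi> = of_fun (\<lambda>x. q x - fc q 0) \<phi>" if "periodic_test \<phi>" for \<phi>
  proof -
    have "of_fun (\<lambda>x. q x - fc q 0) \<phi> = (LINT x|torus. q x * \<phi> x - fc q 0 * \<phi> x)"
      by (simp add: of_fun_def left_diff_distrib)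
    also have "\<dots> = of_fun q \<phi> - of_fun (\<lambda>x. fc q 0) \<phi>"
      unfolding of_fun_def
      using integrable_mult_cont[OF q periodic_continuous_on[OF that]] integrable_mult_cont[OF ci periodic_continuous_on[OF that]]
      by (rule Bochner_Integration.integral_diff)
    finally show ?thesis by (simp only: mean_free_def c)
  qed
  then show ?thesis using q ci by (simp add: represents_def)
qed

lemma fc_minus_mean:
  assumes q: "integrable torus q"
  shows "fc (\<lambda>x. q x - fc q 0) k = (if k = 0 then 0 else fc q k)"
proof -
  have ci: "integrable torus (\<lambda>x. fc q 0)"
    by (rule finite_measure.integrable_const[OF finite_measure_lebesgue_on_Icc])
  have "(LINT x|torus. (q x - fc q 0) * ek (- k) x) = (LINT x|torus. q x * ek (- k) x) - (LINT x|torus. fc q 0 * ek (- k) x)"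
    using integrable_mult_cont[OF q continuous_on_ek] integrable_mult_cont[OF ci continuous_on_ek]
    by (simp add: left_diff_distrib)
  also have "(LINT x|torus. fc q 0 * ek (- k) x) = fc q 0 * (if k = 0 then 2 * pi else 0)"
    using ek_integral[of "-k"] by simp
  finally show ?thesis unfolding integral_fc by (auto simp: fc_def[of "\<lambda>x. q x - fc q 0"])
qed

text \<open>  By \<open>a * b \<le> a\<^sup>2 + b\<^sup>2\<close>, since \<open>1 / k\<close> is square summable.\<close>

lemma dx_inv_abs_summable:
  assumes c: "(\<lambda>k. (cmod (fcoeff v k))\<^sup>2) summable_on UNIV"
  shows "(\<lambda>k. cmod (fcoeff (airy t (dx_inv v)) k)) summable_on UNIV"
proof (rule summable_on_comparison_test)
  show "(\<lambda>k. (cmod (fcoeff v k))\<^sup>2 + 4 * wt k) summable_on UNIV"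
    by (intro summable_on_add c summable_on_cmult_right wt_summable)
  fix k :: int
  show "cmod (fcoeff (airy t (dx_inv v)) k) \<le> (cmod (fcoeff v k))\<^sup>2 + 4 * wt k"
  proof (cases "k = 0")
    case True then show ?thesis by (simp add: airy_def dx_inv_def fcoeff_fmult wt_nonneg)
  next
    case False
    let ?a = "cmod (fcoeff v k)" and ?b = "inverse \<bar>real_of_int k\<bar>"
    have "?b * ?a \<le> ?a\<^sup>2 + ?b\<^sup>2"
      using sum_squares_bound[of ?a ?b] zero_le_power2[of ?a] zero_le_power2[of ?b]
      by (simp add: mult_ac) (smt (verit) mult_nonneg_nonneg norm_ge_zero inverse_nonnegative_iff_nonnegative abs_ge_zero)
    also have "?b\<^sup>2 \<le> 4 * wt k" by (rule inverse_square_le_wt[OF False])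
    finally show ?thesis using False
      by (simp add: airy_def dx_inv_def fcoeff_fmult norm_mult norm_inverse)
  qed
qed auto

lemma airy_fcoeff: "fcoeff (airy t u) k = cis (- (t * of_int k ^ 3)) * fcoeff u k"
  by (simp add: airy_def fcoeff_fmult)

lemma dx_inv_fcoeff: "fcoeff (dx_inv u) k = (if k = 0 then 0 else inverse (\<i> * of_int k)) * fcoeff u k"
  by (simp add: dx_inv_def fcoeff_fmult)

lemma airy_represented:
  assumes c: "(\<lambda>k. (cmod (fcoeff u k))\<^sup>2) summable_on UNIV"
  shows "represents (density_of (airy t u)) (airy t u)" "square_integrable (density_of (airy t u))"
    "fc (density_of (airy t u)) k = fcoeff (airy t u) k"
proof -
  have c': "(\<lambda>k. (cmod (fcoeff (airy t u) k))\<^sup>2) summable_on UNIV"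
    using c by (simp add: airy_fcoeff norm_mult)
  have e: "airy t u \<phi> = (\<Sum>\<^sub>\<infinity>k. fcoeff (airy t u) k * of_fun (\<lambda>x. cis (of_int k * x)) \<phi>)" for \<phi>
    by (subst airy_def) (simp add: fmult_def airy_fcoeff)
  note A = square_summable_represented[OF c' e]
  show "represents (density_of (airy t u)) (airy t u)" "square_integrable (density_of (airy t u))"
    "fc (density_of (airy t u)) k = fcoeff (airy t u) k"
    using A by auto
qed

text \<open>  The inner product is a convolution of square summable sequences; its mean-free part is merely
  integrable. The third factor has an absolutely convergent series, to which its density is almost
  everywhere equal, and so the outer product is again a convolution.\<close>

lemma trilinear_integrand:
  fixes v1 v2 v3 :: functional and t :: real
  defines "a1 \<equiv> fcoeff (airy (- t) v1)" and "a2 \<equiv> fcoeff (airy (- t) v2)" and "a3 \<equiv> fcoeff (airy (- t) (dx_inv v3))"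
  assumes c1: "(\<lambda>k. (cmod (fcoeff v1 k))\<^sup>2) summable_on UNIV"
    and c2: "(\<lambda>k. (cmod (fcoeff v2 k))\<^sup>2) summable_on UNIV"
    and c3: "(\<lambda>k. (cmod (fcoeff v3 k))\<^sup>2) summable_on UNIV"
  shows "airy t (mean_free (mult (mean_free (mult (airy (- t) v1) (airy (- t) v2))) (airy (- t) (dx_inv v3)))) \<phi>
    = (\<Sum>\<^sub>\<infinity>k. cis (- (t * of_int k ^ 3)) *
         (if k = 0 then 0 else (\<Sum>\<^sub>\<infinity>m. a3 m * (if k - m = 0 then 0 else (\<Sum>\<^sub>\<infinity>n. a1 n * a2 (k - m - n)))))
         * of_fun (\<lambda>x. cis (of_int k * x)) \<phi>)"
proof -
  let ?U1 = "airy (- t) v1" and ?U2 = "airy (- t) v2" and ?U3 = "airy (- t) (dx_inv v3)"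
  let ?d1 = "density_of ?U1" and ?d2 = "density_of ?U2" and ?d3 = "density_of ?U3"
  let ?g = "\<lambda>x. ?d1 x * ?d2 x"
  have gi: "integrable torus ?g" by (rule square_integrable_mult[OF airy_represented(2)[OF c1] airy_represented(2)[OF c2]])
  have g: "fc ?g j = (\<Sum>\<^sub>\<infinity>n. a1 n * a2 (j - n))" for j
    using fc_mult_has_sum[OF airy_represented(2)[OF c1] airy_represented(2)[OF c2], of "-t" "-t" j]
    unfolding airy_represented(3)[OF c1] airy_represented(3)[OF c2] a1_def a2_def by (rule infsumI[symmetric])
  let ?V = "mean_free (mult ?U1 ?U2)"
  let ?h = "density_of ?V"
  have rV: "represents (\<lambda>x. ?g x - fc ?g 0) ?V"
    unfolding mult_def by (rule mean_free_of_fun[OF gi])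
  have rh: "represents ?h ?V" by (rule represents_density_of[OF rV])
  have hi: "integrable torus ?h" using rh by (simp add: represents_def)
  have h: "fc ?h j = (if j = 0 then 0 else (\<Sum>\<^sub>\<infinity>n. a1 n * a2 (j - n)))" for j
    using represents_fcoeff[OF rh, of j] represents_fcoeff[OF rV, of j] fc_minus_mean[OF gi, of j] g by simp
  note s3 = dx_inv_abs_summable[OF c3, of "-t"]
  have c3': "(\<lambda>k. (cmod (fcoeff (dx_inv v3) k))\<^sup>2) summable_on UNIV"
  proof (rule summable_on_comparison_test[OF c3])
    fix k :: int
    have "inverse \<bar>real_of_int k\<bar> \<le> 1" if "k \<noteq> 0"
      using that by (simp add: field_simps)
    then have "cmod (fcoeff (dx_inv v3) k) \<le> 1 * cmod (fcoeff v3 k)"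
      unfolding dx_inv_fcoeff norm_mult
      by (intro mult_right_mono) (auto simp: norm_inverse norm_mult)
    then show "(cmod (fcoeff (dx_inv v3) k))\<^sup>2 \<le> (cmod (fcoeff v3 k))\<^sup>2" by (intro power_mono) auto
  qed auto
  let ?s = "\<lambda>x. (\<Sum>\<^sub>\<infinity>k. a3 k * ek k x)"
  have r3: "represents ?d3 ?U3" by (rule airy_represented(1)[OF c3'])
  have d3i: "integrable torus ?d3" using r3 by (simp add: represents_def)
  note S = fc_mult_abs_summable[OF s3 hi, folded a3_def]
  have ae: "AE x in torus. ?d3 x = ?s x"
    by (rule fc_determines_function[OF d3i S(1)])
       (unfold airy_represented(3)[OF c3'] a3_def, rule fc_abs_summable_series[OF s3, symmetric])
  let ?q = "\<lambda>x. ?h x * ?d3 x"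
  have qm: "?q \<in> borel_measurable torus" using hi d3i by measurable
  have qae: "AE x in torus. ?h x * ?s x = ?q x" using ae by eventually_elim simp
  have qi: "integrable torus ?q" by (rule integrable_cong_AE_imp[OF S(2) qm]) (use qae in eventually_elim, simp)
  have "fc ?q j = fc (\<lambda>x. ?h x * ?s x) j" for j
  proof -
    have "(LINT x|torus. ?q x * ek (- j) x) = (LINT x|torus. ?h x * ?s x * ek (- j) x)"
    proof (rule integral_cong_AE)
      show "(\<lambda>x. ?q x * ek (- j) x) \<in> borel_measurable torus" using integrable_mult_cont[OF qi continuous_on_ek] by auto
      show "(\<lambda>x. ?h x * ?s x * ek (- j) x) \<in> borel_measurable torus" using integrable_mult_cont[OF S(2) continuous_on_ek] by auto
      show "AE x in torus. ?q x * ek (- j) x = ?h x * ?s x * ek (- j) x" using qae by eventually_elim (simp only:)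
    qed
    then show ?thesis by (simp add: fc_def)
  qed
  then have q: "fc ?q j = (\<Sum>\<^sub>\<infinity>m. a3 m * (if j - m = 0 then 0 else (\<Sum>\<^sub>\<infinity>n. a1 n * a2 (j - m - n))))" for j
    using infsumI[OF S(3)[of j]] by (simp add: h)
  have "fcoeff (mean_free (mult ?V ?U3)) k = (if k = 0 then 0 else fc ?q k)" for k
    unfolding mult_def[of ?V ?U3] using represents_fcoeff[OF mean_free_of_fun[OF qi]] fc_minus_mean[OF qi] by simp
  then show ?thesis unfolding airy_def[of t] fmult_def q by simp
qed

section \<open>Smooth bump functions\<close>

text \<open>  Sums of products of smooth functions: the invariant that proves smoothness of a product by
  \<open>smooth_coinduct\<close>.\<close>

inductive smooth_alg :: "(real \<Rightarrow> complex) \<Rightarrow> bool" where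
  prod: "smooth f \<Longrightarrow> smooth g \<Longrightarrow> smooth_alg (\<lambda>x. f x * g x)"
| add: "smooth_alg f \<Longrightarrow> smooth_alg g \<Longrightarrow> smooth_alg (\<lambda>x. f x + g x)"

lemma smooth_alg_vderiv:
  "smooth_alg h \<Longrightarrow> \<exists>h'. (\<forall>x. (h has_vector_derivative h' x) (at x)) \<and> smooth_alg h'"
proof (induction rule: smooth_alg.induct)
  case (prod f g)
  have "((\<lambda>x. f x * g x) has_vector_derivative (f x * vderiv g x + vderiv f x * g x)) (at x)" for x
    by (rule has_vector_derivative_mult[OF smooth_has_vderiv[OF prod(1)] smooth_has_vderiv[OF prod(2)]])
  moreover have "smooth_alg (\<lambda>x. f x * vderiv g x + vderiv f x * g x)"
    using prod by (intro smooth_alg.intros smooth_vderiv)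
  ultimately show ?case by (intro exI conjI allI)
next
  case (add f g)
  then obtain f' g' where *: "\<And>x. (f has_vector_derivative f' x) (at x)" "smooth_alg f'"
    "\<And>x. (g has_vector_derivative g' x) (at x)" "smooth_alg g'" by blast
  have "((\<lambda>x. f x + g x) has_vector_derivative (f' x + g' x)) (at x)" for x
    by (rule has_vector_derivative_add[OF *(1,3)])
  moreover have "smooth_alg (\<lambda>x. f' x + g' x)" by (rule smooth_alg.add[OF *(2,4)])
  ultimately show ?case by (intro exI conjI allI)
qed

lemma smooth_mult: "smooth f \<Longrightarrow> smooth g \<Longrightarrow> smooth (\<lambda>x. f x * g x)"
proof (rule smooth_coinduct[where P=smooth_alg])
  fix h assume "smooth_alg h"
  then obtain h' where *: "\<And>x. (h has_vector_derivative h' x) (at x)" "smooth_alg h'"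
    using smooth_alg_vderiv by blast
  then show "(\<forall>x. h differentiable (at x)) \<and> smooth_alg (vderiv h)"
    using differentiableI_vderiv vderiv_eqI[OF *(1)] by metis
qed (rule smooth_alg.prod)

lemma smooth_primitive:
  assumes d: "\<And>x. (f has_vector_derivative g x) (at x)" and g: "smooth g"
  shows "smooth f"
proof (rule smooth_coinduct[where P="\<lambda>h. smooth h \<or> h = f"])
  fix h assume "smooth h \<or> h = f"
  then show "(\<forall>x. h differentiable (at x)) \<and> (smooth (vderiv h) \<or> vderiv h = f)"
    using smooth_differentiable smooth_vderiv differentiableI_vderiv[OF d] vderiv_eqI[OF d] g by blast
qed simp

lemma poly_exp_bounded:
  fixes p :: "real poly"
  assumes "0 < c" shows "\<exists>K. \<forall>y\<ge>0. \<bar>poly p y * exp (- (c * y))\<bar> \<le> K"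
  using assms
proof (induction p arbitrary: c rule: pCons_induct)
  case 0 then show ?case by auto
next
  case (pCons a p)
  from pCons(2)[of "c / 2"] pCons(3) obtain K where
    K: "\<And>y. y \<ge> 0 \<Longrightarrow> \<bar>poly p y * exp (- (c / 2 * y))\<bar> \<le> K" by auto
  have "\<bar>poly (pCons a p) y * exp (- (c * y))\<bar> \<le> \<bar>a\<bar> + 2 / c * K" if y: "y \<ge> 0" for y
  proof -
    have e: "exp (- (c * y)) = exp (- (c / 2 * y)) * exp (- (c / 2 * y))"
      by (simp flip: exp_add)
    have "c / 2 * y \<le> exp (c / 2 * y)" using exp_ge_add_one_self[of "c / 2 * y"] by linarith
    then have "y \<le> 2 / c * exp (c / 2 * y)" using pCons(3) by (simp add: field_simps)
    then have "y * exp (- (c / 2 * y)) \<le> 2 / c" by (simp add: exp_minus field_simps)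
    then have "(y * exp (- (c / 2 * y))) * \<bar>poly p y * exp (- (c / 2 * y))\<bar> \<le> 2 / c * K"
      using K[OF y] y pCons(3) by (intro mult_mono) auto
    then have 1: "\<bar>y * poly p y * exp (- (c * y))\<bar> \<le> 2 / c * K"
      unfolding e using y by (simp add: abs_mult mult_ac)
    have 2: "\<bar>a * exp (- (c * y))\<bar> \<le> \<bar>a\<bar>"
      using pCons(3) y by (simp add: abs_mult mult_left_le)
    have "poly (pCons a p) y * exp (- (c * y)) = a * exp (- (c * y)) + y * poly p y * exp (- (c * y))"
      by (simp add: algebra_simps)
    then show ?thesis using 1 2 by linarith
  qed
  then show ?case by blast
qed

text \<open>  For \<open>y = 1 / (\<sigma> * (t - a))\<close> this is \<open>p y * exp (- c * y)\<close>, extended by zero across \<open>t = a\<close>; the sign \<open>\<sigma>\<close>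
  selects the side. The polynomial factor makes the family closed under differentiation.\<close>

definition flat :: "real \<Rightarrow> real \<Rightarrow> real \<Rightarrow> real poly \<Rightarrow> real \<Rightarrow> complex" where
  "flat \<sigma> a c p t = (if \<sigma> * (t - a) > 0
     then complex_of_real (poly p (1 / (\<sigma> * (t - a))) * exp (- (c * (1 / (\<sigma> * (t - a)))))) else 0)"

text \<open>  Away from \<open>a\<close> this is the chain rule with \<open>y' = - \<sigma> * y\<^sup>2\<close>. At \<open>a\<close> the exponential beats \<open>y\<^sup>2 * p y\<close>, so
  the function is \<open>O((t - a)\<^sup>2)\<close> and its derivative vanishes.\<close>

lemma flat_has_derivative:
  assumes \<sigma>: "\<sigma> = 1 \<or> \<sigma> = -1" and c: "0 < c"
  shows "(flat \<sigma> a c p has_vector_derivative flat \<sigma> a c ([:0, 0, -\<sigma>:] * (pderiv p - smult c p)) t) (at t)"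
proof -
  have \<sigma>2: "\<sigma> * \<sigma> = 1" using \<sigma> by auto
  consider "\<sigma> * (t - a) > 0" | "\<sigma> * (t - a) < 0" | "\<sigma> * (t - a) = 0" by linarith
  then show ?thesis
  proof cases
    case 1
    let ?y = "\<lambda>t. 1 / (\<sigma> * (t - a))"
    have "((\<lambda>t. complex_of_real (poly p (?y t) * exp (- (c * ?y t)))) has_vector_derivative
        complex_of_real (poly ([:0, 0, -\<sigma>:] * (pderiv p - smult c p)) (?y t) * exp (- (c * ?y t)))) (at t)"
    proof (rule has_vector_derivative_of_real)
      have y: "(?y has_real_derivative (- \<sigma> * (?y t)\<^sup>2)) (at t)"
        using 1 by (auto intro!: derivative_eq_intros simp: power2_eq_square field_simps)
      have p: "((\<lambda>t. poly p (?y t)) has_real_derivative (poly (pderiv p) (?y t) * (- \<sigma> * (?y t)\<^sup>2))) (at t)"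
        by (rule DERIV_chain2[OF poly_DERIV y])
      show "((\<lambda>t. poly p (?y t) * exp (- (c * ?y t))) has_real_derivative
        poly ([:0, 0, -\<sigma>:] * (pderiv p - smult c p)) (?y t) * exp (- (c * ?y t))) (at t)"
        by (rule derivative_eq_intros p y refl)+ (simp add: algebra_simps power2_eq_square)
    qed
    then have "((\<lambda>t. complex_of_real (poly p (?y t) * exp (- (c * ?y t)))) has_vector_derivative
        flat \<sigma> a c ([:0, 0, -\<sigma>:] * (pderiv p - smult c p)) t) (at t)"
      using 1 by (simp add: flat_def)
    then show ?thesis
    proof (rule has_vector_derivative_transform_within_open[where S="{t. \<sigma> * (t - a) > 0}"])
      show "open {t. \<sigma> * (t - a) > 0}" by (intro open_Collect_less continuous_intros)
    qed (use 1 in \<open>auto simp: flat_def\<close>)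
  next
    case 2
    have "((\<lambda>t. 0) has_vector_derivative flat \<sigma> a c ([:0, 0, -\<sigma>:] * (pderiv p - smult c p)) t) (at t)"
      using 2 by (simp add: flat_def)
    then show ?thesis
    proof (rule has_vector_derivative_transform_within_open[where S="{t. \<sigma> * (t - a) < 0}"])
      show "open {t. \<sigma> * (t - a) < 0}" by (intro open_Collect_less continuous_intros)
    qed (use 2 in \<open>auto simp: flat_def\<close>)
  next
    case 3
    then have t: "t = a" using \<sigma> by auto
    obtain K where K: "\<And>y. y \<ge> 0 \<Longrightarrow> \<bar>poly ([:0, 0, 1:] * p) y * exp (- (c * y))\<bar> \<le> K"
      using poly_exp_bounded[OF c] by blast
    have K0: "0 \<le> K" using K[of 0] by simp
    have bd: "cmod (flat \<sigma> a c p (a + h)) \<le> K * h\<^sup>2" for h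
    proof (cases "\<sigma> * h > 0")
      case True
      have y: "1 / (\<sigma> * h) \<ge> 0" using True by simp
      have "\<bar>poly p (1 / (\<sigma> * h)) * exp (- (c * (1 / (\<sigma> * h))))\<bar> * (1 / (\<sigma> * h))\<^sup>2 \<le> K"
        using K[OF y] by (simp add: abs_mult power2_eq_square mult_ac)
      moreover have "(1 / (\<sigma> * h))\<^sup>2 = 1 / h\<^sup>2" using \<sigma> by (auto simp: power_divide)
      moreover have "h\<^sup>2 > 0" using True by auto
      ultimately have "\<bar>poly p (1 / (\<sigma> * h)) * exp (- (c * (1 / (\<sigma> * h))))\<bar> \<le> K * h\<^sup>2"
        by (simp add: field_simps)
      then show ?thesis using True by (simp add: flat_def del: of_real_mult)
    next
      case False then show ?thesis using K0 by (simp add: flat_def)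
    qed
    have "(flat \<sigma> a c p has_vector_derivative 0) (at a)"
      unfolding has_vector_derivative_def has_derivative_at
    proof (intro conjI)
      show "(\<lambda>h. norm (flat \<sigma> a c p (a + h) - flat \<sigma> a c p a - h *\<^sub>R 0) / norm h) \<midarrow>0\<rightarrow> 0"
      proof (rule Lim_null_comparison)
        show "\<forall>\<^sub>F h in at 0. norm (norm (flat \<sigma> a c p (a + h) - flat \<sigma> a c p a - h *\<^sub>R 0) / norm h) \<le> K * \<bar>h\<bar>"
        proof (intro always_eventually allI)
          fix h :: real
          have "cmod (flat \<sigma> a c p (a + h)) / \<bar>h\<bar> \<le> K * \<bar>h\<bar>"
          proof (cases "h = 0")
            case False
            then show ?thesis using bd[of h] by (simp add: divide_le_eq power2_eq_square mult.assoc)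
          qed simp
          then show "norm (norm (flat \<sigma> a c p (a + h) - flat \<sigma> a c p a - h *\<^sub>R 0) / norm h) \<le> K * \<bar>h\<bar>"
            by (simp add: flat_def[of \<sigma> a c p a])
        qed
        have "((\<lambda>h. K * \<bar>h\<bar>) \<longlongrightarrow> K * \<bar>0\<bar>) (at 0)" by (intro tendsto_intros)
        then show "((\<lambda>h. K * \<bar>h\<bar>) \<longlongrightarrow> 0) (at 0)" by simp
      qed
    qed simp
    then show ?thesis using t by (simp add: flat_def[of \<sigma> a c _ a])
  qed
qed

lemma smooth_flat:
  assumes "\<sigma> = 1 \<or> \<sigma> = -1" "0 < c" shows "smooth (flat \<sigma> a c p)"
proof (rule smooth_coinduct[where P="\<lambda>f. \<exists>p. f = flat \<sigma> a c p"])
  fix f assume "\<exists>p. f = flat \<sigma> a c p"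
  then obtain p where f: "f = flat \<sigma> a c p" by blast
  have "vderiv f = flat \<sigma> a c ([:0, 0, -\<sigma>:] * (pderiv p - smult c p))"
    unfolding f by (rule vderiv_eqI[OF flat_has_derivative[OF assms]])
  then show "(\<forall>x. f differentiable (at x)) \<and> (\<exists>p. vderiv f = flat \<sigma> a c p)"
    using differentiableI_vderiv[OF flat_has_derivative[OF assms]] f by blast
qed blast

definition bump :: "real \<Rightarrow> real \<Rightarrow> real \<Rightarrow> real \<Rightarrow> complex" where
  "bump c a b t = flat 1 a c 1 t * flat (-1) b c 1 t"

lemma bump_eq:
  "bump c a b t = (if a < t \<and> t < b then complex_of_real (exp (- (c / (t - a))) * exp (- (c / (b - t)))) else 0)"
  by (auto simp: bump_def flat_def)

lemma smooth_bump: "0 < c \<Longrightarrow> smooth (bump c a b)"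
  unfolding bump_def[abs_def] by (intro smooth_mult smooth_flat) auto

lemma norm_bump_le: "0 < c \<Longrightarrow> cmod (bump c a b t) \<le> 1"
  unfolding bump_eq by (auto simp: norm_mult intro!: mult_le_one)

text \<open>  The support shrinks to a compact subset of the interval while the parameter \<open>c\<close> tends to zero, so
  the bumps are test functions that exhaust the interval.\<close>

lemma bump_tendsto_indicator:
  "(\<lambda>n. bump (1 / Suc n) (a + 1 / Suc n) (b - 1 / Suc n) t) \<longlonglongrightarrow> indicator {a<..<b} t"
proof (cases "t \<in> {a<..<b}")
  case True
  have l: "(\<lambda>n. 1 / real (Suc n)) \<longlonglongrightarrow> 0" by (rule LIMSEQ_Suc[OF lim_1_over_n])
  have l1: "(\<lambda>n. t - (a + 1 / real (Suc n))) \<longlonglongrightarrow> t - (a + 0)" by (intro tendsto_intros l)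
  have l2: "(\<lambda>n. (b - 1 / real (Suc n)) - t) \<longlonglongrightarrow> (b - 0) - t" by (intro tendsto_intros l)
  have "\<forall>\<^sub>F n in sequentially. 0 < t - (a + 1 / real (Suc n))" using order_tendstoD(1)[OF l1, of 0] True by auto
  moreover have "\<forall>\<^sub>F n in sequentially. 0 < (b - 1 / real (Suc n)) - t" using order_tendstoD(1)[OF l2, of 0] True by auto
  ultimately have e: "\<forall>\<^sub>F n in sequentially.
     complex_of_real (exp (- ((1 / Suc n) / (t - (a + 1 / Suc n)))) * exp (- ((1 / Suc n) / ((b - 1 / Suc n) - t))))
     = bump (1 / Suc n) (a + 1 / Suc n) (b - 1 / Suc n) t"
    by eventually_elim (auto simp: bump_eq)
  have "(\<lambda>n. complex_of_real (exp (- ((1 / Suc n) / (t - (a + 1 / Suc n)))) * exp (- ((1 / Suc n) / ((b - 1 / Suc n) - t)))))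
     \<longlonglongrightarrow> complex_of_real (exp (- (0 / (t - (a + 0)))) * exp (- (0 / ((b - 0) - t))))"
    using True by (intro tendsto_of_real tendsto_mult tendsto_exp tendsto_minus tendsto_divide l l1 l2) auto
  then have "(\<lambda>n. complex_of_real (exp (- ((1 / Suc n) / (t - (a + 1 / Suc n)))) * exp (- ((1 / Suc n) / ((b - 1 / Suc n) - t))))) \<longlonglongrightarrow> 1" by simp
  from Lim_transform_eventually[OF this e] show ?thesis using True by simp
next
  case False
  have "bump (1 / Suc n) (a + 1 / Suc n) (b - 1 / Suc n) t = 0" for n
  proof -
    have "0 < 1 / real (Suc n)" by simp
    then have "a + 1 / real (Suc n) < t \<Longrightarrow> a < t" "t < b - 1 / real (Suc n) \<Longrightarrow> t < b" by linarith+
    then have "\<not> (a + 1 / real (Suc n) < t \<and> t < b - 1 / real (Suc n))"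
      using False unfolding greaterThanLessThan_iff by blast
    then show ?thesis by (simp only: bump_eq if_False)
  qed
  then show ?thesis using False by (simp only:) simp
qed

section \<open>Indefinite integrals\<close>

text \<open>  \<open>A\<close> is an indefinite integral of \<open>a\<close>, in other words absolutely continuous with derivative \<open>a\<close>. The
  integral over \<open>{s0..t}\<close> is written with a cutoff so that a single measure space serves for all \<open>t\<close>.\<close>

definition primitive :: "real \<Rightarrow> real \<Rightarrow> (real \<Rightarrow> complex) \<Rightarrow> (real \<Rightarrow> complex) \<Rightarrow> bool" where
  "primitive s0 s A a \<longleftrightarrow> integrable (lebesgue_on {s0..s}) a \<and>
     (\<forall>t\<in>{s0..s}. A t = A s0 + (LINT x|lebesgue_on {s0..s}. of_bool (x \<le> t) * a x))"

lemma le_pred_measurable: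
  fixes t s0 s :: real
  shows "(\<lambda>x. of_bool (x \<le> t) :: complex) \<in> borel_measurable (lebesgue_on {s0..s})"
proof (rule borel_measurable_lebesgue_onI)
  have "(\<lambda>x. of_bool (x \<le> t) :: complex) = (\<lambda>x. complex_of_real (indicator {..t} x))"
    by (auto simp: indicator_def)
  moreover have "(\<lambda>x. complex_of_real (indicator {..t} x)) \<in> borel_measurable borel"
    by (rule measurable_compose[OF borel_measurable_indicator borel_measurable_of_real]) simp
  ultimately show "(\<lambda>x. of_bool (x \<le> t) :: complex) \<in> borel_measurable borel" by (simp only:)
qed

lemma integrable_of_bool:
  assumes "integrable (lebesgue_on {s0..s}) a" and "P \<in> borel_measurable (lebesgue_on {s0..s})" "\<And>x. cmod (P x) \<le> 1"
  shows "integrable (lebesgue_on {s0..s}) (\<lambda>x. P x * a x)"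
proof (rule Bochner_Integration.integrable_bound[OF assms(1)])
  show "(\<lambda>x. P x * a x) \<in> borel_measurable (lebesgue_on {s0..s})" using assms by measurable
  show "AE x in lebesgue_on {s0..s}. norm (P x * a x) \<le> norm (a x)"
    using assms(3) by (intro AE_I2) (simp add: norm_mult mult_left_le_one_le)
qed

lemma primitive_integrable: "primitive s0 s A a \<Longrightarrow> integrable (lebesgue_on {s0..s}) a"
  unfolding primitive_def by blast

lemma primitive_bounded:
  assumes "primitive s0 s A a" "t \<in> {s0..s}"
  shows "cmod (A t) \<le> cmod (A s0) + (LINT x|lebesgue_on {s0..s}. cmod (a x))"
proof -
  have ai: "integrable (lebesgue_on {s0..s}) a" by (rule primitive_integrable[OF assms(1)])
  have i: "integrable (lebesgue_on {s0..s}) (\<lambda>x. of_bool (x \<le> t) * a x)"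
    by (rule integrable_of_bool[OF ai le_pred_measurable]) simp
  have "cmod (LINT x|lebesgue_on {s0..s}. of_bool (x \<le> t) * a x) \<le> (LINT x|lebesgue_on {s0..s}. cmod (of_bool (x \<le> t) * a x))"
    by (rule integral_norm_bound)
  also have "\<dots> \<le> (LINT x|lebesgue_on {s0..s}. cmod (a x))"
    by (rule integral_mono[OF integrable_norm[OF i] integrable_norm[OF ai]]) (simp add: norm_mult)
  finally show ?thesis using assms norm_triangle_ineq[of "A s0"] unfolding primitive_def
    by (metis (no_types, lifting) add_left_mono order_trans)
qed

lemma primitive_continuous:
  assumes "primitive s0 s A a" shows "continuous_on {s0..s} A"
  unfolding continuous_on_sequentially comp_def
proof (intro allI ballI impI)
  let ?M = "lebesgue_on {s0..s}"
  fix x t assume x: "t \<in> {s0..s}" and *: "(\<forall>n. x n \<in> {s0..s}) \<and> x \<longlonglongrightarrow> t"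
  have ai: "integrable ?M a" by (rule primitive_integrable[OF assms(1)])
  have "(\<lambda>n. A s0 + (LINT y|?M. of_bool (y \<le> x n) * a y)) \<longlonglongrightarrow> A s0 + (LINT y|?M. of_bool (y \<le> t) * a y)"
  proof (intro tendsto_intros integral_dominated_convergence)
    show "integrable ?M (\<lambda>y. norm (a y))" using ai by simp
    show "(\<lambda>y. of_bool (y \<le> t) * a y) \<in> borel_measurable ?M" for t
      using integrable_of_bool[OF ai le_pred_measurable] by auto
    show "(\<lambda>y. of_bool (y \<le> x n) * a y) \<in> borel_measurable ?M" for n
      using integrable_of_bool[OF ai le_pred_measurable] by auto
    show "AE y in ?M. norm (of_bool (y \<le> x n) * a y) \<le> norm (a y)" for n by (auto simp: norm_mult)
    show "AE y in ?M. (\<lambda>n. of_bool (y \<le> x n) * a y) \<longlonglongrightarrow> of_bool (y \<le> t) * a y"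
      using AE_lebesgue_on_not_eq[where c=t]
    proof eventually_elim
      case (elim y)
      have "\<forall>\<^sub>F n in sequentially. (y \<le> x n) = (y \<le> t)"
      proof (cases "y < t")
        case True
        then show ?thesis using order_tendstoD(1)[OF conjunct2[OF *] True] by (auto elim!: eventually_mono)
      next
        case False
        then have "t < y" using elim by simp
        then show ?thesis using order_tendstoD(2)[OF conjunct2[OF *], of y] by (auto elim!: eventually_mono)
      qed
      then have "\<forall>\<^sub>F n in sequentially. of_bool (y \<le> x n) * a y = of_bool (y \<le> t) * a y"
        by eventually_elim simp
      then show ?case by (rule tendsto_eventually)
    qed
  qed
  moreover have rep: "A u = A s0 + (LINT y|?M. of_bool (y \<le> u) * a y)" if "u \<in> {s0..s}" for u
    using assms that unfolding primitive_def by blast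
  moreover have "(\<lambda>n. A (x n)) = (\<lambda>n. A s0 + (LINT y|?M. of_bool (y \<le> x n) * a y))"
    by (rule ext, rule rep) (use * in blast)
  ultimately show "(\<lambda>n. A (x n)) \<longlonglongrightarrow> A t" unfolding rep[OF x] by (simp only:)
qed

lemma primitive_of_derivative:
  assumes s: "s0 \<le> s" and d: "\<And>t. t \<in> {s0..s} \<Longrightarrow> (A has_vector_derivative a t) (at t)" and c: "continuous_on {s0..s} a"
  shows "primitive s0 s A a"
  unfolding primitive_def
proof (intro conjI ballI)
  show ai: "integrable (lebesgue_on {s0..s}) a" by (rule cont_integrable_Icc[OF c])
  fix t assume t: "t \<in> {s0..s}"
  have "(LINT x|lebesgue_on {s0..s}. of_bool (x \<le> t) * a x) = (LINT x|lebesgue_on {s0..s}. (if x \<in> {s0..t} then a x else 0))"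
    by (intro Bochner_Integration.integral_cong refl) auto
  also have "\<dots> = (LINT x|lebesgue_on {s0..t}. a x)"
    using t by (intro Lebesgue_Measure.integral_restrict) auto
  also have "\<dots> = integral {s0..t} a"
    using t by (intro cont_LINT_Icc continuous_on_subset[OF c]) auto
  also have "\<dots> = A t - A s0"
    using t by (intro integral_unique fundamental_theorem_of_calculus has_vector_derivative_at_within[OF d]) auto
  finally show "A t = A s0 + (LINT x|lebesgue_on {s0..s}. of_bool (x \<le> t) * a x)" by simp
qed

lemma integrable_mult_bounded_measurable:
  fixes a b :: "real \<Rightarrow> complex"
  assumes a: "integrable (lebesgue_on {s0..s}) a" and b: "b \<in> borel_measurable (lebesgue_on {s0..s})"
    and bd: "\<And>x. x \<in> {s0..s} \<Longrightarrow> cmod (b x) \<le> K"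
  shows "integrable (lebesgue_on {s0..s}) (\<lambda>x. a x * b x)"
proof (rule Bochner_Integration.integrable_bound)
  show "integrable (lebesgue_on {s0..s}) (\<lambda>x. cmod (a x) * K)" using a by simp
  show "(\<lambda>x. a x * b x) \<in> borel_measurable (lebesgue_on {s0..s})" using a b by measurable
  show "AE x in lebesgue_on {s0..s}. norm (a x * b x) \<le> norm (cmod (a x) * K)"
  proof (rule AE_I2)
    fix x assume "x \<in> space (lebesgue_on {s0..s})"
    then have "cmod (a x) * cmod (b x) \<le> cmod (a x) * \<bar>K\<bar>"
      using bd[of x] by (intro mult_left_mono) auto
    then show "norm (a x * b x) \<le> norm (cmod (a x) * K)" by (simp add: norm_mult abs_mult)
  qed
qed

text \<open>  Fubini's theorem on the two halves of a square. Applied to functions cut off at \<open>t\<close> it gives the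
  product rule for indefinite integrals, which are in general nowhere known to be differentiable.\<close>

lemma integral_product_le_split:
  fixes \<alpha> \<beta> :: "real \<Rightarrow> complex" and s0 s :: real
  defines "M \<equiv> lebesgue_on {s0..s}"
  assumes \<alpha>: "integrable M \<alpha>" and \<beta>: "integrable M \<beta>"
  shows "integral\<^sup>L M \<alpha> * integral\<^sup>L M \<beta>
    = (LINT x|M. \<alpha> x * (LINT y|M. of_bool (y \<le> x) * \<beta> y)) + (LINT y|M. \<beta> y * (LINT x|M. of_bool (x \<le> y) * \<alpha> x))"
    and "integrable M (\<lambda>x. \<alpha> x * (LINT y|M. of_bool (y \<le> x) * \<beta> y))"
proof -
  interpret M: finite_measure M unfolding M_def by (rule finite_measure_lebesgue_on_Icc)
  interpret P: pair_sigma_finite M M by unfold_locales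
  have [measurable]: "\<alpha> \<in> borel_measurable M" "\<beta> \<in> borel_measurable M" using \<alpha> \<beta> by auto
  have id1: "(\<lambda>z. fst z) \<in> borel_measurable (M \<Otimes>\<^sub>M M)" "(\<lambda>z. snd z) \<in> borel_measurable (M \<Otimes>\<^sub>M M)"
  proof -
    have "(\<lambda>x. x) \<in> borel_measurable M" unfolding M_def by (rule borel_measurable_lebesgue_onI) simp
    from measurable_compose[OF measurable_fst[of M M] this] measurable_compose[OF measurable_snd[of M M] this]
    show "(\<lambda>z. fst z) \<in> borel_measurable (M \<Otimes>\<^sub>M M)" "(\<lambda>z. snd z) \<in> borel_measurable (M \<Otimes>\<^sub>M M)" by simp_all
  qed
  have pm: "(\<lambda>z. of_bool (snd z \<le> fst z) :: complex) \<in> borel_measurable (M \<Otimes>\<^sub>M M)"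
  proof -
    have "{z \<in> space (M \<Otimes>\<^sub>M M). snd z \<le> fst z} \<in> sets (M \<Otimes>\<^sub>M M)"
      by (rule borel_measurable_le[OF id1(2) id1(1)])
    then have "(\<lambda>z. if snd z \<le> fst z then 1 else (0::complex)) \<in> borel_measurable (M \<Otimes>\<^sub>M M)"
      by (intro measurable_If) auto
    then show ?thesis by (simp add: of_bool_def)
  qed
  have prod: "integrable (M \<Otimes>\<^sub>M M) (\<lambda>(x, y). \<alpha> x * \<beta> y)"
  proof (rule P.Fubini_integrable)
    show "(\<lambda>(x, y). \<alpha> x * \<beta> y) \<in> borel_measurable (M \<Otimes>\<^sub>M M)" by measurable
    show "integrable M (\<lambda>x. LINT y|M. norm (case (x, y) of (x, y) \<Rightarrow> \<alpha> x * \<beta> y))"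
      using \<alpha> by (simp add: norm_mult)
    show "AE x in M. integrable M (\<lambda>y. case (x, y) of (x, y) \<Rightarrow> \<alpha> x * \<beta> y)"
      using \<beta> by (intro AE_I2) simp
  qed
  let ?p = "\<lambda>x y. of_bool (y \<le> x) :: complex"
  have i1: "integrable (M \<Otimes>\<^sub>M M) (\<lambda>(x, y). ?p x y * (\<alpha> x * \<beta> y))"
  proof (rule Bochner_Integration.integrable_bound[OF prod])
    show "(\<lambda>(x, y). ?p x y * (\<alpha> x * \<beta> y)) \<in> borel_measurable (M \<Otimes>\<^sub>M M)"
      unfolding case_prod_beta by (intro borel_measurable_times pm) measurable
    show "AE z in M \<Otimes>\<^sub>M M. norm (case z of (x, y) \<Rightarrow> ?p x y * (\<alpha> x * \<beta> y)) \<le> norm (case z of (x, y) \<Rightarrow> \<alpha> x * \<beta> y)"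
      by (intro AE_I2) (auto simp: norm_mult)
  qed
  have i2: "integrable (M \<Otimes>\<^sub>M M) (\<lambda>(x, y). (1 - ?p x y) * (\<alpha> x * \<beta> y))"
    using Bochner_Integration.integrable_diff[OF prod i1] by (simp add: case_prod_unfold left_diff_distrib)
  have "integral\<^sup>L M \<alpha> * integral\<^sup>L M \<beta> = (LINT x|M. LINT y|M. \<alpha> x * \<beta> y)" by simp
  also have "\<dots> = integral\<^sup>L (M \<Otimes>\<^sub>M M) (\<lambda>(x, y). \<alpha> x * \<beta> y)"
    using P.integral_fst'[OF prod] by simp
  also have "\<dots> = integral\<^sup>L (M \<Otimes>\<^sub>M M) (\<lambda>(x, y). ?p x y * (\<alpha> x * \<beta> y)) + integral\<^sup>L (M \<Otimes>\<^sub>M M) (\<lambda>(x, y). (1 - ?p x y) * (\<alpha> x * \<beta> y))"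
    using Bochner_Integration.integral_add[OF i1 i2] by (simp add: case_prod_unfold left_diff_distrib)
  also have "integral\<^sup>L (M \<Otimes>\<^sub>M M) (\<lambda>(x, y). ?p x y * (\<alpha> x * \<beta> y)) = (LINT x|M. LINT y|M. ?p x y * (\<alpha> x * \<beta> y))"
    using P.integral_fst'[OF i1] by simp
  also have "(LINT x|M. LINT y|M. ?p x y * (\<alpha> x * \<beta> y)) = (LINT x|M. \<alpha> x * (LINT y|M. ?p x y * \<beta> y))"
    by (simp add: mult.left_commute)
  also have "integral\<^sup>L (M \<Otimes>\<^sub>M M) (\<lambda>(x, y). (1 - ?p x y) * (\<alpha> x * \<beta> y)) = (LINT y|M. LINT x|M. (1 - ?p x y) * (\<alpha> x * \<beta> y))"
    using P.integral_snd[OF i2] by simp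
  also have "\<dots> = (LINT y|M. \<beta> y * (LINT x|M. (1 - ?p x y) * \<alpha> x))"
  proof -
    have r: "(1 - ?p x y) * (\<alpha> x * \<beta> y) = \<beta> y * ((1 - ?p x y) * \<alpha> x)" for x y by simp
    show ?thesis unfolding r integral_mult_right_zero ..
  qed
  also have "(LINT y|M. \<beta> y * (LINT x|M. (1 - ?p x y) * \<alpha> x)) = (LINT y|M. \<beta> y * (LINT x|M. of_bool (x \<le> y) * \<alpha> x))"
  proof -
  have swap: "(LINT x|M. (1 - ?p x y) * \<alpha> x) = (LINT x|M. of_bool (x \<le> y) * \<alpha> x)" for y
  proof (rule integral_cong_AE)
    have m: "(\<lambda>x. of_bool (x \<le> y) * \<alpha> x) \<in> borel_measurable M"
      using le_pred_measurable[of y s0 s] unfolding M_def[symmetric] by measurable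
    show "(\<lambda>x. of_bool (x \<le> y) * \<alpha> x) \<in> borel_measurable M" by fact
    have ae: "AE x in M. of_bool (x \<le> y) * \<alpha> x = (1 - ?p x y) * \<alpha> x"
      unfolding M_def using AE_lebesgue_on_not_eq[where c=y] by eventually_elim auto
    show "(\<lambda>x. (1 - ?p x y) * \<alpha> x) \<in> borel_measurable M"
      using m ae unfolding M_def by (rule borel_measurable_lebesgue_on_AE)
    show "AE x in M. (1 - ?p x y) * \<alpha> x = of_bool (x \<le> y) * \<alpha> x"
      using ae by eventually_elim (simp only:)
  qed
  show ?thesis by (simp only: swap)
  qed
  finally show "integral\<^sup>L M \<alpha> * integral\<^sup>L M \<beta>
    = (LINT x|M. \<alpha> x * (LINT y|M. of_bool (y \<le> x) * \<beta> y)) + (LINT y|M. \<beta> y * (LINT x|M. of_bool (x \<le> y) * \<alpha> x))" .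
  show "integrable M (\<lambda>x. \<alpha> x * (LINT y|M. of_bool (y \<le> x) * \<beta> y))"
    using P.integrable_fst'[OF i1] by (simp add: mult.left_commute)
qed

lemma primitive_measurable:
  assumes "primitive s0 s A a" shows "A \<in> borel_measurable (lebesgue_on {s0..s})"
  by (intro borel_measurable_integrable cont_integrable_Icc primitive_continuous[OF assms])

lemma primitive_mult:
  assumes A: "primitive s0 s A a" and B: "primitive s0 s B b"
  shows "primitive s0 s (\<lambda>t. A t * B t) (\<lambda>t. a t * B t + b t * A t)"
proof -
  let ?M = "lebesgue_on {s0..s}"
  note ai = primitive_integrable[OF A] and bi = primitive_integrable[OF B]
  have iaB: "integrable ?M (\<lambda>t. a t * B t)"
    by (rule integrable_mult_bounded_measurable[OF ai primitive_measurable[OF B] primitive_bounded[OF B]])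
  have ibA: "integrable ?M (\<lambda>t. b t * A t)"
    by (rule integrable_mult_bounded_measurable[OF bi primitive_measurable[OF A] primitive_bounded[OF A]])
  have "A t * B t = A s0 * B s0 + (LINT x|?M. of_bool (x \<le> t) * (a x * B x + b x * A x))" if t: "t \<in> {s0..s}" for t
  proof -
    let ?p = "\<lambda>x. of_bool (x \<le> t) :: complex"
    have \<alpha>: "integrable ?M (\<lambda>x. ?p x * a x)" by (rule integrable_of_bool[OF ai le_pred_measurable]) simp
    have \<beta>: "integrable ?M (\<lambda>x. ?p x * b x)" by (rule integrable_of_bool[OF bi le_pred_measurable]) simp
    have \<alpha>B: "integrable ?M (\<lambda>x. ?p x * (a x * B x))" by (rule integrable_of_bool[OF iaB le_pred_measurable]) simp
    have \<beta>A: "integrable ?M (\<lambda>x. ?p x * (b x * A x))" by (rule integrable_of_bool[OF ibA le_pred_measurable]) simp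
    have inner: "?p x * f x * (LINT y|?M. of_bool (y \<le> x) * (?p y * g y)) = ?p x * f x * (G x - G s0)"
      if G: "primitive s0 s G g" and x: "x \<in> {s0..s}" for f g G x
    proof (cases "x \<le> t")
      case True
      have "(LINT y|?M. of_bool (y \<le> x) * (?p y * g y)) = (LINT y|?M. of_bool (y \<le> x) * g y)"
        using True by (intro Bochner_Integration.integral_cong refl) auto
      also have "\<dots> = G x - G s0" using G x unfolding primitive_def by (metis add_diff_cancel_left')
      finally show ?thesis by simp
    qed simp
    have e1: "(LINT x|?M. ?p x * a x * (LINT y|?M. of_bool (y \<le> x) * (?p y * b y))) = (LINT x|?M. ?p x * (a x * B x)) - B s0 * (LINT x|?M. ?p x * a x)"
    proof -
      have "(LINT x|?M. ?p x * a x * (LINT y|?M. of_bool (y \<le> x) * (?p y * b y))) = (LINT x|?M. ?p x * a x * (B x - B s0))"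
        by (intro Bochner_Integration.integral_cong refl inner[OF B]) simp
      also have "\<dots> = (LINT x|?M. ?p x * (a x * B x) - B s0 * (?p x * a x))"
        by (intro Bochner_Integration.integral_cong refl) (simp add: algebra_simps)
      also have "\<dots> = (LINT x|?M. ?p x * (a x * B x)) - (LINT x|?M. B s0 * (?p x * a x))"
        by (intro Bochner_Integration.integral_diff \<alpha>B integrable_mult_right \<alpha>)
      finally show ?thesis by simp
    qed
    have e2: "(LINT x|?M. ?p x * b x * (LINT y|?M. of_bool (y \<le> x) * (?p y * a y))) = (LINT x|?M. ?p x * (b x * A x)) - A s0 * (LINT x|?M. ?p x * b x)"
    proof -
      have "(LINT x|?M. ?p x * b x * (LINT y|?M. of_bool (y \<le> x) * (?p y * a y))) = (LINT x|?M. ?p x * b x * (A x - A s0))"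
        by (intro Bochner_Integration.integral_cong refl inner[OF A]) simp
      also have "\<dots> = (LINT x|?M. ?p x * (b x * A x) - A s0 * (?p x * b x))"
        by (intro Bochner_Integration.integral_cong refl) (simp add: algebra_simps)
      also have "\<dots> = (LINT x|?M. ?p x * (b x * A x)) - (LINT x|?M. A s0 * (?p x * b x))"
        by (intro Bochner_Integration.integral_diff \<beta>A integrable_mult_right \<beta>)
      finally show ?thesis by simp
    qed
    have At: "A t = A s0 + (LINT x|?M. ?p x * a x)" and Bt: "B t = B s0 + (LINT x|?M. ?p x * b x)"
      using A B t unfolding primitive_def by blast+
    have "A t * B t = A s0 * B s0 + A s0 * (LINT x|?M. ?p x * b x) + B s0 * (LINT x|?M. ?p x * a x)
        + (LINT x|?M. ?p x * a x) * (LINT x|?M. ?p x * b x)"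
      unfolding At Bt by (simp add: algebra_simps)
    also have "\<dots> = A s0 * B s0 + ((LINT x|?M. ?p x * (a x * B x)) + (LINT x|?M. ?p x * (b x * A x)))"
      unfolding integral_product_le_split(1)[OF \<alpha> \<beta>] e1 e2 by simp
    also have "(LINT x|?M. ?p x * (a x * B x)) + (LINT x|?M. ?p x * (b x * A x)) = (LINT x|?M. ?p x * (a x * B x + b x * A x))"
      using Bochner_Integration.integral_add[OF \<alpha>B \<beta>A] by (simp add: distrib_left)
    finally show ?thesis .
  qed
  then show ?thesis
    unfolding primitive_def by (intro conjI ballI Bochner_Integration.integrable_add iaB ibA)
qed

section \<open>Weak time derivatives and oscillatory integrals\<close>

lemma integral_zero_if_bumps_zero:
  assumes s: "s0 < s" and h: "integrable (lebesgue_on {s0..s}) h"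
    and z: "\<And>c a b. 0 < c \<Longrightarrow> s0 < a \<Longrightarrow> b < s \<Longrightarrow> (LINT t|lebesgue_on {s0..s}. bump c a b t * h t) = 0"
  shows "AE t in lebesgue_on {s0..s}. h t = 0"
proof (rule integral_zero_if_intervals_zero[OF s h])
  let ?M = "lebesgue_on {s0..s}"
  fix x assume x: "s0 < x" "x \<le> s"
  let ?b = "\<lambda>n. bump (1 / Suc n) (s0 + 1 / Suc n) (x - 1 / Suc n)"
  have bm: "?b n \<in> borel_measurable ?M" for n
    by (intro borel_measurable_integrable cont_integrable_Icc smooth_continuous_on smooth_bump) simp
  have "(\<lambda>n. LINT t|?M. ?b n t * h t) \<longlonglongrightarrow> (LINT t|?M. indicator {s0<..<x} t * h t)"
  proof (rule integral_dominated_convergence)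
    show "integrable ?M (\<lambda>t. norm (h t))" using h by simp
    show bh: "(\<lambda>t. ?b n t * h t) \<in> borel_measurable ?M" for n using bm h by (intro borel_measurable_times) auto
    show lim: "AE t in ?M. (\<lambda>n. ?b n t * h t) \<longlonglongrightarrow> indicator {s0<..<x} t * h t"
      by (intro AE_I2 tendsto_mult bump_tendsto_indicator tendsto_const)
    show "(\<lambda>t. indicator {s0<..<x} t * h t) \<in> borel_measurable ?M"
      by (rule borel_measurable_lebesgue_on_AE_lim[OF bh lim])
    show "AE t in ?M. norm (?b n t * h t) \<le> norm (h t)" for n
      by (intro AE_I2) (simp add: norm_mult mult_left_le_one_le norm_bump_le del: of_nat_Suc)
  qed
  moreover have "(LINT t|?M. ?b n t * h t) = 0" for n
  proof (rule z)
    have "0 < 1 / real (Suc n)" by simp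
    then show "x - 1 / real (Suc n) < s" using x by linarith
  qed simp_all
  ultimately have "(\<lambda>n. 0) \<longlonglongrightarrow> (LINT t|?M. indicator {s0<..<x} t * h t)" by (simp only:)
  then have "(LINT t|?M. indicator {s0<..<x} t * h t) = 0"
    by (simp add: LIMSEQ_const_iff)
  moreover have "indicat_real {s0<..<x} t *\<^sub>R h t = indicator {s0<..<x} t * h t" for t
    by (simp add: indicator_def)
  ultimately show "(LINT t:{s0<..<x}|?M. h t) = 0"
    unfolding set_lebesgue_integral_def by simp
qed

lemma bump_integral_nonzero:
  assumes "s0 < s" shows "\<exists>c a b. 0 < c \<and> s0 < a \<and> b < s \<and> (LINT t|lebesgue_on {s0..s}. bump c a b t) \<noteq> 0"
proof (rule ccontr)
  assume "\<not> ?thesis"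
  then have z: "\<And>c a b. 0 < c \<Longrightarrow> s0 < a \<Longrightarrow> b < s \<Longrightarrow> (LINT t|lebesgue_on {s0..s}. bump c a b t * 1) = 0" by auto
  have i: "integrable (lebesgue_on {s0..s}) (\<lambda>t. 1::complex)"
    by (rule finite_measure.integrable_const[OF finite_measure_lebesgue_on_Icc])
  have "AE t in lebesgue_on {s0..s}. (1::complex) = 0"
    by (rule integral_zero_if_bumps_zero[OF assms i z])
  from AE_lebesgue_on_const[OF assms this] show False by simp
qed

text \<open>  The indefinite integral vanishes on the left of the support and, the mean being zero, also on its
  right.\<close>

lemma time_test_antiderivative:
  assumes \<eta>: "smooth \<eta>" and ab: "s0 < a" "b < s" and supp: "\<And>t. t \<notin> {a..b} \<Longrightarrow> \<eta> t = 0"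
    and z: "(LINT t|lebesgue_on {s0..s}. \<eta> t) = 0" and s: "s0 < s"
  shows "\<exists>\<psi>. time_test s0 s \<psi> \<and> vderiv \<psi> = \<eta>"
proof -
  note c = smooth_continuous_on[OF \<eta>]
  define \<psi> where "\<psi> t = integral {s0..t} \<eta>" for t
  have low: "\<psi> t = 0" if "t < a" for t
  proof -
    have "\<psi> t = integral {s0..t} (\<lambda>x. 0)"
      unfolding \<psi>_def using that by (intro integral_cong supp) auto
    then show ?thesis by simp
  qed
  have full: "integral {s0..s} \<eta> = 0" using z cont_LINT_Icc[OF c] by simp
  have high: "\<psi> t = 0" if "b < t" for t
  proof (cases "s0 \<le> t")
    case True
    have ext: "integral {s0..u} \<eta> = integral {s0..max t s} \<eta>" if "u \<in> {t, s}" for u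
    proof -
      have u: "s0 \<le> u" "u \<le> max t s" "b < u" using that True s ab \<open>b < t\<close> by auto
      have "integral {s0..u} \<eta> + integral {u..max t s} \<eta> = integral {s0..max t s} \<eta>"
        by (rule Henstock_Kurzweil_Integration.integral_combine[OF u(1,2) integrable_continuous_interval[OF c]])
      moreover have "integral {u..max t s} \<eta> = integral {u..max t s} (\<lambda>x. 0)"
        using u by (intro integral_cong supp) auto
      ultimately show ?thesis by simp
    qed
    show ?thesis unfolding \<psi>_def using ext[of t] ext[of s] full by simp
  next
    case False
    then show ?thesis using low[of t] ab by simp
  qed
  have d: "(\<psi> has_vector_derivative \<eta> t) (at t)" for t
  proof (cases "t < a")
    case True
    have "((\<lambda>t. 0) has_vector_derivative \<eta> t) (at t)" using supp[of t] True by simp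
    then show ?thesis
      by (rule has_vector_derivative_transform_within_open[where S="{..<a}"]) (use True low in auto)
  next
    case False
    have "(\<psi> has_vector_derivative \<eta> t) (at t within {s0..t+1})"
      unfolding \<psi>_def using False ab by (intro integral_has_vector_derivative c) auto
    moreover have "at t within {s0..t+1} = at t"
      using False ab by (intro at_within_interior) (auto simp: interior_atLeastAtMost_real)
    ultimately show ?thesis by simp
  qed
  have "time_test s0 s \<psi>"
    unfolding time_test_def
  proof (intro conjI)
    show "smooth \<psi>" by (rule smooth_primitive[OF d \<eta>])
    show "\<exists>a b. s0 < a \<and> b < s \<and> (\<forall>t. t \<notin> {a..b} \<longrightarrow> \<psi> t = 0)"
    proof (rule exI[of _ a], rule exI[of _ b], intro conjI allI impI)
      fix t assume "t \<notin> {a..b}"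
      then have "t < a \<or> b < t" by auto
      then show "\<psi> t = 0" using low high by blast
    qed (use ab in auto)
  qed
  then show ?thesis using vderiv_eqI[OF d] by blast
qed

lemma integrable_smooth_mult:
  assumes "smooth \<psi>" and f: "integrable (lebesgue_on {s0..s}) f"
  shows "integrable (lebesgue_on {s0..s}) (\<lambda>t. \<psi> t * f t)"
  using integrable_mult_cont[OF f smooth_continuous_on[OF assms(1)]] by (simp add: mult.commute)

text \<open>  Subtracting a multiple of a fixed bump makes any bump mean-free, hence the derivative of a test
  function. So \<open>h\<close>, minus the constant determined by the fixed bump, is orthogonal to all bumps.\<close>

lemma weakly_constant:
  assumes s: "s0 < s" and h: "integrable (lebesgue_on {s0..s}) h"
    and z: "\<And>\<psi>. time_test s0 s \<psi> \<Longrightarrow> (LINT t|lebesgue_on {s0..s}. vderiv \<psi> t * h t) = 0"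
  shows "\<exists>c. AE t in lebesgue_on {s0..s}. h t = c"
proof -
  let ?M = "lebesgue_on {s0..s}"
  obtain c0 a0 b0 where 0: "0 < c0" "s0 < a0" "b0 < s" "(LINT t|?M. bump c0 a0 b0 t) \<noteq> 0"
    using bump_integral_nonzero[OF s] by blast
  let ?e0 = "bump c0 a0 b0"
  define C where "C = (LINT t|?M. ?e0 t * h t) / (LINT t|?M. ?e0 t)"
  have ie: "integrable ?M (bump c a b)" if "0 < c" for c a b
    by (intro cont_integrable_Icc smooth_continuous_on smooth_bump that)
  have ieh: "integrable ?M (\<lambda>t. bump c a b t * h t)" if "0 < c" for c a b
    by (intro integrable_smooth_mult smooth_bump that h)
  have "AE t in ?M. h t - C = 0"
  proof (rule integral_zero_if_bumps_zero[OF s])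
    show "integrable ?M (\<lambda>t. h t - C)"
      using h finite_measure.integrable_const[OF finite_measure_lebesgue_on_Icc] by (intro Bochner_Integration.integrable_diff)
    fix c a b :: real assume c: "0 < c" and ab: "s0 < a" "b < s"
    define \<kappa> where "\<kappa> = (LINT t|?M. bump c a b t) / (LINT t|?M. ?e0 t)"
    let ?\<eta> = "\<lambda>t. bump c a b t + (- \<kappa>) * ?e0 t"
    have "\<exists>\<psi>. time_test s0 s \<psi> \<and> vderiv \<psi> = ?\<eta>"
    proof (rule time_test_antiderivative)
      show "smooth ?\<eta>" by (intro smooth_add_cmult smooth_bump c 0)
      show "s0 < min a a0" "max b b0 < s" using ab 0 by auto
      show "?\<eta> t = 0" if "t \<notin> {min a a0..max b b0}" for t using that by (auto simp: bump_eq)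
      have "(LINT t|?M. ?\<eta> t) = (LINT t|?M. bump c a b t) + (- \<kappa>) * (LINT t|?M. ?e0 t)"
        using ie[OF c] ie[OF 0(1)] by (subst Bochner_Integration.integral_add) auto
      then show "(LINT t|?M. ?\<eta> t) = 0" using 0(4) by (simp add: \<kappa>_def)
    qed (rule s)
    then obtain \<psi> where "time_test s0 s \<psi>" "vderiv \<psi> = ?\<eta>" by blast
    then have "(LINT t|?M. ?\<eta> t * h t) = 0" using z by metis
    also have "(LINT t|?M. ?\<eta> t * h t) = (LINT t|?M. bump c a b t * h t + (- \<kappa>) * (?e0 t * h t))"
      by (intro Bochner_Integration.integral_cong refl) (simp add: algebra_simps)
    also have "\<dots> = (LINT t|?M. bump c a b t * h t) + (- \<kappa>) * (LINT t|?M. ?e0 t * h t)"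
      using ieh[OF c] ieh[OF 0(1)] by (subst Bochner_Integration.integral_add) auto
    finally have 1: "(LINT t|?M. bump c a b t * h t) = C * (LINT t|?M. bump c a b t)"
      by (simp add: \<kappa>_def C_def)
    have "(LINT t|?M. bump c a b t * (h t - C)) = (LINT t|?M. bump c a b t * h t - C * bump c a b t)"
      by (intro Bochner_Integration.integral_cong refl) (simp add: algebra_simps)
    also have "\<dots> = (LINT t|?M. bump c a b t * h t) - C * (LINT t|?M. bump c a b t)"
      using ieh[OF c] ie[OF c] by (subst Bochner_Integration.integral_diff) auto
    finally show "(LINT t|?M. bump c a b t * (h t - C)) = 0" using 1 by simp
  qed
  then have "AE t in ?M. h t = C" by eventually_elim simp
  then show ?thesis by blast
qed

lemma primitive_at_end:
  assumes "primitive s0 s A a" "s0 \<le> s"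
  shows "A s = A s0 + (LINT t|lebesgue_on {s0..s}. a t)"
proof -
  have "(LINT x|lebesgue_on {s0..s}. of_bool (x \<le> s) * a x) = (LINT x|lebesgue_on {s0..s}. a x)"
    by (intro Bochner_Integration.integral_cong refl) auto
  moreover have "A s = A s0 + (LINT x|lebesgue_on {s0..s}. of_bool (x \<le> s) * a x)"
    using assms unfolding primitive_def by (meson atLeastAtMost_iff order_refl)
  ultimately show ?thesis by simp
qed

lemma primitive_integral: 
  assumes a: "integrable (lebesgue_on {s0..s}) a" and s: "s0 < s"
  shows "\<exists>A. primitive s0 s A a \<and> A s0 = c"
proof -
  let ?I = "\<lambda>t. (LINT x|lebesgue_on {s0..s}. of_bool (x \<le> t) * a x)"
  have "?I s0 = (LINT x|lebesgue_on {s0..s}. 0)"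
  proof (rule integral_cong_AE)
    show "(\<lambda>x. of_bool (x \<le> s0) * a x) \<in> borel_measurable (lebesgue_on {s0..s})"
      using integrable_of_bool[OF a le_pred_measurable] by auto
    show "AE x in lebesgue_on {s0..s}. of_bool (x \<le> s0) * a x = 0"
      using AE_space AE_lebesgue_on_not_eq[where c=s0] by eventually_elim auto
  qed simp
  then have "?I s0 = 0" by simp
  then show ?thesis using a unfolding primitive_def by (intro exI[of _ "\<lambda>t. c + ?I t"] conjI ballI) simp_all
qed

text \<open>  The indefinite integral \<open>G\<close> of \<open>g\<close> has the same weak derivative as \<open>f\<close> by the product rule, so
  \<open>f - G\<close> is weakly constant.\<close>

lemma weak_derivative_primitive:
  assumes s: "s0 < s" and f: "integrable (lebesgue_on {s0..s}) f" and g: "integrable (lebesgue_on {s0..s}) g"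
    and w: "\<And>\<psi>. time_test s0 s \<psi> \<Longrightarrow>
       (LINT t|lebesgue_on {s0..s}. vderiv \<psi> t * f t) = - (LINT t|lebesgue_on {s0..s}. \<psi> t * g t)"
  shows "\<exists>A. primitive s0 s A g \<and> (AE t in lebesgue_on {s0..s}. f t = A t)"
proof -
  let ?M = "lebesgue_on {s0..s}"
  obtain G where G: "primitive s0 s G g" "G s0 = 0" using primitive_integral[OF g s] by blast
  have Gi: "integrable ?M G" by (intro cont_integrable_Icc primitive_continuous[OF G(1)])
  have "\<exists>c. AE t in ?M. f t - G t = c"
  proof (rule weakly_constant[OF s])
    show "integrable ?M (\<lambda>t. f t - G t)" using f Gi by simp
    fix \<psi> assume \<psi>: "time_test s0 s \<psi>"
    have sm: "smooth \<psi>" using \<psi> by (simp add: time_test_def)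
    have end0: "\<psi> s0 = 0" "\<psi> s = 0" using \<psi> s unfolding time_test_def by force+
    have "primitive s0 s \<psi> (vderiv \<psi>)"
      using s by (intro primitive_of_derivative smooth_has_vderiv sm smooth_continuous_on smooth_vderiv) auto
    from primitive_at_end[OF primitive_mult[OF this G(1)]] end0 s
    have "(LINT t|?M. vderiv \<psi> t * G t + g t * \<psi> t) = 0" by simp
    moreover have i1: "integrable ?M (\<lambda>t. vderiv \<psi> t * G t)" by (intro integrable_smooth_mult smooth_vderiv sm Gi)
    have i2: "integrable ?M (\<lambda>t. \<psi> t * g t)" by (intro integrable_smooth_mult sm g)
    have i3: "integrable ?M (\<lambda>t. vderiv \<psi> t * f t)" by (intro integrable_smooth_mult smooth_vderiv sm f)
    have "(LINT t|?M. vderiv \<psi> t * G t + g t * \<psi> t) = (LINT t|?M. vderiv \<psi> t * G t) + (LINT t|?M. \<psi> t * g t)"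
      using Bochner_Integration.integral_add[OF i1 i2] by (simp add: mult.commute)
    moreover have "(LINT t|?M. vderiv \<psi> t * (f t - G t)) = (LINT t|?M. vderiv \<psi> t * f t) - (LINT t|?M. vderiv \<psi> t * G t)"
      using Bochner_Integration.integral_diff[OF i3 i1] by (simp add: right_diff_distrib)
    ultimately show "(LINT t|?M. vderiv \<psi> t * (f t - G t)) = 0" using w[OF \<psi>] by (simp add: add_eq_0_iff)
  qed
  then obtain c where c: "AE t in ?M. f t - G t = c" by blast
  obtain A where A: "primitive s0 s A g" "A s0 = c" using primitive_integral[OF g s] by blast
  have AG: "A t = G t + c" if "t \<in> {s0..s}" for t
  proof -
    have "A t = A s0 + (LINT x|?M. of_bool (x \<le> t) * g x)" "G t = G s0 + (LINT x|?M. of_bool (x \<le> t) * g x)"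
      using A(1) G(1) that unfolding primitive_def by blast+
    then show ?thesis using A(2) G(2) by simp
  qed
  have "AE t in ?M. f t = A t"
    using c AE_space by eventually_elim (auto simp: AG algebra_simps)
  then show ?thesis using A(1) by blast
qed

text \<open>  The product rule for indefinite integrals, applied to the exponential and the product of the three
  functions, whose derivative has three terms.\<close>

lemma oscillatory_integral_le:
  assumes s: "s0 \<le> s" and \<omega>: "\<omega> \<noteq> 0"
    and A: "primitive s0 s A a" and B: "primitive s0 s B b" and C: "primitive s0 s C c"
  shows "integrable (lebesgue_on {s0..s}) (\<lambda>t. cmod (a t * B t * C t) + cmod (A t * b t * C t) + cmod (A t * B t * c t))"
    and "\<bar>\<omega>\<bar> * cmod (LINT t|lebesgue_on {s0..s}. cis (- (\<omega> * t)) * (A t * B t * C t))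
     \<le> cmod (A s * B s * C s) + cmod (A s0 * B s0 * C s0)
       + (LINT t|lebesgue_on {s0..s}. cmod (a t * B t * C t) + cmod (A t * b t * C t) + cmod (A t * B t * c t))"
proof -
  let ?M = "lebesgue_on {s0..s}"
  let ?E = "\<lambda>t. cis (- (\<omega> * t))"
  have Ed: "(?E has_vector_derivative (- (\<i> * \<omega>) * ?E t)) (at t)" for t
  proof -
    have "((\<lambda>z. exp (- (\<i> * \<omega>) * z)) has_field_derivative (- (\<i> * \<omega>) * exp (- (\<i> * \<omega>) * complex_of_real t))) (at (complex_of_real t))"
      by (auto intro!: derivative_eq_intros)
    from has_vector_derivative_real_field[OF this] show ?thesis
      by (simp add: cis_conv_exp mult.assoc)
  qed
  have Ec: "continuous_on S ?E" for S
    unfolding cis_conv_exp by (intro continuous_intros)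
  have E: "primitive s0 s ?E (\<lambda>t. - (\<i> * \<omega>) * ?E t)"
    by (intro primitive_of_derivative s Ed continuous_intros Ec)
  define G where "G t = A t * B t * C t" for t
  define g where "g t = (a t * B t + b t * A t) * C t + c t * (A t * B t)" for t
  have G: "primitive s0 s G g"
    unfolding G_def[abs_def] g_def[abs_def] by (rule primitive_mult[OF primitive_mult[OF A B] C])
  have gi: "integrable ?M g" by (rule primitive_integrable[OF G])
  have m: "A \<in> borel_measurable ?M" "B \<in> borel_measurable ?M" "C \<in> borel_measurable ?M"
    using primitive_measurable A B C by blast+
  have AB: "(\<lambda>t. A t * B t) \<in> borel_measurable ?M" "(\<lambda>t. A t * C t) \<in> borel_measurable ?M" "(\<lambda>t. B t * C t) \<in> borel_measurable ?M"
    using m by measurable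
  have bd: "cmod (F t * H t) \<le> (cmod (F s0) + (LINT x|?M. cmod (f x))) * (cmod (H s0) + (LINT x|?M. cmod (h x)))"
    if "primitive s0 s F f" "primitive s0 s H h" "t \<in> {s0..s}" for F f H h t
    unfolding norm_mult using that by (intro mult_mono primitive_bounded) (auto intro!: add_nonneg_nonneg)
  have i1: "integrable ?M (\<lambda>t. a t * (B t * C t))"
    by (rule integrable_mult_bounded_measurable[OF _ AB(3) bd[OF B C]]) (rule primitive_integrable[OF A])
  have i2: "integrable ?M (\<lambda>t. b t * (A t * C t))"
    by (rule integrable_mult_bounded_measurable[OF _ AB(2) bd[OF A C]]) (rule primitive_integrable[OF B])
  have i3: "integrable ?M (\<lambda>t. c t * (A t * B t))"
    by (rule integrable_mult_bounded_measurable[OF _ AB(1) bd[OF A B]]) (rule primitive_integrable[OF C])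
  show di: "integrable ?M (\<lambda>t. cmod (a t * B t * C t) + cmod (A t * b t * C t) + cmod (A t * B t * c t))"
    using integrable_norm[OF i1] integrable_norm[OF i2] integrable_norm[OF i3]
    by (simp add: norm_mult mult_ac)
  have GE: "integrable ?M (\<lambda>t. ?E t * G t)"
    by (intro cont_integrable_Icc continuous_intros Ec primitive_continuous[OF G])
  have gE: "integrable ?M (\<lambda>t. g t * ?E t)" by (rule integrable_mult_cont[OF gi Ec])
  have "G s * ?E s = G s0 * ?E s0 + (LINT t|?M. g t * ?E t + - (\<i> * \<omega>) * ?E t * G t)"
    by (rule primitive_at_end[OF primitive_mult[OF G E] s])
  also have "(LINT t|?M. g t * ?E t + - (\<i> * \<omega>) * ?E t * G t) = (LINT t|?M. g t * ?E t) + (LINT t|?M. - (\<i> * \<omega>) * (?E t * G t))"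
    unfolding mult.assoc[of "- (\<i> * \<omega>)"] by (rule Bochner_Integration.integral_add[OF gE integrable_mult_right[OF GE]])
  also have "(LINT t|?M. - (\<i> * \<omega>) * (?E t * G t)) = - (\<i> * \<omega>) * (LINT t|?M. ?E t * G t)"
    by (rule integral_mult_right_zero)
  finally have "\<i> * \<omega> * (LINT t|?M. ?E t * G t) = - (G s * ?E s) + G s0 * ?E s0 + (LINT t|?M. g t * ?E t)"
    by (simp add: algebra_simps)
  then have "cmod (\<i> * \<omega> * (LINT t|?M. ?E t * G t)) = cmod (- (G s * ?E s) + G s0 * ?E s0 + (LINT t|?M. g t * ?E t))"
    by (simp only:)
  then have "\<bar>\<omega>\<bar> * cmod (LINT t|?M. ?E t * G t) = cmod (- (G s * ?E s) + G s0 * ?E s0 + (LINT t|?M. g t * ?E t))"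
    unfolding norm_mult[of "\<i> * \<omega>"] by (simp only: norm_mult norm_ii norm_of_real mult_1)
  also have "\<dots> \<le> cmod (G s * ?E s) + cmod (G s0 * ?E s0) + cmod (LINT t|?M. g t * ?E t)"
    by (intro order_trans[OF norm_triangle_ineq] add_right_mono) (simp only: norm_minus_cancel order_refl)
  also have "cmod (LINT t|?M. g t * ?E t) \<le> (LINT t|?M. cmod (g t * ?E t))" by (rule integral_norm_bound)
  also have "\<dots> \<le> (LINT t|?M. cmod (a t * B t * C t) + cmod (A t * b t * C t) + cmod (A t * B t * c t))"
  proof (rule integral_mono[OF integrable_norm[OF gE] di])
    fix t
    have "g t = a t * B t * C t + A t * b t * C t + A t * B t * c t" by (simp add: g_def algebra_simps)
    then have "cmod (g t) \<le> cmod (a t * B t * C t) + cmod (A t * b t * C t) + cmod (A t * B t * c t)"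
      by (simp only:) (intro order_trans[OF norm_triangle_ineq] add_right_mono order_refl)
    then show "cmod (g t * ?E t) \<le> cmod (a t * B t * C t) + cmod (A t * b t * C t) + cmod (A t * B t * c t)"
      by (simp add: norm_mult)
  qed
  finally show "\<bar>\<omega>\<bar> * cmod (LINT t|?M. ?E t * (A t * B t * C t))
     \<le> cmod (A s * B s * C s) + cmod (A s0 * B s0 * C s0)
       + (LINT t|?M. cmod (a t * B t * C t) + cmod (A t * b t * C t) + cmod (A t * B t * c t))"
    unfolding G_def by (simp add: norm_mult)
qed

section \<open>Sobolev-valued functions of time\<close>

text \<open>  The Japanese bracket to the power \<open>r\<close>, so that \<open>jb r k * \<bar>fcoeff u k\<bar>\<close> is the sequence whose \<open>\<ell>\<^sup>2\<close> norm
  is, up to \<open>sqrt (2 * pi)\<close>, the Sobolev norm of order \<open>r\<close>.\<close>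

definition jb :: "real \<Rightarrow> int \<Rightarrow> real" where "jb r k = (1 + (of_int k)\<^sup>2) powr (r / 2)"

lemma one_plus_square_ge_1: "1 \<le> 1 + (real_of_int k)\<^sup>2" by simp

lemma one_plus_square_nonzero: "1 + (real_of_int k)\<^sup>2 \<noteq> 0"
  using one_plus_square_ge_1[of k] by linarith

lemma jb_pos: "0 < jb r k"
  using one_plus_square_nonzero[of k] by (simp add: jb_def)

lemma jb_square: "(jb r k * x)\<^sup>2 = (1 + (of_int k)\<^sup>2) powr r * x\<^sup>2"
  by (simp add: jb_def power_mult_distrib power2_eq_square powr_add[symmetric])

lemma jb_0: "jb 0 k = 1"
  using one_plus_square_nonzero[of k] by (simp add: jb_def)

lemma jb_mono: "r \<le> r' \<Longrightarrow> jb r k \<le> jb r' k"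
  unfolding jb_def using one_plus_square_ge_1[of k] by (intro powr_mono) auto

lemma jb_minus: "jb (- r) k * jb r k = 1"
  using one_plus_square_nonzero[of k] by (simp add: jb_def powr_add[symmetric])

lemma l2bdI_summable:
  assumes "(\<lambda>k. (1 + (of_int k)\<^sup>2) powr r * (cmod (c k))\<^sup>2) summable_on UNIV"
    and "sqrt (\<Sum>\<^sub>\<infinity>k. (1 + (of_int k)\<^sup>2) powr r * (cmod (c k))\<^sup>2) \<le> a"
  shows "l2bd (\<lambda>k. jb r k * cmod (c k)) a"
  unfolding l2bd_def
proof (intro conjI allI impI)
  show "0 \<le> jb r k * cmod (c k)" for k using jb_pos[of r k] by simp
  fix F :: "int set" assume F: "finite F"
  have "(\<Sum>k\<in>F. (jb r k * cmod (c k))\<^sup>2) \<le> (\<Sum>\<^sub>\<infinity>k. (1 + (of_int k)\<^sup>2) powr r * (cmod (c k))\<^sup>2)"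
    unfolding jb_square using assms(1) F by (intro finite_sum_le_infsum) auto
  then have "L2_set (\<lambda>k. jb r k * cmod (c k)) F \<le> sqrt (\<Sum>\<^sub>\<infinity>k. (1 + (of_int k)\<^sup>2) powr r * (cmod (c k))\<^sup>2)"
    by (simp add: L2_set_def)
  then show "L2_set (\<lambda>k. jb r k * cmod (c k)) F \<le> a" using assms(2) by linarith
qed

lemma H_norm_nonneg: "0 \<le> H_norm r u"
  unfolding H_norm_def by (intro mult_nonneg_nonneg real_sqrt_ge_zero infsum_nonneg) auto

lemma sqrt_le_H_norm: "sqrt (\<Sum>\<^sub>\<infinity>k. (1 + (of_int k)\<^sup>2) powr r * (cmod (fcoeff u k))\<^sup>2) \<le> H_norm r u"
proof -
  have "1 \<le> sqrt (2 * pi)" using pi_gt3 by simp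
  moreover have "0 \<le> sqrt (\<Sum>\<^sub>\<infinity>k. (1 + (of_int k)\<^sup>2) powr r * (cmod (fcoeff u k))\<^sup>2)"
    by (intro real_sqrt_ge_zero infsum_nonneg) auto
  ultimately show ?thesis unfolding H_norm_def using mult_right_mono[of 1 "sqrt (2 * pi)"] by fastforce
qed

lemma in_H_l2bd: "in_H r u \<Longrightarrow> l2bd (\<lambda>k. jb r k * cmod (fcoeff u k)) (H_norm r u)"
  by (rule l2bdI_summable[OF _ sqrt_le_H_norm]) (simp add: in_H_def)

lemma in_H_mono:
  assumes u: "in_H r u" and r: "r' \<le> r" shows "in_H r' u" "H_norm r' u \<le> H_norm r u"
proof -
  have le: "(1 + (of_int k)\<^sup>2) powr r' * (cmod (fcoeff u k))\<^sup>2 \<le> (1 + (of_int k)\<^sup>2) powr r * (cmod (fcoeff u k))\<^sup>2" for k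
    using r one_plus_square_ge_1[of k] by (intro mult_right_mono powr_mono) auto
  have s: "(\<lambda>k. (1 + (of_int k)\<^sup>2) powr r * (cmod (fcoeff u k))\<^sup>2) summable_on UNIV"
    using u by (simp add: in_H_def)
  have s': "(\<lambda>k. (1 + (of_int k)\<^sup>2) powr r' * (cmod (fcoeff u k))\<^sup>2) summable_on UNIV"
    by (rule summable_on_comparison_test[OF s le]) auto
  then show "in_H r' u" using u by (simp add: in_H_def)
  show "H_norm r' u \<le> H_norm r u"
    unfolding H_norm_def by (intro mult_left_mono real_sqrt_le_mono infsum_mono s s' le) auto
qed

lemma fcoeff_diff: "fcoeff (\<lambda>\<phi>. u \<phi> - v \<phi>) k = fcoeff u k - fcoeff v k"
  by (simp add: fcoeff_def diff_divide_distrib)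

lemma in_H_diff_bound:
  assumes u: "in_H r u" and v: "in_H r v"
  shows "jb r k * cmod (fcoeff u k - fcoeff v k) \<le> H_norm r (\<lambda>\<phi>. u \<phi> - v \<phi>)"
proof -
  let ?w = "\<lambda>\<phi>. u \<phi> - v \<phi>"
  have "(\<lambda>k. 2 * ((1 + (of_int k)\<^sup>2) powr r * (cmod (fcoeff u k))\<^sup>2) + 2 * ((1 + (of_int k)\<^sup>2) powr r * (cmod (fcoeff v k))\<^sup>2)) summable_on UNIV"
    using u v by (intro summable_on_add summable_on_cmult_right) (auto simp: in_H_def)
  then have "(\<lambda>k. (1 + (of_int k)\<^sup>2) powr r * (cmod (fcoeff ?w k))\<^sup>2) summable_on UNIV"
  proof (rule summable_on_comparison_test)
    fix k :: int
    have "(1 + (of_int k)\<^sup>2) powr r * (cmod (fcoeff ?w k))\<^sup>2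
        \<le> (1 + (of_int k)\<^sup>2) powr r * (2 * (cmod (fcoeff u k))\<^sup>2 + 2 * (cmod (fcoeff v k))\<^sup>2)"
      unfolding fcoeff_diff by (intro mult_left_mono cmod_diff_square_le) auto
    then show "(1 + (of_int k)\<^sup>2) powr r * (cmod (fcoeff ?w k))\<^sup>2
      \<le> 2 * ((1 + (of_int k)\<^sup>2) powr r * (cmod (fcoeff u k))\<^sup>2) + 2 * ((1 + (of_int k)\<^sup>2) powr r * (cmod (fcoeff v k))\<^sup>2)"
      by (simp add: algebra_simps)
  qed auto
  from l2bd_pointwise[OF l2bdI_summable[OF this sqrt_le_H_norm], of k]
  show ?thesis by (simp add: fcoeff_diff)
qed

text \<open>  Each coefficient is continuous for the Sobolev norm, so it inherits measurability from the
  approximating simple functions.\<close>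

lemma Linf_H_fcoeff_measurable:
  assumes v: "in_Linf_H r s0 s v"
  shows "(\<lambda>t. fcoeff (v t) k) \<in> borel_measurable (lebesgue_on {s0..s})"
proof -
  let ?M = "lebesgue_on {s0..s}"
  obtain S where S: "\<And>n. simple_function ?M (S n)" "\<And>n t. t \<in> {s0..s} \<Longrightarrow> in_H r (S n t)"
    and lim: "AE t in ?M. (\<lambda>n. H_norm r (\<lambda>\<phi>. S n t \<phi> - v t \<phi>)) \<longlonglongrightarrow> 0"
    using v unfolding in_Linf_H_def strongly_measurable_H_def by blast
  have vH: "AE t in ?M. in_H r (v t)"
    using v unfolding in_Linf_H_def by (auto elim: eventually_mono)
  show ?thesis
  proof (rule borel_measurable_lebesgue_on_AE_lim)
    show "(\<lambda>t. fcoeff (S n t) k) \<in> borel_measurable ?M" for n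
      using simple_function_compose[OF S(1), of "\<lambda>u. fcoeff u k" n] by (intro borel_measurable_simple_function) (simp add: o_def)
    show "AE t in ?M. (\<lambda>n. fcoeff (S n t) k) \<longlonglongrightarrow> fcoeff (v t) k"
      using lim vH AE_space
    proof eventually_elim
      case (elim t)
      have "(\<lambda>n. fcoeff (S n t) k - fcoeff (v t) k) \<longlonglongrightarrow> 0"
      proof (rule Lim_null_comparison)
        show "\<forall>\<^sub>F n in sequentially. norm (fcoeff (S n t) k - fcoeff (v t) k) \<le> jb (- r) k * H_norm r (\<lambda>\<phi>. S n t \<phi> - v t \<phi>)"
        proof (intro always_eventually allI)
          fix n
          have "jb r k * cmod (fcoeff (S n t) k - fcoeff (v t) k) \<le> H_norm r (\<lambda>\<phi>. S n t \<phi> - v t \<phi>)"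
            using elim S(2) by (intro in_H_diff_bound) auto
          then have "jb (- r) k * (jb r k * cmod (fcoeff (S n t) k - fcoeff (v t) k)) \<le> jb (- r) k * H_norm r (\<lambda>\<phi>. S n t \<phi> - v t \<phi>)"
            using jb_pos[of "-r" k] by (intro mult_left_mono) auto
          then show "norm (fcoeff (S n t) k - fcoeff (v t) k) \<le> jb (- r) k * H_norm r (\<lambda>\<phi>. S n t \<phi> - v t \<phi>)"
            by (simp add: mult.assoc[symmetric] jb_minus)
        qed
        show "(\<lambda>n. jb (- r) k * H_norm r (\<lambda>\<phi>. S n t \<phi> - v t \<phi>)) \<longlonglongrightarrow> 0"
          using elim(1) by (rule tendsto_mult_right_zero)
      qed
      then show ?case by (rule LIM_zero_cancel)
    qed
  qed
qed

lemma int_interval_exhausts: "filterlim (\<lambda>n. {- int n..int n}) (finite_subsets_at_top UNIV) sequentially"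
  unfolding filterlim_finite_subsets_at_top
proof (intro allI impI conjI)
  fix X :: "int set" assume X: "finite X \<and> X \<subseteq> UNIV"
  show "\<forall>\<^sub>F n in sequentially. finite {- int n..int n} \<and> X \<subseteq> {- int n..int n} \<and> {- int n..int n} \<subseteq> UNIV"
    using eventually_ge_at_top[of "nat (\<Sum>k\<in>X. \<bar>k\<bar>)"]
  proof eventually_elim
    case (elim n)
    have "X \<subseteq> {- int n..int n}" using X elim by (intro finite_int_set_in_interval) auto
    then show ?case by simp
  qed
qed

text \<open>  Needed for \<open>Linf_norm\<close>: the essential supremum of a function that is not measurable says nothing
  about its values. The norm is a limit of finite sums of measurable coefficients.\<close>

lemma H_norm_measurable:
  fixes v :: "real \<Rightarrow> functional"
  assumes m: "\<And>k. (\<lambda>t. fcoeff (v t) k) \<in> borel_measurable (lebesgue_on {s0..s})"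
    and ae: "AE t in lebesgue_on {s0..s}. in_H r (v t)"
  shows "(\<lambda>t. H_norm r (v t)) \<in> borel_measurable (lebesgue_on {s0..s})"
proof (rule borel_measurable_lebesgue_on_AE_lim)
  let ?S = "\<lambda>n t. sqrt (2 * pi) * sqrt (\<Sum>k\<in>{- int n..int n}. (1 + (of_int k)\<^sup>2) powr r * (cmod (fcoeff (v t) k))\<^sup>2)"
  show "?S n \<in> borel_measurable (lebesgue_on {s0..s})" for n
    using m by measurable
  show "AE t in lebesgue_on {s0..s}. (\<lambda>n. ?S n t) \<longlonglongrightarrow> H_norm r (v t)"
    using ae
  proof eventually_elim
    case (elim t)
    then have "((\<lambda>k. (1 + (of_int k)\<^sup>2) powr r * (cmod (fcoeff (v t) k))\<^sup>2) has_sum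
        (\<Sum>\<^sub>\<infinity>k. (1 + (of_int k)\<^sup>2) powr r * (cmod (fcoeff (v t) k))\<^sup>2)) UNIV" by (simp add: in_H_def)
    then have "(\<lambda>n. \<Sum>k\<in>{- int n..int n}. (1 + (of_int k)\<^sup>2) powr r * (cmod (fcoeff (v t) k))\<^sup>2)
       \<longlonglongrightarrow> (\<Sum>\<^sub>\<infinity>k. (1 + (of_int k)\<^sup>2) powr r * (cmod (fcoeff (v t) k))\<^sup>2)"
      unfolding has_sum_def by (rule filterlim_compose[OF _ int_interval_exhausts])
    then show ?case unfolding H_norm_def by (intro tendsto_intros)
  qed
qed

lemma esssup_real_bound:
  fixes f :: "real \<Rightarrow> real"
  assumes m: "f \<in> borel_measurable M" and b: "AE t in M. f t \<le> B"
  shows "AE t in M. f t \<le> enn2real (esssup M (\<lambda>t. ennreal (f t)))"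
proof -
  have "esssup M (\<lambda>t. ennreal (f t)) \<le> ennreal B"
    using m b by (intro esssup_I) (auto intro: ennreal_leI elim!: eventually_mono)
  then have fin: "esssup M (\<lambda>t. ennreal (f t)) < top" using ennreal_less_top le_less_trans by blast
  have "AE t in M. ennreal (f t) \<le> esssup M (\<lambda>t. ennreal (f t))" by (rule esssup_AE)
  then show ?thesis
  proof eventually_elim
    case (elim t)
    then have "enn2real (ennreal (f t)) \<le> enn2real (esssup M (\<lambda>t. ennreal (f t)))"
      using fin by (intro enn2real_mono) auto
    moreover have "f t \<le> enn2real (ennreal (f t))"
      by (cases "0 \<le> f t") (auto simp: ennreal_neg)
    ultimately show ?case by linarith
  qed
qed

lemma Linf_norm_nonneg: "0 \<le> Linf_norm nrm s0 s v"
  by (simp add: Linf_norm_def)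

text \<open>  Also for lower orders \<open>r'\<close>: the factors are given in \<open>H\<close> of order \<open>\<alpha>\<close>, but are estimated in
  \<open>L\<^sup>2\<close> and in the space of order \<open>- 23 / 14\<close>.\<close>

lemma Linf_H_AE_bound:
  assumes v: "in_Linf_H r s0 s v" and r: "r' \<le> r"
  shows "AE t in lebesgue_on {s0..s}. in_H r' (v t) \<and> H_norm r' (v t) \<le> Linf_norm (H_norm r') s0 s v"
proof -
  let ?M = "lebesgue_on {s0..s}"
  obtain B where B: "AE t in ?M. in_H r (v t) \<and> H_norm r (v t) \<le> B"
    using v unfolding in_Linf_H_def by blast
  then have ae: "AE t in ?M. in_H r' (v t)" by eventually_elim (use in_H_mono r in blast)
  have m: "(\<lambda>t. H_norm r' (v t)) \<in> borel_measurable ?M"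
    by (rule H_norm_measurable[OF Linf_H_fcoeff_measurable[OF v] ae])
  have "AE t in ?M. H_norm r' (v t) \<le> B"
    using B by eventually_elim (use in_H_mono(2)[OF _ r] order_trans in blast)
  from esssup_real_bound[OF m this] ae show ?thesis
    unfolding Linf_norm_def by eventually_elim simp
qed

lemma Linf_L2_norm:
  assumes v: "in_Linf_H r s0 s v" and r: "0 \<le> r"
  shows "Linf_norm L2_norm s0 s v = Linf_norm (H_norm 0) s0 s v"
proof -
  let ?M = "lebesgue_on {s0..s}"
  have ae0: "AE t in ?M. in_H 0 (v t)" using Linf_H_AE_bound[OF v r] by eventually_elim simp
  have m: "(\<lambda>t. H_norm 0 (v t)) \<in> borel_measurable ?M"
    by (rule H_norm_measurable[OF Linf_H_fcoeff_measurable[OF v] ae0])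
  have ae: "AE t in ?M. H_norm 0 (v t) = L2_norm (v t)"
    using ae0 by eventually_elim (simp add: L2_norm_eq_H_norm)
  have m': "(\<lambda>t. L2_norm (v t)) \<in> borel_measurable ?M"
    by (rule borel_measurable_lebesgue_on_AE[OF m ae])
  have "esssup ?M (\<lambda>t. ennreal (L2_norm (v t))) = esssup ?M (\<lambda>t. ennreal (H_norm 0 (v t)))"
  proof (rule esssup_AE_cong)
    show "(\<lambda>t. ennreal (L2_norm (v t))) \<in> borel_measurable ?M" using m' by measurable
    show "(\<lambda>t. ennreal (H_norm 0 (v t))) \<in> borel_measurable ?M" using m by measurable
    show "AE t in ?M. ennreal (L2_norm (v t)) = ennreal (H_norm 0 (v t))"
      using ae by eventually_elim simp
  qed
  then show ?thesis by (simp add: Linf_norm_def)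
qed

lemma Linf_H_fcoeff_integrable:
  assumes v: "in_Linf_H r s0 s v"
  shows "integrable (lebesgue_on {s0..s}) (\<lambda>t. fcoeff (v t) k)"
proof (rule finite_measure.integrable_const_bound[OF finite_measure_lebesgue_on_Icc _ Linf_H_fcoeff_measurable[OF v]])
  show "AE t in lebesgue_on {s0..s}. norm (fcoeff (v t) k) \<le> jb (- r) k * Linf_norm (H_norm r) s0 s v"
    using Linf_H_AE_bound[OF v order_refl]
  proof eventually_elim
    case (elim t)
    then have "jb r k * cmod (fcoeff (v t) k) \<le> Linf_norm (H_norm r) s0 s v"
      using l2bd_pointwise[OF in_H_l2bd, of r "v t" k] by linarith
    then have "jb (- r) k * (jb r k * cmod (fcoeff (v t) k)) \<le> jb (- r) k * Linf_norm (H_norm r) s0 s v"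
      using jb_pos[of "-r" k] by (intro mult_left_mono) auto
    then show ?case by (simp add: mult.assoc[symmetric] jb_minus)
  qed
qed

lemma weak_time_deriv_fcoeff:
  assumes w: "weak_time_deriv s0 s v w" and \<psi>: "time_test s0 s \<psi>"
  shows "(LINT t|lebesgue_on {s0..s}. vderiv \<psi> t * fcoeff (v t) k) = - (LINT t|lebesgue_on {s0..s}. \<psi> t * fcoeff (w t) k)"
proof -
  have "(LINT t|lebesgue_on {s0..s}. vderiv \<psi> t * v t (ek (- k))) = - (LINT t|lebesgue_on {s0..s}. \<psi> t * w t (ek (- k)))"
    using w \<psi> periodic_test_ek unfolding weak_time_deriv_def by blast
  then show ?thesis by (simp add: fcoeff_alt)
qed

text \<open>  Integration by parts evaluates coefficients at the endpoints, where an almost everywhere bound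
  says nothing by itself; for continuous functions it extends to every time.\<close>

lemma AE_le_imp_le:
  fixes f :: "real \<Rightarrow> real"
  assumes s: "s0 < s" and c: "continuous_on {s0..s} f" and ae: "AE t in lebesgue_on {s0..s}. f t \<le> B"
    and t: "t \<in> {s0..s}"
  shows "f t \<le> B"
proof -
  have "complex_of_real (max 0 (f t - B)) = 0"
  proof (rule AE_zero_continuous[OF _ s _ t])
    show "continuous_on {s0..s} (\<lambda>t. complex_of_real (max 0 (f t - B)))" by (intro continuous_intros c)
    show "AE t in lebesgue_on {s0..s}. complex_of_real (max 0 (f t - B)) = 0"
      using ae by eventually_elim simp
  qed
  then show ?thesis by simp
qed

lemma l2bd_everywhere:
  fixes A :: "int \<Rightarrow> real \<Rightarrow> complex"
  assumes s: "s0 < s" and c: "\<And>k. continuous_on {s0..s} (A k)"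
    and ae: "AE t in lebesgue_on {s0..s}. l2bd (\<lambda>k. jb r k * cmod (A k t)) L" and t: "t \<in> {s0..s}"
  shows "l2bd (\<lambda>k. jb r k * cmod (A k t)) L"
  unfolding l2bd_def
proof (intro conjI allI impI)
  show "0 \<le> jb r k * cmod (A k t)" for k using jb_pos[of r k] by simp
  fix F :: "int set" assume F: "finite F"
  show "L2_set (\<lambda>k. jb r k * cmod (A k t)) F \<le> L"
  proof (rule AE_le_imp_le[OF s _ _ t])
    show "continuous_on {s0..s} (\<lambda>t. L2_set (\<lambda>k. jb r k * cmod (A k t)) F)"
      unfolding L2_set_def by (intro continuous_intros c)
    show "AE t in lebesgue_on {s0..s}. L2_set (\<lambda>k. jb r k * cmod (A k t)) F \<le> L"
      using ae by eventually_elim (use F in \<open>simp add: l2bd_def\<close>)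
  qed
qed

section \<open>The trilinear operator in frequency variables\<close>

text \<open>
  The contribution of one triple of frequencies at one time. The three cases that are set to zero come
  from the outer projection, the inner projection and the inverse derivative.
\<close>

definition tri_term :: "(int \<Rightarrow> complex) \<Rightarrow> (int \<Rightarrow> complex) \<Rightarrow> (int \<Rightarrow> complex) \<Rightarrow> real \<Rightarrow> freq \<Rightarrow> complex" where
  "tri_term a1 a2 a3 t x =
     (if k0 x = 0 \<or> l12 x = 0 \<or> k3 x = 0 then 0
      else inverse (\<i> * of_int (k3 x)) * (cis (- (of_int (3 * l_prod x) * t)) * (a1 (k1 x) * a2 (k2 x) * a3 (k3 x))))"

text \<open>  Absolute convergence, which licenses all exchanges of sums and time integrals. The sequence \<open>e\<close>
  stands for the rapidly decreasing coefficients of a test function and takes care of \<open>k\<close>; the inner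
  sum over \<open>k1\<close> is bounded by Cauchy--Schwarz, and that over \<open>k3\<close> likewise, since \<open>1 / k3\<close> is square
  summable.\<close>

lemma tri_term_sum_le:
  assumes 1: "l2bd (\<lambda>k. cmod (a1 k)) L1" and 2: "l2bd (\<lambda>k. cmod (a2 k)) L2" and 3: "l2bd (\<lambda>k. cmod (a3 k)) L3"
    and E: "\<And>F. finite F \<Longrightarrow> (\<Sum>k\<in>F. cmod (e k)) \<le> E" and F: "finite F"
  shows "(\<Sum>x\<in>F. cmod (tri_term a1 a2 a3 t x * e (k0 x))) \<le> 2 * sqrt wt_total * (E * (L1 * L2 * L3))"
proof -
  define u where "u m = (if m = 0 then 0 else inverse \<bar>real_of_int m\<bar>)" for m
  have u: "l2bd u (2 * sqrt wt_total)"
    unfolding l2bd_def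
  proof (intro conjI allI impI)
    show "0 \<le> u n" for n by (simp add: u_def)
    fix F :: "int set" assume F: "finite F"
    have "(\<Sum>k\<in>F. (u k)\<^sup>2) \<le> (\<Sum>k\<in>F. 4 * wt k)"
    proof (rule sum_mono)
      fix k
      show "(u k)\<^sup>2 \<le> 4 * wt k"
      proof (cases "k = 0")
        case False
        then show ?thesis using inverse_square_le_wt by (simp add: u_def)
      qed (simp add: u_def wt_nonneg)
    qed
    also have "\<dots> \<le> 4 * wt_total" using sum_wt_le[OF F] by (simp add: sum_distrib_left[symmetric])
    finally show "L2_set u F \<le> 2 * sqrt wt_total"
      unfolding L2_set_def by (metis real_sqrt_four real_sqrt_le_mono real_sqrt_mult)
  qed
  note bn = l2bd_bound_nonneg[OF 1] l2bd_bound_nonneg[OF 2] l2bd_bound_nonneg[OF 3] l2bd_bound_nonneg[OF u]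
  let ?h = "\<lambda>k m n. cmod (e k) * ((cmod (a3 m) * u m) * (cmod (a1 n) * cmod (a2 (k - m - n))))"
  let ?K = "k0 ` F" and ?M = "k3 ` F" and ?N = "k1 ` F"
  have fin: "finite ?K" "finite ?M" "finite ?N" using F by auto
  have h0: "0 \<le> ?h k m n" for k m n by (simp add: u_def)
  have "(\<Sum>x\<in>F. cmod (tri_term a1 a2 a3 t x * e (k0 x))) \<le> (\<Sum>x\<in>F. ?h (k0 x) (k3 x) (k1 x))"
  proof (rule sum_mono)
    fix x :: freq
    have k2: "k2 x = k0 x - k3 x - k1 x" by (cases x) simp
    show "cmod (tri_term a1 a2 a3 t x * e (k0 x)) \<le> ?h (k0 x) (k3 x) (k1 x)"
      by (simp add: tri_term_def norm_mult norm_inverse u_def k2)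
  qed
  also have "\<dots> = (\<Sum>y\<in>(\<lambda>x. (k0 x, k3 x, k1 x)) ` F. case y of (k, m, n) \<Rightarrow> ?h k m n)"
  proof -
    have "inj_on (\<lambda>x. (k0 x, k3 x, k1 x)) F" by (auto simp: inj_on_def)
    then show ?thesis by (simp add: sum.reindex o_def)
  qed
  also have "\<dots> \<le> (\<Sum>y\<in>?K \<times> ?M \<times> ?N. case y of (k, m, n) \<Rightarrow> ?h k m n)"
    using fin h0 by (intro sum_mono2) auto
  also have "\<dots> = (\<Sum>k\<in>?K. \<Sum>m\<in>?M. \<Sum>n\<in>?N. ?h k m n)"
    by (simp add: sum.cartesian_product)
  also have "\<dots> = (\<Sum>k\<in>?K. cmod (e k) * (\<Sum>m\<in>?M. (cmod (a3 m) * u m) * (\<Sum>n\<in>?N. cmod (a1 n) * cmod (a2 (k - m - n)))))"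
    by (simp add: sum_distrib_left)
  also have "\<dots> \<le> (\<Sum>k\<in>?K. cmod (e k) * (\<Sum>m\<in>?M. (cmod (a3 m) * u m) * (L1 * L2)))"
  proof (intro sum_mono mult_left_mono)
    fix k m
    show "(\<Sum>n\<in>?N. cmod (a1 n) * cmod (a2 (k - m - n))) \<le> L1 * L2"
      using l2bd_sum_inj[OF fin(3) 1 2, of "\<lambda>n. n" "\<lambda>n. k - m - n"] by (simp add: inj_on_def)
  qed (auto simp: u_def)
  also have "\<dots> = (\<Sum>k\<in>?K. cmod (e k)) * ((\<Sum>m\<in>?M. cmod (a3 m) * u m) * (L1 * L2))"
    by (simp add: sum_distrib_right)
  also have "\<dots> \<le> E * ((L3 * (2 * sqrt wt_total)) * (L1 * L2))"
  proof (intro mult_mono E fin mult_right_mono)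
    show "(\<Sum>m\<in>?M. cmod (a3 m) * u m) \<le> L3 * (2 * sqrt wt_total)"
      using l2bd_sum_inj[OF fin(2) 3 u, of "\<lambda>n. n" "\<lambda>n. n"] by simp
    show "0 \<le> E" using E[of "{}"] by simp
  qed (use bn in \<open>auto intro!: mult_nonneg_nonneg sum_nonneg simp: u_def\<close>)
  finally show ?thesis by (simp add: mult_ac)
qed

lemma test_pairing_summable:
  assumes "periodic_test \<phi>"
  shows "(\<lambda>k. cmod (of_fun (\<lambda>x. cis (of_int k * x)) \<phi>)) summable_on UNIV"
proof -
  have "(\<lambda>k. cmod (fc \<phi> k)) summable_on (uminus ` UNIV)"
    using test_fc_summable[OF assms] by (simp add: surj_uminus)
  then have "(\<lambda>k. cmod (fc \<phi> (- k))) summable_on UNIV"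
    by (subst (asm) summable_on_reindex) (auto simp: o_def)
  then have "(\<lambda>k. 2 * pi * cmod (fc \<phi> (- k))) summable_on UNIV" by (rule summable_on_cmult_right)
  then show ?thesis unfolding of_fun_cis by (simp add: norm_mult)
qed

lemma in_H_0_l2bd:
  assumes "in_H 0 u" shows "l2bd (\<lambda>k. cmod (fcoeff u k)) (H_norm 0 u)"
  using in_H_l2bd[OF assms] by (simp add: jb_0)

lemma l2bd_mono: "l2bd A a \<Longrightarrow> a \<le> b \<Longrightarrow> l2bd A b"
  unfolding l2bd_def using order_trans by blast

lemma airy_phase:
  "cis (- (t * of_int (k0 x) ^ 3)) * cis (t * of_int (k3 x) ^ 3) * cis (t * of_int (k1 x) ^ 3) * cis (t * of_int (k2 x) ^ 3)
    = cis (- (of_int (3 * l_prod x) * t))"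
proof -
  have "real_of_int (3 * l_prod x) = of_int (k0 x) ^ 3 - of_int (k1 x) ^ 3 - of_int (k2 x) ^ 3 - of_int (k3 x) ^ 3"
    unfolding resonance_factorization[of x, symmetric] by simp
  then have "- (t * of_int (k0 x) ^ 3) + t * of_int (k3 x) ^ 3 + t * of_int (k1 x) ^ 3 + t * of_int (k2 x) ^ 3 = - (real_of_int (3 * l_prod x) * t)"
    by (simp only:) (simp add: algebra_simps)
  then show ?thesis unfolding cis_mult by (simp only:)
qed

lemma tri_term_factor:
  assumes "k \<noteq> 0" "k - m \<noteq> 0"
  shows "tri_term (fcoeff v1) (fcoeff v2) (fcoeff v3) t (k, m, n)
     = (cis (- (t * of_int k ^ 3)) * fcoeff (airy (- t) (dx_inv v3)) m)
       * (fcoeff (airy (- t) v1) n * fcoeff (airy (- t) v2) (k - m - n))"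
proof (cases "m = 0")
  case True then show ?thesis by (simp add: tri_term_def airy_fcoeff dx_inv_fcoeff)
next
  case False
  have "l12 (k, m, n) \<noteq> 0" using assms by (simp add: l12_def)
  then have "tri_term (fcoeff v1) (fcoeff v2) (fcoeff v3) t (k, m, n)
     = inverse (\<i> * of_int m) * (cis (- (of_int (3 * l_prod (k, m, n)) * t)) * (fcoeff v1 n * fcoeff v2 (k - m - n) * fcoeff v3 m))"
    using assms False by (simp add: tri_term_def)
  also have "cis (- (of_int (3 * l_prod (k, m, n)) * t))
     = cis (- (t * of_int k ^ 3)) * cis (t * of_int m ^ 3) * cis (t * of_int n ^ 3) * cis (t * of_int (k - m - n) ^ 3)"
    using airy_phase[of t "(k, m, n)"] by simp
  finally show ?thesis using False by (simp add: airy_fcoeff dx_inv_fcoeff mult_ac)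
qed

lemma trilinear_integrand_sum:
  assumes H: "in_H 0 v1" "in_H 0 v2" "in_H 0 v3" and \<phi>: "periodic_test \<phi>"
  shows "airy t (mean_free (mult (mean_free (mult (airy (- t) v1) (airy (- t) v2))) (airy (- t) (dx_inv v3)))) \<phi>
    = (\<Sum>\<^sub>\<infinity>x. tri_term (fcoeff v1) (fcoeff v2) (fcoeff v3) t x * of_fun (\<lambda>y. cis (of_int (k0 x) * y)) \<phi>)"
proof -
  define e where "e k = of_fun (\<lambda>y. cis (of_int k * y)) \<phi>" for k
  let ?a1 = "fcoeff (airy (- t) v1)" and ?a2 = "fcoeff (airy (- t) v2)" and ?a3 = "fcoeff (airy (- t) (dx_inv v3))"
  define g where "g x = tri_term (fcoeff v1) (fcoeff v2) (fcoeff v3) t x * e (k0 x)" for x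
  have es: "(\<lambda>k. cmod (e k)) summable_on UNIV" unfolding e_def by (rule test_pairing_summable[OF \<phi>])
  then have eb: "(\<Sum>k\<in>F. cmod (e k)) \<le> (\<Sum>\<^sub>\<infinity>k. cmod (e k))" if "finite F" for F
    using that by (intro finite_sum_le_infsum) auto
  have W: "(\<Sum>x\<in>F. cmod (g x)) \<le> 2 * sqrt wt_total * ((\<Sum>\<^sub>\<infinity>k. cmod (e k)) * (H_norm 0 v1 * H_norm 0 v2 * H_norm 0 v3))" if "finite F" for F
    unfolding g_def by (rule tri_term_sum_le[OF in_H_0_l2bd[OF H(1)] in_H_0_l2bd[OF H(2)] in_H_0_l2bd[OF H(3)] eb that])
  have gabs: "(\<lambda>x. norm (g x)) summable_on UNIV"
    using W by (intro nonneg_bdd_above_summable_on) (auto simp: bdd_above_def)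
  then have gs: "g summable_on UNIV" by (rule abs_summable_summable)
  have gs2: "g summable_on (UNIV \<times> UNIV)" using gs by simp
  have fib: "(\<lambda>y. g (k, y)) summable_on UNIV" for k
    using summable_on_SigmaD1[of "\<lambda>k y. g (k, y)" UNIV "\<lambda>_. UNIV" k] gs by simp
  have fib2: "(\<lambda>y. g (k, y)) summable_on (UNIV \<times> UNIV)" for k using fib by simp
  have "infsum g UNIV = (\<Sum>\<^sub>\<infinity>k. (\<Sum>\<^sub>\<infinity>y. g (k, y)))"
    using infsum_Sigma_banach[OF gs2] by simp
  also have "\<dots> = (\<Sum>\<^sub>\<infinity>k. (\<Sum>\<^sub>\<infinity>m. (\<Sum>\<^sub>\<infinity>n. g (k, m, n))))"
    using infsum_Sigma_banach[OF fib2] by simp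
  also have "\<dots> = (\<Sum>\<^sub>\<infinity>k. cis (- (t * of_int k ^ 3)) *
         (if k = 0 then 0 else (\<Sum>\<^sub>\<infinity>m. ?a3 m * (if k - m = 0 then 0 else (\<Sum>\<^sub>\<infinity>n. ?a1 n * ?a2 (k - m - n))))) * e k)"
  proof (rule infsum_cong)
    fix k :: int
    show "(\<Sum>\<^sub>\<infinity>m. (\<Sum>\<^sub>\<infinity>n. g (k, m, n))) = cis (- (t * of_int k ^ 3)) *
         (if k = 0 then 0 else (\<Sum>\<^sub>\<infinity>m. ?a3 m * (if k - m = 0 then 0 else (\<Sum>\<^sub>\<infinity>n. ?a1 n * ?a2 (k - m - n))))) * e k"
    proof (cases "k = 0")
      case True then show ?thesis by (simp add: g_def tri_term_def)
    next
      case False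
      have eq: "(\<Sum>\<^sub>\<infinity>n. g (k, m, n)) = (cis (- (t * of_int k ^ 3)) * e k) * (?a3 m * (if k - m = 0 then 0 else (\<Sum>\<^sub>\<infinity>n. ?a1 n * ?a2 (k - m - n))))" for m
      proof (cases "k - m = 0")
        case True
        then have "g (k, m, n) = 0" for n by (simp add: g_def tri_term_def l12_def)
        then show ?thesis using True by simp
      next
        case km: False
        have "g (k, m, n) = ((cis (- (t * of_int k ^ 3)) * e k) * ?a3 m) * (?a1 n * ?a2 (k - m - n))" for n
          unfolding g_def tri_term_factor[OF False km] by simp
        then show ?thesis using km by (simp add: infsum_cmult_right' mult.assoc)
      qed
      show ?thesis unfolding eq infsum_cmult_right' using False by simp
    qed
  qed
  also have "\<dots> = airy t (mean_free (mult (mean_free (mult (airy (- t) v1) (airy (- t) v2))) (airy (- t) (dx_inv v3)))) \<phi>"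
    using H unfolding e_def by (intro trilinear_integrand[symmetric]) (auto simp: in_H_0_iff)
  finally show ?thesis unfolding g_def e_def by simp
qed

definition tri_coeff :: "real \<Rightarrow> real \<Rightarrow> (real \<Rightarrow> functional) \<Rightarrow> (real \<Rightarrow> functional) \<Rightarrow> (real \<Rightarrow> functional) \<Rightarrow> freq \<Rightarrow> complex" where
  "tri_coeff s0 s v1 v2 v3 x =
     (LINT t|lebesgue_on {s0..s}. tri_term (fcoeff (v1 t)) (fcoeff (v2 t)) (fcoeff (v3 t)) t x)"

lemma tri_term_measurable:
  assumes "\<And>k. (\<lambda>t. a1 t k) \<in> borel_measurable (lebesgue_on {s0..s})" "\<And>k. (\<lambda>t. a2 t k) \<in> borel_measurable (lebesgue_on {s0..s})"
    "\<And>k. (\<lambda>t. a3 t k) \<in> borel_measurable (lebesgue_on {s0..s})"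
  shows "(\<lambda>t. tri_term (a1 t) (a2 t) (a3 t) t x) \<in> borel_measurable (lebesgue_on {s0..s})"
proof -
  have c: "(\<lambda>t. cis (- (of_int (3 * l_prod x) * t))) \<in> borel_measurable (lebesgue_on {s0..s})"
    by (rule borel_measurable_lebesgue_onI, rule borel_measurable_continuous_onI)
       (unfold cis_conv_exp, intro continuous_intros)
  show ?thesis unfolding tri_term_def
    by (cases "k0 x = 0 \<or> l12 x = 0 \<or> k3 x = 0")
       (simp, simp only: if_False, intro borel_measurable_times borel_measurable_const c assms)
qed

text \<open>  The time integral is exchanged with the sum over triples by dominated convergence, with a constant
  majorant from \<open>tri_term_sum_le\<close>.\<close>

lemma trilin_formula:
  assumes v: "in_Linf_H r1 s0 s v1" "in_Linf_H r2 s0 s v2" "in_Linf_H r3 s0 s v3"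
    and r: "0 \<le> r1" "0 \<le> r2" "0 \<le> r3" and \<phi>: "periodic_test \<phi>"
  shows "trilin s0 s v1 v2 v3 \<phi> = (\<Sum>\<^sub>\<infinity>k. (\<Sum>\<^sub>\<infinity>y. tri_coeff s0 s v1 v2 v3 (k, y)) * of_fun (\<lambda>x. cis (of_int k * x)) \<phi>)"
proof -
  let ?M = "lebesgue_on {s0..s}"
  define e where "e k = of_fun (\<lambda>y. cis (of_int k * y)) \<phi>" for k
  have es: "(\<lambda>k. cmod (e k)) summable_on UNIV" unfolding e_def by (rule test_pairing_summable[OF \<phi>])
  then have eb: "(\<Sum>k\<in>F. cmod (e k)) \<le> (\<Sum>\<^sub>\<infinity>k. cmod (e k))" if "finite F" for F
    using that by (intro finite_sum_le_infsum) auto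
  let ?L1 = "Linf_norm (H_norm 0) s0 s v1" and ?L2 = "Linf_norm (H_norm 0) s0 s v2" and ?L3 = "Linf_norm (H_norm 0) s0 s v3"
  note ae = Linf_H_AE_bound[OF v(1) r(1)] Linf_H_AE_bound[OF v(2) r(2)] Linf_H_AE_bound[OF v(3) r(3)]
  let ?g = "\<lambda>x t. tri_term (fcoeff (v1 t)) (fcoeff (v2 t)) (fcoeff (v3 t)) t x * e (k0 x)"
  have gm: "?g x \<in> borel_measurable ?M" for x
    by (intro borel_measurable_times borel_measurable_const tri_term_measurable Linf_H_fcoeff_measurable[OF v(1)]
        Linf_H_fcoeff_measurable[OF v(2)] Linf_H_fcoeff_measurable[OF v(3)])
  have inf: "infinite (UNIV :: freq set)"
  proof
    assume "finite (UNIV :: freq set)"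
    then have "finite (range (fst :: freq \<Rightarrow> int))" by (rule finite_imageI)
    moreover have "surj (fst :: freq \<Rightarrow> int)" by (rule surjI[of _ "\<lambda>k. (k, 0, 0)"]) simp
    ultimately show False using infinite_int by simp
  qed
  have bd: "AE t in ?M. \<forall>F. finite F \<longrightarrow> (\<Sum>x\<in>F. norm (?g x t)) \<le> 2 * sqrt wt_total * ((\<Sum>\<^sub>\<infinity>k. cmod (e k)) * (?L1 * ?L2 * ?L3))"
    using ae
  proof eventually_elim
    case (elim t)
    then have l: "l2bd (\<lambda>k. cmod (fcoeff (v1 t) k)) ?L1" "l2bd (\<lambda>k. cmod (fcoeff (v2 t) k)) ?L2" "l2bd (\<lambda>k. cmod (fcoeff (v3 t) k)) ?L3"
      using l2bd_mono[OF in_H_0_l2bd] by blast+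
    show ?case by (intro allI impI tri_term_sum_le[OF l eb])
  qed
  note A = has_sum_lebesgue_integral[OF inf gm finite_measure.integrable_const[OF finite_measure_lebesgue_on_Icc] bd]
  have J: "(LINT t|?M. ?g x t) = tri_coeff s0 s v1 v2 v3 x * e (k0 x)" for x
    unfolding tri_coeff_def by (rule integral_mult_left_zero)
  have pw: "AE t in ?M. (\<Sum>\<^sub>\<infinity>x. ?g x t) = airy t (mean_free (mult (mean_free (mult (airy (- t) (v1 t)) (airy (- t) (v2 t)))) (airy (- t) (dx_inv (v3 t))))) \<phi>"
    using ae
  proof eventually_elim
    case (elim t)
    then show ?case unfolding e_def by (intro trilinear_integrand_sum[symmetric] \<phi>) auto
  qed
  have "trilin s0 s v1 v2 v3 \<phi> = (LINT t|?M. (\<Sum>\<^sub>\<infinity>x. ?g x t))"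
    unfolding trilin_def
  proof (rule integral_cong_AE)
    show m: "(\<lambda>t. (\<Sum>\<^sub>\<infinity>x. ?g x t)) \<in> borel_measurable ?M" using A(3) by (rule borel_measurable_integrable)
    show "(\<lambda>t. airy t (mean_free (mult (mean_free (mult (airy (- t) (v1 t)) (airy (- t) (v2 t)))) (airy (- t) (dx_inv (v3 t))))) \<phi>) \<in> borel_measurable ?M"
      by (rule borel_measurable_lebesgue_on_AE[OF m pw])
    show "AE t in ?M. airy t (mean_free (mult (mean_free (mult (airy (- t) (v1 t)) (airy (- t) (v2 t)))) (airy (- t) (dx_inv (v3 t))))) \<phi> = (\<Sum>\<^sub>\<infinity>x. ?g x t)"
      using pw by eventually_elim (simp only:)
  qed
  also have "\<dots> = (\<Sum>\<^sub>\<infinity>x. tri_coeff s0 s v1 v2 v3 x * e (k0 x))"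
    using infsumI[OF A(1)] unfolding J by (rule sym)
  also have "\<dots> = (\<Sum>\<^sub>\<infinity>k. (\<Sum>\<^sub>\<infinity>y. tri_coeff s0 s v1 v2 v3 (k, y) * e (k0 (k, y))))"
  proof -
    have "(\<lambda>x. tri_coeff s0 s v1 v2 v3 x * e (k0 x)) summable_on (UNIV \<times> UNIV)"
      using abs_summable_summable[OF A(4)] unfolding J by simp
    from infsum_Sigma_banach[OF this] show ?thesis by simp
  qed
  also have "\<dots> = (\<Sum>\<^sub>\<infinity>k. (\<Sum>\<^sub>\<infinity>y. tri_coeff s0 s v1 v2 v3 (k, y)) * e k)"
  proof (rule infsum_cong)
    fix k :: int
    have "k0 (k, y) = k" for y by (cases y) simp
    then show "(\<Sum>\<^sub>\<infinity>y. tri_coeff s0 s v1 v2 v3 (k, y) * e (k0 (k, y))) = (\<Sum>\<^sub>\<infinity>y. tri_coeff s0 s v1 v2 v3 (k, y)) * e k"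
      by (simp add: infsum_cmult_left')
  qed
  finally show ?thesis unfolding e_def .
qed

text \<open>  Duality. Testing against \<open>D k = \<bar>c k\<bar>\<close> on a finite set, where \<open>c k\<close> is the sum over the fibre,
  gives \<open>d\<^sup>2 \<le> B * d\<close> for the \<open>\<ell>\<^sup>2\<close> norm \<open>d\<close> of \<open>c\<close> on that set.\<close>

lemma fibre_sums_square_summable:
  fixes J :: "freq \<Rightarrow> complex"
  assumes bd: "\<And>T D d. finite T \<Longrightarrow> l2bd D d \<Longrightarrow> (\<Sum>x\<in>T. D (k0 x) * cmod (J x)) \<le> B * d"
  shows "(\<lambda>k. (cmod (\<Sum>\<^sub>\<infinity>y. J (k, y)))\<^sup>2) summable_on UNIV"
    and "(\<Sum>\<^sub>\<infinity>k. (cmod (\<Sum>\<^sub>\<infinity>y. J (k, y)))\<^sup>2) \<le> B\<^sup>2"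
proof -
  have k0p: "k0 (k, y) = k" for k y by (cases y) simp
  have l2i: "l2bd (\<lambda>n. if n \<in> S then c n else 0) (L2_set c S)" if S: "finite S" and c: "\<And>n. 0 \<le> c n" for S c
    unfolding l2bd_def
  proof (intro conjI allI impI)
    fix F :: "int set" assume F: "finite F"
    have "(\<Sum>n\<in>F. (if n \<in> S then c n else 0)\<^sup>2) = (\<Sum>n\<in>F \<inter> S. (c n)\<^sup>2)"
      using F by (intro sum.mono_neutral_cong_right) auto
    also have "\<dots> \<le> (\<Sum>n\<in>S. (c n)\<^sup>2)" using S by (intro sum_mono2) auto
    finally show "L2_set (\<lambda>n. if n \<in> S then c n else 0) F \<le> L2_set c S" by (simp add: L2_set_def)
  qed (use c in auto)
  have fib: "(\<lambda>y. cmod (J (k, y))) summable_on UNIV" for k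
  proof (rule nonneg_bdd_above_summable_on)
    show "bdd_above (sum (\<lambda>y. cmod (J (k, y))) ` {F. F \<subseteq> UNIV \<and> finite F})"
    proof (rule bdd_aboveI2)
      fix F :: "(int \<times> int) set" assume "F \<in> {F. F \<subseteq> UNIV \<and> finite F}"
      then have F: "finite F" by simp
      have inj: "inj_on (Pair k) F" by (simp add: inj_on_def)
      have "(\<Sum>x\<in>Pair k ` F. (if k0 x \<in> {k} then 1 else 0) * cmod (J x)) \<le> B * L2_set (\<lambda>_. 1) {k}"
        using bd[OF finite_imageI[OF F] l2i[of "{k}" "\<lambda>_. 1"]] by simp
      then show "(\<Sum>y\<in>F. cmod (J (k, y))) \<le> B * L2_set (\<lambda>_. 1) {k}"
        by (simp add: sum.reindex[OF inj] k0p o_def)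
    qed
  qed simp
  have B0: "0 \<le> B" using bd[OF _ l2i[of "{0}" "\<lambda>_. 1"], of "{}"] by (simp add: L2_set_def)
  let ?C = "\<lambda>k. cmod (\<Sum>\<^sub>\<infinity>y. J (k, y))"
  have fin: "(\<Sum>k\<in>S. (?C k)\<^sup>2) \<le> B\<^sup>2" if S: "finite S" for S
  proof -
    define d where "d = L2_set ?C S"
    have "(\<Sum>k\<in>S. (?C k)\<^sup>2) \<le> (\<Sum>k\<in>S. ?C k * (\<Sum>\<^sub>\<infinity>y. cmod (J (k, y))))"
      unfolding power2_eq_square by (intro sum_mono mult_left_mono norm_infsum_bound fib) auto
    also have "\<dots> = (\<Sum>\<^sub>\<infinity>k\<in>S. (\<Sum>\<^sub>\<infinity>y. ?C k * cmod (J (k, y))))"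
      using S by (simp add: infsum_cmult_right')
    also have "\<dots> \<le> B * d"
    proof -
      have bnd: "(\<Sum>x\<in>T. ?C (fst x) * cmod (J x)) \<le> B * d" if T: "finite T" "T \<subseteq> S \<times> UNIV" for T
      proof -
        have "(\<Sum>x\<in>T. ?C (fst x) * cmod (J x)) = (\<Sum>x\<in>T. (if k0 x \<in> S then ?C (k0 x) else 0) * cmod (J x))"
          using T by (intro sum.cong refl) (auto simp: k0p)
        also have "\<dots> \<le> B * d" unfolding d_def by (rule bd[OF T(1) l2i[OF S]]) simp
        finally show ?thesis .
      qed
      have s: "(\<lambda>x. ?C (fst x) * cmod (J x)) summable_on (S \<times> UNIV)"
        by (rule nonneg_bdd_above_summable_on) (use bnd in \<open>auto simp: bdd_above_def intro!: exI[of _ "B * d"]\<close>)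
      have "(\<Sum>\<^sub>\<infinity>k\<in>S. (\<Sum>\<^sub>\<infinity>y. ?C k * cmod (J (k, y)))) = infsum (\<lambda>x. ?C (fst x) * cmod (J x)) (S \<times> UNIV)"
        using infsum_Sigma_banach[OF s] by simp
      also have "\<dots> \<le> B * d" by (rule infsum_le_finite_sums[OF s bnd])
      finally show ?thesis .
    qed
    finally have "d\<^sup>2 \<le> B * d" by (simp add: d_def L2_set_def sum_nonneg)
    moreover have d0: "0 \<le> d" by (simp add: d_def)
    ultimately have "d \<le> B" using B0
      by (cases "d = 0") (auto simp: power2_eq_square)
    then have "d\<^sup>2 \<le> B\<^sup>2" using d0 by (intro power_mono)
    then show ?thesis by (simp add: d_def L2_set_def sum_nonneg)
  qed
  show s: "(\<lambda>k. (?C k)\<^sup>2) summable_on UNIV"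
    by (rule nonneg_bdd_above_summable_on) (use fin in \<open>auto simp: bdd_above_def\<close>)
  show "(\<Sum>\<^sub>\<infinity>k. (?C k)\<^sup>2) \<le> B\<^sup>2" by (rule infsum_le_finite_sums[OF s fin])
qed

lemma trilin_L2_bound:
  assumes v: "in_Linf_H r1 s0 s v1" "in_Linf_H r2 s0 s v2" "in_Linf_H r3 s0 s v3"
    and r: "0 \<le> r1" "0 \<le> r2" "0 \<le> r3"
    and bd: "\<And>T D d. finite T \<Longrightarrow> l2bd D d \<Longrightarrow> (\<Sum>x\<in>T. D (k0 x) * cmod (tri_coeff s0 s v1 v2 v3 x)) \<le> B * d"
    and B: "0 \<le> B"
  shows "in_L2 (trilin s0 s v1 v2 v3)" "L2_norm (trilin s0 s v1 v2 v3) \<le> 3 * B"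
proof -
  note F = fibre_sums_square_summable[OF bd]
  note S = square_summable_represented[OF F(1) trilin_formula[OF v r]]
  show "in_L2 (trilin s0 s v1 v2 v3)" by (rule S(1))
  have "L2_norm (trilin s0 s v1 v2 v3) = sqrt (2 * pi * (\<Sum>\<^sub>\<infinity>k. (cmod (\<Sum>\<^sub>\<infinity>y. tri_coeff s0 s v1 v2 v3 (k, y)))\<^sup>2))"
    by (rule S(5))
  \<comment> \<open>the norm of a function is \<open>sqrt (2 * pi) \<le> 3\<close> times that of its coefficients\<close>
  also have "\<dots> \<le> sqrt (9 * B\<^sup>2)"
    using pi_less_4 F(2) by (intro real_sqrt_le_mono mult_mono infsum_nonneg) auto
  also have "\<dots> = 3 * B" using B by (simp add: real_sqrt_mult)
  finally show "L2_norm (trilin s0 s v1 v2 v3) \<le> 3 * B" .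
qed

section \<open>Resonant and nonresonant triples\<close>

text \<open>The order of the space of the time derivatives.\<close>

abbreviation (input) nr :: real where "nr \<equiv> -23/14"

definition denom :: "freq \<Rightarrow> real" where "denom x = \<bar>of_int (k3 x)\<bar> * \<bar>of_int (l_prod x)\<bar>"

lemma sqrt_bracket_le_br: "jb r k \<le> br k powr r" if "0 \<le> r"
proof -
  have "(1 + (real_of_int k)\<^sup>2) \<le> (br k)\<^sup>2" by (simp add: br_def power2_sum)
  then have "jb r k \<le> ((br k)\<^sup>2) powr (r / 2)"
    unfolding jb_def using that by (intro powr_mono2) auto
  also have "\<dots> = br k powr r" using br_ge_1[of k] by (simp add: powr_powr flip: powr_numeral)
  finally show ?thesis .
qed

lemma le_br_powr_jb: "0 \<le> a \<Longrightarrow> a \<le> br k powr (23/14) * (jb nr k * a)"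
proof -
  assume a: "0 \<le> a"
  have "a = jb (23/14) k * (jb nr k * a)"
    using jb_minus[of "-23/14" k] by (simp add: mult.assoc[symmetric])
  also have "\<dots> \<le> br k powr (23/14) * (jb nr k * a)"
    using a jb_pos[of nr k] by (intro mult_right_mono sqrt_bracket_le_br) auto
  finally show ?thesis .
qed

text \<open>  One of the three sequences is controlled only in the negative order. This covers the endpoint
  terms, where that factor can be chosen freely, and each of the three derivative terms.\<close>

definition one_negative_order ::
  "(int \<Rightarrow> real) \<Rightarrow> (int \<Rightarrow> real) \<Rightarrow> (int \<Rightarrow> real) \<Rightarrow> real \<Rightarrow> real \<Rightarrow> real \<Rightarrow> bool" where
  "one_negative_order A B C a b c \<longleftrightarrow>
     l2bd (\<lambda>k. jb nr k * A k) a \<and> l2bd B b \<and> l2bd C c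
   \<or> l2bd A a \<and> l2bd (\<lambda>k. jb nr k * B k) b \<and> l2bd C c
   \<or> l2bd A a \<and> l2bd B b \<and> l2bd (\<lambda>k. jb nr k * C k) c"

definition nonres_const :: real where "nonres_const = 256 * pair_const"

lemma nonres_const_pos: "0 < nonres_const"
  unfolding nonres_const_def using pair_const_pos by simp

text \<open>  The loss from the negative order is \<open>br (\<kappa> x) powr (23 / 14)\<close> at one of the three frequencies \<open>\<kappa>\<close>, and
  \<open>nonresonant_multiplier_le\<close> trades it, together with the denominator, for the pair weights.\<close>

lemma nonresonant_sum_le:
  assumes T: "finite T" "\<forall>x\<in>T. k3 x \<noteq> 0 \<and> l_prod x \<noteq> 0"
    and nn: "\<forall>k. 0 \<le> A k" "\<forall>k. 0 \<le> B k" "\<forall>k. 0 \<le> C k" and D: "l2bd D d"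
    and h: "one_negative_order A B C a b c"
  shows "(\<Sum>x\<in>T. A (k1 x) * B (k2 x) * C (k3 x) * D (k0 x) / denom x) \<le> nonres_const * (a * b * c * d)"
proof -
  have gen: "(\<Sum>x\<in>T. A (k1 x) * B (k2 x) * C (k3 x) * D (k0 x) / denom x) \<le> nonres_const * (a * b * c * d)"
    if T: "finite T" "\<And>x. x \<in> T \<Longrightarrow> k3 x \<noteq> 0 \<and> l_prod x \<noteq> 0" and \<kappa>: "\<kappa> \<in> {k1, k2, k3}"
      and l: "l2bd A' a" "l2bd B' b" "l2bd C' c" "l2bd D d"
      and le: "\<And>x. A (k1 x) * B (k2 x) * C (k3 x) \<le> br (\<kappa> x) powr (23/14) * (A' (k1 x) * B' (k2 x) * C' (k3 x))"
    for T \<kappa> A B C A' B' C' D a b c d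
  proof -
    note nn = l2bd_nonneg[OF l(1)] l2bd_nonneg[OF l(2)] l2bd_nonneg[OF l(3)] l2bd_nonneg[OF l(4)]
    have "(\<Sum>x\<in>T. A (k1 x) * B (k2 x) * C (k3 x) * D (k0 x) / denom x)
       \<le> (\<Sum>x\<in>T. 256 * (pair_weights x * (A' (k1 x) * B' (k2 x) * C' (k3 x) * D (k0 x))))"
    proof (rule sum_mono)
      fix x assume x: "x \<in> T"
      let ?p = "A' (k1 x) * B' (k2 x) * C' (k3 x) * D (k0 x)"
      have p0: "0 \<le> ?p" using nn by auto
      have "A (k1 x) * B (k2 x) * C (k3 x) * D (k0 x) \<le> br (\<kappa> x) powr (23/14) * (A' (k1 x) * B' (k2 x) * C' (k3 x)) * D (k0 x)"
        using le nn by (intro mult_right_mono) auto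
      then have "A (k1 x) * B (k2 x) * C (k3 x) * D (k0 x) / denom x
          \<le> br (\<kappa> x) powr (23/14) * (A' (k1 x) * B' (k2 x) * C' (k3 x)) * D (k0 x) / denom x"
        by (intro divide_right_mono) (auto simp: denom_def)
      also have "\<dots> = br (\<kappa> x) powr (23/14) / denom x * ?p" by simp
      also have "\<dots> \<le> (256 * pair_weights x) * ?p"
        using nonresonant_multiplier_le[of x \<kappa>] T(2)[OF x] \<kappa> p0 unfolding denom_def by (intro mult_right_mono) auto
      finally show "A (k1 x) * B (k2 x) * C (k3 x) * D (k0 x) / denom x \<le> 256 * (pair_weights x * ?p)" by simp
    qed
    also have "\<dots> \<le> 256 * (pair_const * (a * b * c * d))"
      unfolding sum_distrib_left[symmetric] using pair_weights_sum_le[OF T(1) l] by (intro mult_left_mono) auto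
    finally show ?thesis by (simp add: nonres_const_def)
  qed
  from h show ?thesis
    unfolding one_negative_order_def
proof (elim disjE conjE)
  assume l: "l2bd (\<lambda>k. jb nr k * A k) a" "l2bd B b" "l2bd C c"
  show ?thesis
  proof (rule gen[where \<kappa>=k1, OF T(1) _ _ l D])
    fix x
    have "A (k1 x) * (B (k2 x) * C (k3 x)) \<le> br (k1 x) powr (23/14) * (jb nr (k1 x) * A (k1 x)) * (B (k2 x) * C (k3 x))"
      using nn by (intro mult_right_mono le_br_powr_jb) auto
    then show "A (k1 x) * B (k2 x) * C (k3 x) \<le> br (k1 x) powr (23/14) * (jb nr (k1 x) * A (k1 x) * B (k2 x) * C (k3 x))"
      by (simp only: mult.assoc)
  qed (use T(2) in auto)
next
  assume l: "l2bd A a" "l2bd (\<lambda>k. jb nr k * B k) b" "l2bd C c"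
  show ?thesis
  proof (rule gen[where \<kappa>=k2, OF T(1) _ _ l D])
    fix x
    have "B (k2 x) * (A (k1 x) * C (k3 x)) \<le> br (k2 x) powr (23/14) * (jb nr (k2 x) * B (k2 x)) * (A (k1 x) * C (k3 x))"
      using nn by (intro mult_right_mono le_br_powr_jb) auto
    then show "A (k1 x) * B (k2 x) * C (k3 x) \<le> br (k2 x) powr (23/14) * (A (k1 x) * (jb nr (k2 x) * B (k2 x)) * C (k3 x))"
      by (simp only: mult_ac)
  qed (use T(2) in auto)
next
  assume l: "l2bd A a" "l2bd B b" "l2bd (\<lambda>k. jb nr k * C k) c"
  show ?thesis
  proof (rule gen[where \<kappa>=k3, OF T(1) _ _ l D])
    fix x
    have "C (k3 x) * (A (k1 x) * B (k2 x)) \<le> br (k3 x) powr (23/14) * (jb nr (k3 x) * C (k3 x)) * (A (k1 x) * B (k2 x))"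
      using nn by (intro mult_right_mono le_br_powr_jb) auto
    then show "A (k1 x) * B (k2 x) * C (k3 x) \<le> br (k3 x) powr (23/14) * (A (k1 x) * B (k2 x) * (jb nr (k3 x) * C (k3 x)))"
      by (simp only: mult_ac)
  qed (use T(2) in auto)
qed
qed

definition tri_integral :: "real \<Rightarrow> real \<Rightarrow> (int \<Rightarrow> real \<Rightarrow> complex) \<Rightarrow> (int \<Rightarrow> real \<Rightarrow> complex) \<Rightarrow> (int \<Rightarrow> real \<Rightarrow> complex) \<Rightarrow> freq \<Rightarrow> complex" where
  "tri_integral s0 s A1 A2 A3 x =
     (LINT t|lebesgue_on {s0..s}. tri_term (\<lambda>k. A1 k t) (\<lambda>k. A2 k t) (\<lambda>k. A3 k t) t x)"

definition admissible :: "freq \<Rightarrow> bool" where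
  "admissible x \<longleftrightarrow> k0 x \<noteq> 0 \<and> l12 x \<noteq> 0 \<and> k3 x \<noteq> 0"

lemma tri_integral_admissible:
  assumes "admissible x"
  shows "cmod (tri_integral s0 s A1 A2 A3 x) = inverse \<bar>of_int (k3 x)\<bar> *
    cmod (LINT t|lebesgue_on {s0..s}. cis (- (of_int (3 * l_prod x) * t)) * (A1 (k1 x) t * A2 (k2 x) t * A3 (k3 x) t))"
proof -
  have "tri_integral s0 s A1 A2 A3 x = inverse (\<i> * of_int (k3 x)) *
    (LINT t|lebesgue_on {s0..s}. cis (- (of_int (3 * l_prod x) * t)) * (A1 (k1 x) t * A2 (k2 x) t * A3 (k3 x) t))"
    using assms unfolding tri_integral_def tri_term_def admissible_def by (simp only: if_False simp_thms integral_mult_right_zero)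
  then show ?thesis by (simp only: norm_mult norm_inverse norm_ii norm_of_int mult_1 of_int_abs)
qed

lemma tri_integral_not_admissible: "\<not> admissible x \<Longrightarrow> tri_integral s0 s A1 A2 A3 x = 0"
  by (auto simp: tri_integral_def tri_term_def admissible_def)

text \<open>  Triples that are not admissible contribute nothing.\<close>

lemma split_resonant_sum:
  assumes T: "finite T" and D: "\<And>k. 0 \<le> D k"
    and N: "(\<Sum>x\<in>{x\<in>T. admissible x \<and> l_prod x \<noteq> 0}. D (k0 x) * cmod (tri_integral s0 s A1 A2 A3 x)) \<le> n"
    and R: "(\<Sum>x\<in>{x\<in>T. admissible x \<and> l_prod x = 0}. D (k0 x) * cmod (tri_integral s0 s A1 A2 A3 x)) \<le> r"
  shows "(\<Sum>x\<in>T. D (k0 x) * cmod (tri_integral s0 s A1 A2 A3 x)) \<le> n + r"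
proof -
  let ?f = "\<lambda>x. D (k0 x) * cmod (tri_integral s0 s A1 A2 A3 x)"
  let ?N = "{x\<in>T. admissible x \<and> l_prod x \<noteq> 0}" and ?R = "{x\<in>T. admissible x \<and> l_prod x = 0}"
  have "sum ?f T = sum ?f (?N \<union> ?R)"
  proof (rule sum.mono_neutral_right[OF T])
    show "\<forall>x\<in>T - (?N \<union> ?R). ?f x = 0"
    proof
      fix x assume "x \<in> T - (?N \<union> ?R)"
      then have "\<not> admissible x" by blast
      then show "?f x = 0" by (simp add: tri_integral_not_admissible)
    qed
  qed blast
  also have "\<dots> = sum ?f ?N + sum ?f ?R" using T by (intro sum.union_disjoint) auto
  finally show ?thesis using N R by linarith
qed

lemma inverse_int_le_1: "n \<noteq> 0 \<Longrightarrow> inverse \<bar>real_of_int n\<bar> \<le> 1"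
  by (simp add: field_simps)

text \<open>  There is no oscillation to exploit: the time integral is estimated by absolute values, and
  \<open>1 / \<bar>k3\<bar> \<le> 1\<close>.\<close>

lemma resonant_part_le:
  assumes T: "finite T" and D: "l2bd D d" and s: "s0 \<le> s"
    and i: "\<And>x. integrable (lebesgue_on {s0..s}) (\<lambda>t. A1 (k1 x) t * A2 (k2 x) t * A3 (k3 x) t)"
    and ae: "AE t in lebesgue_on {s0..s}. l2bd (\<lambda>k. cmod (A1 k t)) L1 \<and> l2bd (\<lambda>k. cmod (A2 k t)) L2 \<and> l2bd (\<lambda>k. cmod (A3 k t)) L3"
  shows "(\<Sum>x\<in>{x\<in>T. admissible x \<and> l_prod x = 0}. D (k0 x) * cmod (tri_integral s0 s A1 A2 A3 x))
    \<le> (s - s0) * (2 * (L1 * L2 * L3 * d))"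
proof -
  let ?M = "lebesgue_on {s0..s}" and ?R = "{x\<in>T. admissible x \<and> l_prod x = 0}"
  let ?G = "\<lambda>x t. A1 (k1 x) t * A2 (k2 x) t * A3 (k3 x) t"
  have "(\<Sum>x\<in>?R. D (k0 x) * cmod (tri_integral s0 s A1 A2 A3 x)) \<le> (\<Sum>x\<in>?R. D (k0 x) * (LINT t|?M. cmod (?G x t)))"
  proof (intro sum_mono mult_left_mono l2bd_nonneg[OF D])
    fix x assume "x \<in> ?R"
    then have x: "admissible x" "k3 x \<noteq> 0" by (auto simp: admissible_def)
    let ?I = "LINT t|?M. cis (- (of_int (3 * l_prod x) * t)) * ?G x t"
    have "cmod (tri_integral s0 s A1 A2 A3 x) \<le> 1 * cmod ?I"
      unfolding tri_integral_admissible[OF x(1)] by (intro mult_right_mono inverse_int_le_1 x) auto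
    also have "cmod ?I \<le> (LINT t|?M. cmod (cis (- (of_int (3 * l_prod x) * t)) * ?G x t))" by (rule integral_norm_bound)
    also have "\<dots> = (LINT t|?M. cmod (?G x t))" by (simp add: norm_mult)
    finally show "cmod (tri_integral s0 s A1 A2 A3 x) \<le> (LINT t|?M. cmod (?G x t))" by simp
  qed
  also have "\<dots> = (LINT t|?M. (\<Sum>x\<in>?R. D (k0 x) * cmod (?G x t)))"
    using i by (subst Bochner_Integration.integral_sum) (auto intro!: integrable_mult_right integrable_norm)
  also have "\<dots> \<le> (LINT t|?M. 2 * (L1 * L2 * L3 * d))"
  proof (rule integral_mono_AE)
    show "integrable ?M (\<lambda>t. \<Sum>x\<in>?R. D (k0 x) * cmod (?G x t))"
      using i by (intro Bochner_Integration.integrable_sum integrable_mult_right integrable_norm)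
    show "integrable ?M (\<lambda>t. 2 * (L1 * L2 * L3 * d))"
      by (rule finite_measure.integrable_const[OF finite_measure_lebesgue_on_Icc])
    show "AE t in ?M. (\<Sum>x\<in>?R. D (k0 x) * cmod (?G x t)) \<le> 2 * (L1 * L2 * L3 * d)"
      using ae
    proof eventually_elim
      case (elim t)
      have "(\<Sum>x\<in>?R. cmod (A1 (k1 x) t) * cmod (A2 (k2 x) t) * cmod (A3 (k3 x) t) * D (k0 x)) \<le> 2 * (L1 * L2 * L3 * d)"
        using elim T by (intro resonant_sum_le[where A="\<lambda>k. cmod (A1 k t)" and B="\<lambda>k. cmod (A2 k t)" and C="\<lambda>k. cmod (A3 k t)"] D)
          (auto simp: admissible_def l_prod_def)
      then show ?case by (simp add: norm_mult mult_ac)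
    qed
  qed
  also have "\<dots> = (s - s0) * (2 * (L1 * L2 * L3 * d))" using s by (simp add: measure_restrict_space)
  finally show ?thesis .
qed

text \<open>  Integration by parts in time at every triple. The endpoint terms are two nonresonant sums, bounded
  with the negative order on an arbitrary factor (\<open>n1, n2, n3\<close>); the three derivative terms are bounded
  pointwise in time with the negative order on the derivative, and integrated.\<close>

lemma nonresonant_part_le:
  assumes s: "s0 < s"
    and p1: "\<And>k. primitive s0 s (A1 k) (b1 k)" and p2: "\<And>k. primitive s0 s (A2 k) (b2 k)"
    and p3: "\<And>k. primitive s0 s (A3 k) (b3 k)"
    and L: "\<forall>t\<in>{s0..s}. l2bd (\<lambda>k. cmod (A1 k t)) L1 \<and> l2bd (\<lambda>k. cmod (A2 k t)) L2 \<and> l2bd (\<lambda>k. cmod (A3 k t)) L3"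
    and b: "AE t in lebesgue_on {s0..s}. l2bd (\<lambda>k. jb nr k * cmod (b1 k t)) D1
        \<and> l2bd (\<lambda>k. jb nr k * cmod (b2 k t)) D2 \<and> l2bd (\<lambda>k. jb nr k * cmod (b3 k t)) D3"
    and N: "\<forall>t\<in>{s0..s}. one_negative_order (\<lambda>k. cmod (A1 k t)) (\<lambda>k. cmod (A2 k t)) (\<lambda>k. cmod (A3 k t)) n1 n2 n3"
    and T: "finite T" and D: "l2bd D d"
  shows "(\<Sum>x\<in>{x\<in>T. admissible x \<and> l_prod x \<noteq> 0}. D (k0 x) * cmod (tri_integral s0 s A1 A2 A3 x))
    \<le> nonres_const * ((2 * (n1 * n2 * n3) + (s - s0) * (D1 * L2 * L3 + L1 * D2 * L3 + L1 * L2 * D3)) * d)"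
proof -
  let ?M = "lebesgue_on {s0..s}" and ?T = "{x\<in>T. admissible x \<and> l_prod x \<noteq> 0}"
  have fT: "finite ?T" using T by simp
  have nzT: "\<forall>x\<in>?T. k3 x \<noteq> 0 \<and> l_prod x \<noteq> 0" by (auto simp: admissible_def)
  let ?G = "\<lambda>x t. cmod (A1 (k1 x) t * A2 (k2 x) t * A3 (k3 x) t)"
  let ?R = "\<lambda>x t. cmod (b1 (k1 x) t * A2 (k2 x) t * A3 (k3 x) t) + cmod (A1 (k1 x) t * b2 (k2 x) t * A3 (k3 x) t)
      + cmod (A1 (k1 x) t * A2 (k2 x) t * b3 (k3 x) t)"
  have end_le: "(\<Sum>x\<in>?T. D (k0 x) * ?G x t / denom x) \<le> nonres_const * (n1 * n2 * n3 * d)" if t: "t \<in> {s0..s}" for t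
  proof -
    have e: "(\<Sum>x\<in>?T. D (k0 x) * ?G x t / denom x)
      = (\<Sum>x\<in>?T. cmod (A1 (k1 x) t) * cmod (A2 (k2 x) t) * cmod (A3 (k3 x) t) * D (k0 x) / denom x)"
      by (simp add: norm_mult mult_ac)
    show ?thesis unfolding e by (rule nonresonant_sum_le[OF fT nzT _ _ _ D]) (use N t in auto)
  qed
  note osc = oscillatory_integral_le[OF less_imp_le[OF s] _ p1 p2 p3]
  have Ri: "integrable ?M (?R x)" for x by (rule osc(1)[of 1]) simp
  have "(\<Sum>x\<in>?T. D (k0 x) * cmod (tri_integral s0 s A1 A2 A3 x))
      \<le> (\<Sum>x\<in>?T. D (k0 x) * ?G x s / denom x + D (k0 x) * ?G x s0 / denom x + (LINT t|?M. D (k0 x) * ?R x t / denom x))"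
  proof (rule sum_mono)
    fix x assume x: "x \<in> ?T"
    then have ax: "admissible x" and l: "l_prod x \<noteq> 0" and k3: "k3 x \<noteq> 0" by (auto simp: admissible_def)
    let ?I = "LINT t|?M. cis (- (of_int (3 * l_prod x) * t)) * (A1 (k1 x) t * A2 (k2 x) t * A3 (k3 x) t)"
    have d0: "0 < denom x" using l k3 by (simp add: denom_def)
    have "\<bar>real_of_int (l_prod x)\<bar> * cmod ?I \<le> \<bar>real_of_int (3 * l_prod x)\<bar> * cmod ?I"
      by (intro mult_right_mono) auto
    also have "\<dots> \<le> ?G x s + ?G x s0 + (LINT t|?M. ?R x t)"
      using l by (intro osc(2)) auto
    finally have I: "\<bar>real_of_int (l_prod x)\<bar> * cmod ?I \<le> ?G x s + ?G x s0 + (LINT t|?M. ?R x t)" .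
    have "cmod (tri_integral s0 s A1 A2 A3 x) = \<bar>real_of_int (l_prod x)\<bar> * cmod ?I / denom x"
      unfolding tri_integral_admissible[OF ax] denom_def using l k3 by (simp add: field_simps)
    also have "\<dots> \<le> (?G x s + ?G x s0 + (LINT t|?M. ?R x t)) / denom x"
      using I d0 by (intro divide_right_mono) auto
    finally have "D (k0 x) * cmod (tri_integral s0 s A1 A2 A3 x) \<le> D (k0 x) * ((?G x s + ?G x s0 + (LINT t|?M. ?R x t)) / denom x)"
      using l2bd_nonneg[OF D] by (intro mult_left_mono)
    also have "\<dots> = D (k0 x) * ?G x s / denom x + D (k0 x) * ?G x s0 / denom x + D (k0 x) * (LINT t|?M. ?R x t) / denom x"
      by (simp add: ring_distribs add_divide_distrib)
    also have "D (k0 x) * (LINT t|?M. ?R x t) / denom x = (LINT t|?M. D (k0 x) * ?R x t / denom x)"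
      by (simp only: integral_mult_right_zero integral_divide_zero)
    finally show "D (k0 x) * cmod (tri_integral s0 s A1 A2 A3 x)
      \<le> D (k0 x) * ?G x s / denom x + D (k0 x) * ?G x s0 / denom x + (LINT t|?M. D (k0 x) * ?R x t / denom x)" .
  qed
  also have "\<dots> = (\<Sum>x\<in>?T. D (k0 x) * ?G x s / denom x) + (\<Sum>x\<in>?T. D (k0 x) * ?G x s0 / denom x)
      + (LINT t|?M. (\<Sum>x\<in>?T. D (k0 x) * ?R x t / denom x))"
  proof -
    have "(LINT t|?M. (\<Sum>x\<in>?T. D (k0 x) * ?R x t / denom x)) = (\<Sum>x\<in>?T. (LINT t|?M. D (k0 x) * ?R x t / denom x))"
      by (rule Bochner_Integration.integral_sum) (intro integrable_divide integrable_mult_right Ri)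
    then show ?thesis by (simp only: sum.distrib)
  qed
  also have "(LINT t|?M. (\<Sum>x\<in>?T. D (k0 x) * ?R x t / denom x)) \<le> (LINT t|?M. nonres_const * ((D1 * L2 * L3 + L1 * D2 * L3 + L1 * L2 * D3) * d))"
  proof (rule integral_mono_AE)
    show "integrable ?M (\<lambda>t. \<Sum>x\<in>?T. D (k0 x) * ?R x t / denom x)"
      using Ri by (intro Bochner_Integration.integrable_sum integrable_divide integrable_mult_right)
    show "integrable ?M (\<lambda>t. nonres_const * ((D1 * L2 * L3 + L1 * D2 * L3 + L1 * L2 * D3) * d))"
      by (rule finite_measure.integrable_const[OF finite_measure_lebesgue_on_Icc])
    show "AE t in ?M. (\<Sum>x\<in>?T. D (k0 x) * ?R x t / denom x) \<le> nonres_const * ((D1 * L2 * L3 + L1 * D2 * L3 + L1 * L2 * D3) * d)"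
      using b AE_space
    proof eventually_elim
      case (elim t)
      then have t: "t \<in> {s0..s}" by simp
      have 1: "(\<Sum>x\<in>?T. cmod (b1 (k1 x) t) * cmod (A2 (k2 x) t) * cmod (A3 (k3 x) t) * D (k0 x) / denom x) \<le> nonres_const * (D1 * L2 * L3 * d)"
        by (rule nonresonant_sum_le[OF fT nzT _ _ _ D, where A="\<lambda>k. cmod (b1 k t)" and B="\<lambda>k. cmod (A2 k t)" and C="\<lambda>k. cmod (A3 k t)"])
             (use elim L t in \<open>auto simp: one_negative_order_def\<close>)
      have 2: "(\<Sum>x\<in>?T. cmod (A1 (k1 x) t) * cmod (b2 (k2 x) t) * cmod (A3 (k3 x) t) * D (k0 x) / denom x) \<le> nonres_const * (L1 * D2 * L3 * d)"
        by (rule nonresonant_sum_le[OF fT nzT _ _ _ D, where A="\<lambda>k. cmod (A1 k t)" and B="\<lambda>k. cmod (b2 k t)" and C="\<lambda>k. cmod (A3 k t)"])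
             (use elim L t in \<open>auto simp: one_negative_order_def\<close>)
      have 3: "(\<Sum>x\<in>?T. cmod (A1 (k1 x) t) * cmod (A2 (k2 x) t) * cmod (b3 (k3 x) t) * D (k0 x) / denom x) \<le> nonres_const * (L1 * L2 * D3 * d)"
        by (rule nonresonant_sum_le[OF fT nzT _ _ _ D, where A="\<lambda>k. cmod (A1 k t)" and B="\<lambda>k. cmod (A2 k t)" and C="\<lambda>k. cmod (b3 k t)"])
             (use elim L t in \<open>auto simp: one_negative_order_def\<close>)
      have "(\<Sum>x\<in>?T. D (k0 x) * ?R x t / denom x)
        = (\<Sum>x\<in>?T. cmod (b1 (k1 x) t) * cmod (A2 (k2 x) t) * cmod (A3 (k3 x) t) * D (k0 x) / denom x)
        + (\<Sum>x\<in>?T. cmod (A1 (k1 x) t) * cmod (b2 (k2 x) t) * cmod (A3 (k3 x) t) * D (k0 x) / denom x)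
        + (\<Sum>x\<in>?T. cmod (A1 (k1 x) t) * cmod (A2 (k2 x) t) * cmod (b3 (k3 x) t) * D (k0 x) / denom x)"
        unfolding sum.distrib[symmetric]
        by (intro sum.cong refl) (simp add: norm_mult add_divide_distrib[symmetric] algebra_simps)
      also have "\<dots> \<le> nonres_const * ((D1 * L2 * L3 + L1 * D2 * L3 + L1 * L2 * D3) * d)"
        using 1 2 3 by (simp add: algebra_simps)
      finally show ?case .
    qed
  qed
  also have "\<dots> = (s - s0) * (nonres_const * ((D1 * L2 * L3 + L1 * D2 * L3 + L1 * L2 * D3) * d))"
    using s by (simp add: measure_restrict_space)
  also have "(\<Sum>x\<in>?T. D (k0 x) * ?G x s / denom x) \<le> nonres_const * (n1 * n2 * n3 * d)" using s by (intro end_le) auto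
  also have "(\<Sum>x\<in>?T. D (k0 x) * ?G x s0 / denom x) \<le> nonres_const * (n1 * n2 * n3 * d)" using s by (intro end_le) auto
  finally show ?thesis by (simp add: algebra_simps)
qed

section \<open>Estimates for the trilinear operator\<close>

text \<open>  Continuous representatives of the Fourier coefficients, with the bounds that the two norms
  supply: at all times for the coefficients, at almost all times for their derivatives.\<close>

lemma in_X_primitives:
  assumes s: "s0 < s" and v: "in_X \<alpha> s0 s v" and \<alpha>: "0 \<le> \<alpha>"
  shows "\<exists>A b. (\<forall>k. primitive s0 s (A k) (b k)) \<and> (AE t in lebesgue_on {s0..s}. fcoeff (v t) = (\<lambda>k. A k t))
    \<and> (\<forall>t\<in>{s0..s}. l2bd (\<lambda>k. cmod (A k t)) (Linf_norm (H_norm 0) s0 s v))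
    \<and> (\<forall>t\<in>{s0..s}. l2bd (\<lambda>k. jb nr k * cmod (A k t)) (Linf_norm (H_norm nr) s0 s v))
    \<and> (AE t in lebesgue_on {s0..s}. l2bd (\<lambda>k. jb nr k * cmod (b k t)) (Linf_norm (H_norm nr) s0 s (dt s0 s v)))"
proof -
  let ?M = "lebesgue_on {s0..s}" and ?w = "dt s0 s v"
  have vL: "in_Linf_H \<alpha> s0 s v" using v by (simp add: in_X_def)
  have "in_Linf_H (-23/14) s0 s ?w \<and> weak_time_deriv s0 s v ?w"
  proof -
    have "\<exists>w. in_Linf_H (-23/14) s0 s w \<and> weak_time_deriv s0 s v w"
      using v unfolding in_X_def by blast
    from someI_ex[OF this] show ?thesis unfolding dt_def .
  qed
  then have wL: "in_Linf_H nr s0 s ?w" and wd: "weak_time_deriv s0 s v ?w" by auto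
  define b where "b k t = fcoeff (?w t) k" for k t
  have "\<exists>A. primitive s0 s A (b k) \<and> (AE t in ?M. fcoeff (v t) k = A t)" for k
    unfolding b_def
    by (rule weak_derivative_primitive[OF s Linf_H_fcoeff_integrable[OF vL] Linf_H_fcoeff_integrable[OF wL] weak_time_deriv_fcoeff[OF wd]])
  then obtain A where A: "\<And>k. primitive s0 s (A k) (b k)" "\<And>k. AE t in ?M. fcoeff (v t) k = A k t" by metis
  have ae: "AE t in ?M. fcoeff (v t) = (\<lambda>k. A k t)"
    using A(2) unfolding fun_eq_iff AE_all_countable by blast
  have cont: "continuous_on {s0..s} (A k)" for k by (rule primitive_continuous[OF A(1)])
  have bound: "l2bd (\<lambda>k. jb r k * cmod (A k t)) (Linf_norm (H_norm r) s0 s v)" if "r \<le> \<alpha>" "t \<in> {s0..s}" for r t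
  proof (rule l2bd_everywhere[OF s cont _ that(2)])
    show "AE t in ?M. l2bd (\<lambda>k. jb r k * cmod (A k t)) (Linf_norm (H_norm r) s0 s v)"
      using ae Linf_H_AE_bound[OF vL that(1)]
    proof eventually_elim
      case (elim t)
      have "l2bd (\<lambda>k. jb r k * cmod (fcoeff (v t) k)) (Linf_norm (H_norm r) s0 s v)"
        by (rule l2bd_mono[OF in_H_l2bd]) (use elim in auto)
      then show ?case unfolding elim(1) .
    qed
  qed
  have wb: "AE t in ?M. l2bd (\<lambda>k. jb nr k * cmod (b k t)) (Linf_norm (H_norm nr) s0 s ?w)"
    using Linf_H_AE_bound[OF wL order_refl] unfolding b_def
    by eventually_elim (use l2bd_mono[OF in_H_l2bd] in blast)
  show ?thesis
  proof (rule exI[of _ A], rule exI[of _ b], intro conjI allI ballI A(1) ae wb)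
    fix t assume t: "t \<in> {s0..s}"
    show "l2bd (\<lambda>k. cmod (A k t)) (Linf_norm (H_norm 0) s0 s v)" using bound[OF \<alpha> t] by (simp add: jb_0)
    show "l2bd (\<lambda>k. jb nr k * cmod (A k t)) (Linf_norm (H_norm nr) s0 s v)" using \<alpha> by (intro bound t) auto
  qed
qed

lemma X_norm_nonneg: "0 \<le> X_norm r s0 s v"
  unfolding X_norm_def by (intro add_nonneg_nonneg Linf_norm_nonneg)

text \<open>  The sum of the nonresonant and the resonant part. Every term with a factor \<open>s - s0\<close> is a product
  that occurs in the expansion of the product of the three norms \<open>X_norm 0 = L + D\<close>.\<close>

lemma time_dependent_estimate:
  assumes \<alpha>: "0 \<le> \<alpha>" and s: "s0 < s" and X: "in_X \<alpha> s0 s v1" "in_X \<alpha> s0 s v2" "in_X \<alpha> s0 s v3"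
    and N: "N = Linf_norm (H_norm nr) s0 s v1 * Linf_norm (H_norm 0) s0 s v2 * Linf_norm (H_norm 0) s0 s v3 \<or>
     N = Linf_norm (H_norm 0) s0 s v1 * Linf_norm (H_norm nr) s0 s v2 * Linf_norm (H_norm 0) s0 s v3 \<or>
     N = Linf_norm (H_norm 0) s0 s v1 * Linf_norm (H_norm 0) s0 s v2 * Linf_norm (H_norm nr) s0 s v3"
  shows "in_L2 (trilin s0 s v1 v2 v3)"
    and "L2_norm (trilin s0 s v1 v2 v3) \<le> 3 * (2 * nonres_const + 2)
      * ((s - s0) * (X_norm 0 s0 s v1 * X_norm 0 s0 s v2 * X_norm 0 s0 s v3) + N)"
proof -
  define M where "M = nonres_const"
  have M: "M > 0" by (simp add: M_def nonres_const_pos)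
  let ?M = "lebesgue_on {s0..s}"
  let ?L1 = "Linf_norm (H_norm 0) s0 s v1" and ?L2 = "Linf_norm (H_norm 0) s0 s v2" and ?L3 = "Linf_norm (H_norm 0) s0 s v3"
  let ?D1 = "Linf_norm (H_norm nr) s0 s (dt s0 s v1)" and ?D2 = "Linf_norm (H_norm nr) s0 s (dt s0 s v2)" and ?D3 = "Linf_norm (H_norm nr) s0 s (dt s0 s v3)"
  note vL = X[unfolded in_X_def, THEN conjunct1]
  obtain A1 b1 where A1: "\<forall>k. primitive s0 s (A1 k) (b1 k)" "AE t in ?M. fcoeff (v1 t) = (\<lambda>k. A1 k t)"
    "\<forall>t\<in>{s0..s}. l2bd (\<lambda>k. cmod (A1 k t)) ?L1" "\<forall>t\<in>{s0..s}. l2bd (\<lambda>k. jb nr k * cmod (A1 k t)) (Linf_norm (H_norm nr) s0 s v1)"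
    "AE t in ?M. l2bd (\<lambda>k. jb nr k * cmod (b1 k t)) ?D1"
    using in_X_primitives[OF s X(1) \<alpha>] by (elim exE conjE)
  obtain A2 b2 where A2: "\<forall>k. primitive s0 s (A2 k) (b2 k)" "AE t in ?M. fcoeff (v2 t) = (\<lambda>k. A2 k t)"
    "\<forall>t\<in>{s0..s}. l2bd (\<lambda>k. cmod (A2 k t)) ?L2" "\<forall>t\<in>{s0..s}. l2bd (\<lambda>k. jb nr k * cmod (A2 k t)) (Linf_norm (H_norm nr) s0 s v2)"
    "AE t in ?M. l2bd (\<lambda>k. jb nr k * cmod (b2 k t)) ?D2"
    using in_X_primitives[OF s X(2) \<alpha>] by (elim exE conjE)
  obtain A3 b3 where A3: "\<forall>k. primitive s0 s (A3 k) (b3 k)" "AE t in ?M. fcoeff (v3 t) = (\<lambda>k. A3 k t)"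
    "\<forall>t\<in>{s0..s}. l2bd (\<lambda>k. cmod (A3 k t)) ?L3" "\<forall>t\<in>{s0..s}. l2bd (\<lambda>k. jb nr k * cmod (A3 k t)) (Linf_norm (H_norm nr) s0 s v3)"
    "AE t in ?M. l2bd (\<lambda>k. jb nr k * cmod (b3 k t)) ?D3"
    using in_X_primitives[OF s X(3) \<alpha>] by (elim exE conjE)
  have cont: "continuous_on {s0..s} (A1 k)" "continuous_on {s0..s} (A2 k)" "continuous_on {s0..s} (A3 k)" for k
    using A1(1) A2(1) A3(1) primitive_continuous by blast+
  have Am: "A1 k \<in> borel_measurable ?M" "A2 k \<in> borel_measurable ?M" "A3 k \<in> borel_measurable ?M" for k
    using cont by (intro borel_measurable_integrable cont_integrable_Icc, blast)+
  have J: "tri_coeff s0 s v1 v2 v3 x = tri_integral s0 s A1 A2 A3 x" for x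
    unfolding tri_coeff_def tri_integral_def
  proof (rule integral_cong_AE)
    show "(\<lambda>t. tri_term (fcoeff (v1 t)) (fcoeff (v2 t)) (fcoeff (v3 t)) t x) \<in> borel_measurable ?M"
      by (intro tri_term_measurable Linf_H_fcoeff_measurable[OF vL(1)] Linf_H_fcoeff_measurable[OF vL(2)] Linf_H_fcoeff_measurable[OF vL(3)])
    show "(\<lambda>t. tri_term (\<lambda>k. A1 k t) (\<lambda>k. A2 k t) (\<lambda>k. A3 k t) t x) \<in> borel_measurable ?M"
      by (intro tri_term_measurable Am)
    show "AE t in ?M. tri_term (fcoeff (v1 t)) (fcoeff (v2 t)) (fcoeff (v3 t)) t x = tri_term (\<lambda>k. A1 k t) (\<lambda>k. A2 k t) (\<lambda>k. A3 k t) t x"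
      using A1(2) A2(2) A3(2) by eventually_elim (simp only:)
  qed
  let ?P = "X_norm 0 s0 s v1 * X_norm 0 s0 s v2 * X_norm 0 s0 s v3"
  have Xn: "X_norm 0 s0 s v1 = ?L1 + ?D1" "X_norm 0 s0 s v2 = ?L2 + ?D2" "X_norm 0 s0 s v3 = ?L3 + ?D3"
    by (simp_all add: X_norm_def)
  note nn = Linf_norm_nonneg[of "H_norm 0" s0 s v1] Linf_norm_nonneg[of "H_norm 0" s0 s v2] Linf_norm_nonneg[of "H_norm 0" s0 s v3]
    Linf_norm_nonneg[of "H_norm nr" s0 s "dt s0 s v1"] Linf_norm_nonneg[of "H_norm nr" s0 s "dt s0 s v2"] Linf_norm_nonneg[of "H_norm nr" s0 s "dt s0 s v3"]
  have P1: "?D1 * ?L2 * ?L3 + ?L1 * ?D2 * ?L3 + ?L1 * ?L2 * ?D3 \<le> ?P" and P2: "?L1 * ?L2 * ?L3 \<le> ?P"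
    unfolding Xn using nn by (simp_all add: algebra_simps)
  have N0: "0 \<le> N" using N by (auto intro!: mult_nonneg_nonneg Linf_norm_nonneg)
  have P0: "0 \<le> ?P" by (intro mult_nonneg_nonneg X_norm_nonneg)
  have main: "(\<Sum>x\<in>T. D (k0 x) * cmod (tri_coeff s0 s v1 v2 v3 x)) \<le> ((2 * M + 2) * ((s - s0) * ?P + N)) * d"
    if T: "finite T" and D: "l2bd D d" for T D d
  proof -
    have d0: "0 \<le> d" by (rule l2bd_bound_nonneg[OF D])
    have neg: "\<exists>n1 n2 n3. N = n1 * n2 * n3
        \<and> (\<forall>t\<in>{s0..s}. one_negative_order (\<lambda>k. cmod (A1 k t)) (\<lambda>k. cmod (A2 k t)) (\<lambda>k. cmod (A3 k t)) n1 n2 n3)"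
      using N A1(3,4) A2(3,4) A3(3,4) unfolding one_negative_order_def by (elim disjE) blast+
    then obtain n1 n2 n3 where N': "N = n1 * n2 * n3"
      and neg: "\<forall>t\<in>{s0..s}. one_negative_order (\<lambda>k. cmod (A1 k t)) (\<lambda>k. cmod (A2 k t)) (\<lambda>k. cmod (A3 k t)) n1 n2 n3"
      by blast
    have n: "(\<Sum>x\<in>{x\<in>T. admissible x \<and> l_prod x \<noteq> 0}. D (k0 x) * cmod (tri_integral s0 s A1 A2 A3 x))
        \<le> M * ((2 * N + (s - s0) * (?D1 * ?L2 * ?L3 + ?L1 * ?D2 * ?L3 + ?L1 * ?L2 * ?D3)) * d)"
      unfolding N' M_def
    proof (rule nonresonant_part_le[OF s _ _ _ _ _ neg T D])
      show "primitive s0 s (A1 k) (b1 k)" "primitive s0 s (A2 k) (b2 k)" "primitive s0 s (A3 k) (b3 k)" for k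
        using A1(1) A2(1) A3(1) by blast+
      show "\<forall>t\<in>{s0..s}. l2bd (\<lambda>k. cmod (A1 k t)) ?L1 \<and> l2bd (\<lambda>k. cmod (A2 k t)) ?L2 \<and> l2bd (\<lambda>k. cmod (A3 k t)) ?L3"
        using A1(3) A2(3) A3(3) by blast
      show "AE t in ?M. l2bd (\<lambda>k. jb nr k * cmod (b1 k t)) ?D1 \<and> l2bd (\<lambda>k. jb nr k * cmod (b2 k t)) ?D2 \<and> l2bd (\<lambda>k. jb nr k * cmod (b3 k t)) ?D3"
        using A1(5) A2(5) A3(5) by eventually_elim blast
    qed
    have r: "(\<Sum>x\<in>{x\<in>T. admissible x \<and> l_prod x = 0}. D (k0 x) * cmod (tri_integral s0 s A1 A2 A3 x))
        \<le> (s - s0) * (2 * (?L1 * ?L2 * ?L3 * d))"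
    proof (rule resonant_part_le[OF T D less_imp_le[OF s]])
      show "integrable ?M (\<lambda>t. A1 (k1 x) t * A2 (k2 x) t * A3 (k3 x) t)" for x
        by (intro cont_integrable_Icc continuous_intros cont)
      show "AE t in ?M. l2bd (\<lambda>k. cmod (A1 k t)) ?L1 \<and> l2bd (\<lambda>k. cmod (A2 k t)) ?L2 \<and> l2bd (\<lambda>k. cmod (A3 k t)) ?L3"
        using A1(3) A2(3) A3(3) by (intro AE_I2) auto
    qed
    have "(\<Sum>x\<in>T. D (k0 x) * cmod (tri_coeff s0 s v1 v2 v3 x))
        \<le> M * ((2 * N + (s - s0) * (?D1 * ?L2 * ?L3 + ?L1 * ?D2 * ?L3 + ?L1 * ?L2 * ?D3)) * d) + (s - s0) * (2 * (?L1 * ?L2 * ?L3 * d))"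
      unfolding J by (rule split_resonant_sum[OF T l2bd_nonneg[OF D] n r])
    also have "\<dots> \<le> M * ((2 * N + (s - s0) * ?P) * d) + (s - s0) * (2 * (?P * d))"
      using P1 P2 M s d0 by (intro add_mono mult_left_mono mult_right_mono) auto
    also have "\<dots> \<le> ((2 * M + 2) * ((s - s0) * ?P + N)) * d"
    proof -
      have "0 \<le> M * ((s - s0) * ?P)" "0 \<le> N" using M s P0 N0 by auto
      then have "M * (2 * N + (s - s0) * ?P) + (s - s0) * (2 * ?P) \<le> (2 * M + 2) * ((s - s0) * ?P + N)"
        by (simp add: algebra_simps)
      from mult_right_mono[OF this d0] show ?thesis by (simp add: algebra_simps)
    qed
    finally show ?thesis .
  qed
  have B0: "0 \<le> (2 * M + 2) * ((s - s0) * ?P + N)"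
    by (rule mult_nonneg_nonneg[OF _ add_nonneg_nonneg[OF mult_nonneg_nonneg[OF _ P0] N0]]) (use M s in simp_all)
  note F = trilin_L2_bound[OF vL \<alpha> \<alpha> \<alpha> main B0]
  show "in_L2 (trilin s0 s v1 v2 v3)" by (rule F(1))
  show "L2_norm (trilin s0 s v1 v2 v3) \<le> 3 * (2 * nonres_const + 2)
    * ((s - s0) * (X_norm 0 s0 s v1 * X_norm 0 s0 s v2 * X_norm 0 s0 s v3) + N)"
    using F(2) by (simp only: mult.assoc M_def)
qed

text \<open>  The endpoints \<open>\<alpha> = 0\<close> and \<open>\<alpha> = 1\<close> of the interpolation control everything in between.\<close>

lemma powr_mult_le_add:
  fixes x y \<alpha> :: real
  assumes "0 < x" "0 < y" "0 \<le> \<alpha>" "\<alpha> \<le> 1"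
  shows "x powr (1 - \<alpha>) * y powr \<alpha> \<le> x + y"
proof -
  have "x powr (1 - \<alpha>) * y powr \<alpha> \<le> (max x y) powr (1 - \<alpha>) * (max x y) powr \<alpha>"
    using assms by (intro mult_mono powr_mono2) auto
  also have "\<dots> = max x y" using assms by (simp add: powr_add[symmetric])
  finally show ?thesis using assms by linarith
qed

lemma primitive_const: "primitive s0 s (\<lambda>t. c) (\<lambda>t. 0)"
  by (simp add: primitive_def)

text \<open>  Interpolation between the length of the interval and \<open>2 / \<bar>3 * l\<bar> \<le> 1 / \<bar>l\<bar>\<close>, which comes from
  \<open>oscillatory_integral_le\<close> for constant functions.\<close>

lemma cis_integral_le:
  assumes s: "s0 < s" and l: "l \<noteq> 0" and \<alpha>: "0 \<le> \<alpha>" "\<alpha> \<le> 1"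
  shows "cmod (LINT t|lebesgue_on {s0..s}. cis (- (of_int (3 * l) * t))) \<le> (s - s0) powr \<alpha> * (1 / \<bar>of_int l\<bar>) powr (1 - \<alpha>)"
proof -
  let ?M = "lebesgue_on {s0..s}"
  define I where "I = cmod (LINT t|?M. cis (- (of_int (3 * l) * t)))"
  have "I \<le> (LINT t|?M. cmod (cis (- (of_int (3 * l) * t))))" unfolding I_def by (rule integral_norm_bound)
  then have 1: "I \<le> s - s0" using s by (simp add: measure_restrict_space)
  have "\<bar>real_of_int (3 * l)\<bar> * I \<le> 2"
    unfolding I_def using oscillatory_integral_le(2)[OF less_imp_le[OF s] _ primitive_const[of s0 s 1] primitive_const[of s0 s 1] primitive_const[of s0 s 1], of "of_int (3 * l)"] l
    by simp
  then have "3 * (\<bar>of_int l\<bar> * I) \<le> 3 * 1" by (simp add: abs_mult)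
  then have 2: "I \<le> 1 / \<bar>of_int l\<bar>" using l by (simp add: field_simps)
  have "I \<le> (s - s0) powr \<alpha> * (1 / \<bar>of_int l\<bar>) powr (1 - \<alpha>)"
  proof (cases "I = 0")
    case False
    then have I: "0 < I" by (simp add: I_def)
    then have "I = I powr \<alpha> * I powr (1 - \<alpha>)" by (simp add: powr_add[symmetric])
    also have "\<dots> \<le> (s - s0) powr \<alpha> * (1 / \<bar>of_int l\<bar>) powr (1 - \<alpha>)"
      using 1 2 I \<alpha> by (intro mult_mono powr_mono2) auto
    finally show ?thesis .
  qed simp
  then show ?thesis by (simp add: I_def)
qed

lemma jb_minus_one_le: "jb (-1) k \<le> 2 / br k"
proof -
  have "(br k)\<^sup>2 \<le> (2 * sqrt (1 + (of_int k)\<^sup>2))\<^sup>2"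
    using sum_squares_bound[of 1 "\<bar>real_of_int k\<bar>"] by (simp add: br_def power2_sum power_mult_distrib)
  then have "br k \<le> 2 * sqrt (1 + (of_int k)\<^sup>2)" by (rule power2_le_imp_le) simp
  moreover have "0 < sqrt (1 + (real_of_int k)\<^sup>2)" using one_plus_square_ge_1[of k] by (simp add: add_pos_nonneg)
  ultimately have "1 / sqrt (1 + (of_int k)\<^sup>2) \<le> 2 / br k"
    using br_ge_1[of k] by (simp add: divide_le_eq le_divide_eq mult.commute)
  moreover have "jb (-1) k = 1 / sqrt (1 + (of_int k)\<^sup>2)"
    using one_plus_square_ge_1[of k] by (simp add: jb_def powr_minus_divide powr_half_sqrt)
  ultimately show ?thesis by simp
qed

lemma jb_powr: "jb (- \<alpha>) k = jb (-1) k powr \<alpha>"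
  by (simp add: jb_def powr_powr mult.commute)

lemma l2bd_dominated:
  assumes "l2bd A a" "\<And>k. 0 \<le> B k" "\<And>k. B k \<le> A k" shows "l2bd B a"
  unfolding l2bd_def
proof (intro conjI allI impI assms(2))
  fix F :: "int set" assume "finite F"
  then have "L2_set A F \<le> a" using assms(1) by (simp add: l2bd_def)
  moreover have "L2_set B F \<le> L2_set A F" by (rule L2_set_mono) (use assms in auto)
  ultimately show "L2_set B F \<le> a" by linarith
qed

text \<open>  The sequences \<open>A1, A2, A3\<close> carry the weight of order \<open>\<alpha>\<close>, so the multiplier at a nonresonant triple is
  \<open>q powr (1 - \<alpha>) * Y powr \<alpha> / \<bar>k3\<bar>\<close> with \<open>q = 1 / \<bar>l_prod\<bar>\<close> and \<open>Y\<close> the product of the three inverse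
  brackets. It is at most \<open>(q + Y) / \<bar>k3\<bar>\<close>, and both summands are dominated by pair weights. The
  resonant part gives \<open>s - s0\<close>, which is at most \<open>(s - s0) powr \<alpha> * K powr (1 - \<alpha>)\<close>; here the bound on
  the length of the interval enters.\<close>

lemma constant_estimate:
  assumes \<alpha>: "0 \<le> \<alpha>" "\<alpha> \<le> 1" and s: "s0 < s" and sK: "s - s0 \<le> K"
    and vL: "in_Linf_H \<alpha> s0 s v1" "in_Linf_H \<alpha> s0 s v2" "in_Linf_H \<alpha> s0 s v3"
    and w: "\<forall>t\<in>{s0..s}. v1 t = w1 \<and> v2 t = w2 \<and> v3 t = w3"
  shows "L2_norm (trilin s0 s v1 v2 v3) \<le> 3 * (nonres_const + 32 * pair_const + 2 * K powr (1 - \<alpha>))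
    * ((s - s0) powr \<alpha> * (H_norm \<alpha> w1 * H_norm \<alpha> w2 * H_norm \<alpha> w3))"
proof -
  define C where "C = nonres_const + 32 * pair_const + 2 * K powr (1 - \<alpha>)"
  have C0: "C > 0" unfolding C_def using nonres_const_pos pair_const_pos by (simp add: add_pos_nonneg)
  let ?M = "lebesgue_on {s0..s}"
  have const: "in_H \<alpha> u" if v: "in_Linf_H \<alpha> s0 s v" and u: "\<forall>t\<in>{s0..s}. v t = u" for v u
  proof (rule AE_lebesgue_on_const[OF s])
    show "AE t in ?M. in_H \<alpha> u"
      using Linf_H_AE_bound[OF v order_refl] AE_space by eventually_elim (use u in auto)
  qed
  have wH: "in_H \<alpha> w1" "in_H \<alpha> w2" "in_H \<alpha> w3" using const vL w by blast+
  let ?H1 = "H_norm \<alpha> w1" and ?H2 = "H_norm \<alpha> w2" and ?H3 = "H_norm \<alpha> w3"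
  let ?a1 = "fcoeff w1" and ?a2 = "fcoeff w2" and ?a3 = "fcoeff w3"
  let ?L = "(s - s0) powr \<alpha>"
  have J: "tri_coeff s0 s v1 v2 v3 x = tri_integral s0 s (\<lambda>k t. ?a1 k) (\<lambda>k t. ?a2 k) (\<lambda>k t. ?a3 k) x" for x
    unfolding tri_coeff_def tri_integral_def
    by (intro Bochner_Integration.integral_cong refl) (use w in simp)
  have low: "l2bd (\<lambda>k. cmod (fcoeff u k)) (H_norm \<alpha> u)" if "in_H \<alpha> u" for u
    using l2bd_mono[OF in_H_0_l2bd[OF in_H_mono(1)[OF that \<alpha>(1)]] in_H_mono(2)[OF that \<alpha>(1)]] .
  define A1 where "A1 k = jb \<alpha> k * cmod (?a1 k)" for k
  define A2 where "A2 k = jb \<alpha> k * cmod (?a2 k)" for k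
  define A3 where "A3 k = jb \<alpha> k * cmod (?a3 k)" for k
  have A: "l2bd A1 ?H1" "l2bd A2 ?H2" "l2bd A3 ?H3"
    unfolding A1_def[abs_def] A2_def[abs_def] A3_def[abs_def] using in_H_l2bd wH by auto
  have a: "cmod (?a1 k) = jb (- \<alpha>) k * A1 k" "cmod (?a2 k) = jb (- \<alpha>) k * A2 k" "cmod (?a3 k) = jb (- \<alpha>) k * A3 k" for k
    by (simp_all add: A1_def A2_def A3_def mult.assoc[symmetric] jb_minus)
  have main: "(\<Sum>x\<in>T. D (k0 x) * cmod (tri_coeff s0 s v1 v2 v3 x)) \<le> (C * (?L * (?H1 * ?H2 * ?H3))) * d"
    if T: "finite T" and D: "l2bd D d" for T D d
  proof -
    let ?T = "{x\<in>T. admissible x \<and> l_prod x \<noteq> 0}"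
    have d0: "0 \<le> d" by (rule l2bd_bound_nonneg[OF D])
    note nn = l2bd_nonneg[OF A(1)] l2bd_nonneg[OF A(2)] l2bd_nonneg[OF A(3)] l2bd_nonneg[OF D]
    let ?p = "\<lambda>x. A1 (k1 x) * A2 (k2 x) * A3 (k3 x) * D (k0 x)"
    have p0: "0 \<le> ?p x" for x using nn by auto
    have "(\<Sum>x\<in>?T. D (k0 x) * cmod (tri_coeff s0 s v1 v2 v3 x)) \<le> (\<Sum>x\<in>?T. ?L * (?p x / denom x + 32 * (pair_weights x * ?p x)))"
    proof (rule sum_mono)
      fix x assume x: "x \<in> ?T"
      then have ax: "admissible x" and l: "l_prod x \<noteq> 0" and k3: "k3 x \<noteq> 0" by (auto simp: admissible_def)
      let ?I = "cmod (LINT t|?M. cis (- (of_int (3 * l_prod x) * t)))"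
      let ?G = "cmod (?a1 (k1 x)) * cmod (?a2 (k2 x)) * cmod (?a3 (k3 x))"
      let ?Y = "jb (-1) (k1 x) * jb (-1) (k2 x) * jb (-1) (k3 x)"
      let ?q = "1 / \<bar>real_of_int (l_prod x)\<bar>" and ?r = "inverse \<bar>real_of_int (k3 x)\<bar>"
      have Y0: "0 < ?Y" using jb_pos by simp
      have "cmod (tri_coeff s0 s v1 v2 v3 x) = ?r * (?I * ?G)"
        unfolding J tri_integral_admissible[OF ax] integral_mult_left_zero by (simp only: norm_mult)
      also have "\<dots> \<le> ?r * ((?L * ?q powr (1 - \<alpha>)) * ?G)"
        by (intro mult_left_mono mult_right_mono cis_integral_le s l \<alpha>) auto
      finally have "D (k0 x) * cmod (tri_coeff s0 s v1 v2 v3 x) \<le> D (k0 x) * (?r * ((?L * ?q powr (1 - \<alpha>)) * ?G))"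
        using nn by (intro mult_left_mono)
      also have "\<dots> = ?L * ((?q powr (1 - \<alpha>) * ?Y powr \<alpha>) * (?r * ?p x))"
        unfolding a jb_powr[of \<alpha>] using jb_pos[of "-1"] by (simp add: powr_mult less_imp_le mult_ac)
      also have "\<dots> \<le> ?L * ((?q + ?Y) * (?r * ?p x))"
        using l Y0 \<alpha> p0 by (intro mult_left_mono mult_right_mono powr_mult_le_add) auto
      also have "\<dots> = ?L * (?p x / denom x + ?r * (?Y * ?p x))"
        by (simp add: denom_def divide_inverse distrib_right distrib_left mult_ac)
      also have "\<dots> \<le> ?L * (?p x / denom x + 1 * ((32 * pair_weights x) * ?p x))"
      proof -
        have j0: "0 \<le> jb (-1) k" "0 \<le> 2 / br k" for k using jb_pos[of "-1" k] br_ge_1[of k] by auto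
        have "?Y \<le> (2 / br (k1 x)) * (2 / br (k2 x)) * (2 / br (k3 x))"
          by (intro mult_mono jb_minus_one_le mult_nonneg_nonneg j0)
        also have "\<dots> = 8 * (1 / (br (k1 x) * br (k2 x) * br (k3 x)))" by simp
        also have "\<dots> \<le> 8 * (4 * pair_weights x)" by (intro mult_left_mono inverse_freq_product_le) simp
        finally have Y: "?Y \<le> 32 * pair_weights x" by simp
        have "?r * (?Y * ?p x) \<le> 1 * ((32 * pair_weights x) * ?p x)"
          by (rule mult_mono[OF inverse_int_le_1[OF k3] mult_right_mono[OF Y p0]])
             (use mult_nonneg_nonneg[OF less_imp_le[OF Y0] p0[of x]] in simp_all)
        then show ?thesis by (intro mult_left_mono add_left_mono powr_ge_zero)
      qed
      finally show "D (k0 x) * cmod (tri_coeff s0 s v1 v2 v3 x) \<le> ?L * (?p x / denom x + 32 * (pair_weights x * ?p x))"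
        by (simp add: mult.assoc)
    qed
    also have "\<dots> = ?L * ((\<Sum>x\<in>?T. ?p x / denom x) + 32 * (\<Sum>x\<in>?T. pair_weights x * ?p x))"
      by (simp add: sum_distrib_left sum.distrib distrib_left)
    also have "\<dots> \<le> ?L * (nonres_const * (?H1 * ?H2 * ?H3 * d) + 32 * (pair_const * (?H1 * ?H2 * ?H3 * d)))"
    proof (intro mult_left_mono add_mono)
      have jn: "jb nr k \<le> 1" for k using jb_mono[of nr 0 k] by (simp add: jb_0)
      have "l2bd (\<lambda>k. jb nr k * A1 k) ?H1"
        by (rule l2bd_dominated[OF A(1)]) (use nn jn jb_pos[of nr] in \<open>auto simp: less_imp_le mult_left_le_one_le\<close>)
      then show "(\<Sum>x\<in>?T. ?p x / denom x) \<le> nonres_const * (?H1 * ?H2 * ?H3 * d)"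
        using T A nn by (intro nonresonant_sum_le[OF _ _ _ _ _ D]) (auto simp: admissible_def one_negative_order_def)
      show "(\<Sum>x\<in>?T. pair_weights x * ?p x) \<le> pair_const * (?H1 * ?H2 * ?H3 * d)"
        using T by (intro pair_weights_sum_le A D) auto
    qed auto
    finally have n: "(\<Sum>x\<in>?T. D (k0 x) * cmod (tri_integral s0 s (\<lambda>k t. ?a1 k) (\<lambda>k t. ?a2 k) (\<lambda>k t. ?a3 k) x))
        \<le> ?L * ((nonres_const + 32 * pair_const) * (?H1 * ?H2 * ?H3 * d))" unfolding J by (simp add: algebra_simps)
    have r: "(\<Sum>x\<in>{x\<in>T. admissible x \<and> l_prod x = 0}. D (k0 x) * cmod (tri_integral s0 s (\<lambda>k t. ?a1 k) (\<lambda>k t. ?a2 k) (\<lambda>k t. ?a3 k) x))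
        \<le> (s - s0) * (2 * (?H1 * ?H2 * ?H3 * d))"
    proof (rule resonant_part_le[OF T D less_imp_le[OF s]])
      show "integrable ?M (\<lambda>t. ?a1 (k1 x) * ?a2 (k2 x) * ?a3 (k3 x))" for x
        by (rule finite_measure.integrable_const[OF finite_measure_lebesgue_on_Icc])
      show "AE t in ?M. l2bd (\<lambda>k. cmod (?a1 k)) ?H1 \<and> l2bd (\<lambda>k. cmod (?a2 k)) ?H2 \<and> l2bd (\<lambda>k. cmod (?a3 k)) ?H3"
        using low wH by (intro AE_I2) auto
    qed
    have "s - s0 = (s - s0) powr \<alpha> * (s - s0) powr (1 - \<alpha>)" using s by (simp add: powr_add[symmetric])
    also have "\<dots> \<le> ?L * K powr (1 - \<alpha>)" using s sK \<alpha> by (intro mult_left_mono powr_mono2) auto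
    finally have "(s - s0) * (2 * (?H1 * ?H2 * ?H3 * d)) \<le> (?L * K powr (1 - \<alpha>)) * (2 * (?H1 * ?H2 * ?H3 * d))"
      using d0 H_norm_nonneg by (intro mult_right_mono) auto
    with split_resonant_sum[OF T l2bd_nonneg[OF D] n r]
    have "(\<Sum>x\<in>T. D (k0 x) * cmod (tri_coeff s0 s v1 v2 v3 x))
        \<le> ?L * ((nonres_const + 32 * pair_const) * (?H1 * ?H2 * ?H3 * d)) + (?L * K powr (1 - \<alpha>)) * (2 * (?H1 * ?H2 * ?H3 * d))"
      unfolding J by linarith
    also have "\<dots> = (C * (?L * (?H1 * ?H2 * ?H3))) * d" unfolding C_def by (simp add: algebra_simps)
    finally show ?thesis .
  qed
  have B0: "0 \<le> C * (?L * (?H1 * ?H2 * ?H3))"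
    using C0 H_norm_nonneg by (intro mult_nonneg_nonneg) auto
  show ?thesis using trilin_L2_bound(2)[OF vL \<alpha>(1) \<alpha>(1) \<alpha>(1) main B0] by (simp only: mult.assoc C_def)
qed

text \<open>  The degenerate case is separate because an almost everywhere statement on a single point is void.\<close>

lemma trilin_trivial_interval: "in_L2 (trilin s s v1 v2 v3)" "L2_norm (trilin s s v1 v2 v3) = 0"
proof -
  have z: "trilin s s v1 v2 v3 \<phi> = (\<Sum>\<^sub>\<infinity>k. 0 * of_fun (\<lambda>x. cis (of_int k * x)) \<phi>)" for \<phi>
    unfolding trilin_def by (simp add: integral_eq_zero_null_sets)
  have "(\<lambda>k::int. (cmod 0)\<^sup>2) summable_on UNIV" by simp
  note S = square_summable_represented[OF this z]
  show "in_L2 (trilin s s v1 v2 v3)" by (rule S(1))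
  show "L2_norm (trilin s s v1 v2 v3) = 0" using S(5) by simp
qed

theorem proposition3p4:
  fixes K \<alpha> :: real
  assumes "K > 0" and "0 \<le> \<alpha>" and "\<alpha> \<le> 1"
  shows "\<exists>C>0. \<forall>(s0::real) (s::real) (v :: nat \<Rightarrow> real \<Rightarrow> functional).
    0 \<le> s0 \<longrightarrow> s0 \<le> s \<longrightarrow> \<bar>s - s0\<bar> \<le> K \<longrightarrow> (\<forall>j\<in>{1,2,3}. in_X \<alpha> s0 s (v j)) \<longrightarrow>
      in_L2 (trilin s0 s (v 1) (v 2) (v 3)) \<and>
      (\<forall>\<sigma>. \<sigma> permutes {1,2,3} \<longrightarrow>
        L2_norm (trilin s0 s (v 1) (v 2) (v 3))
          \<le> C * \<bar>s - s0\<bar> * (\<Prod>j\<in>{1,2,3}. X_norm 0 s0 s (v (\<sigma> j)))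
            + C * Linf_norm (H_norm (-23/14)) s0 s (v (\<sigma> 1))
                * Linf_norm L2_norm s0 s (v (\<sigma> 2))
                * Linf_norm L2_norm s0 s (v (\<sigma> 3))) \<and>
      (\<forall>w :: nat \<Rightarrow> functional. (\<forall>j\<in>{1,2,3}. \<forall>t\<in>{s0..s}. v j t = w j) \<longrightarrow>
        L2_norm (trilin s0 s (v 1) (v 2) (v 3))
          \<le> C * \<bar>s - s0\<bar> powr \<alpha> * (\<Prod>j\<in>{1,2,3}. H_norm \<alpha> (w j)))"
proof -
  define C1 where "C1 = 3 * (2 * nonres_const + 2)"
  define C2 where "C2 = 3 * (nonres_const + 32 * pair_const + 2 * K powr (1 - \<alpha>))"
  have C1: "C1 > 0" unfolding C1_def using nonres_const_pos by simp
  have C2: "C2 > 0" unfolding C2_def using nonres_const_pos pair_const_pos by (simp add: add_pos_nonneg)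
  show ?thesis
  proof (intro exI[of _ "C1 + C2"] conjI allI impI)
    show "0 < C1 + C2" using C1 C2 by simp
  next
    fix s0 s :: real and v :: "nat \<Rightarrow> real \<Rightarrow> functional"
    assume s: "s0 \<le> s" and X: "\<forall>j\<in>{1,2,3}. in_X \<alpha> s0 s (v j)"
    show "in_L2 (trilin s0 s (v 1) (v 2) (v 3))"
    proof (cases "s0 = s")
      case True then show ?thesis by (simp add: trilin_trivial_interval)
    next
      case False
      then show ?thesis using time_dependent_estimate(1)[OF assms(2) _ _ _ _ disjI1[OF refl]] s X by simp
    qed
  next
    fix s0 s :: real and v :: "nat \<Rightarrow> real \<Rightarrow> functional" and \<sigma> :: "nat \<Rightarrow> nat"
    assume s: "s0 \<le> s" and X: "\<forall>j\<in>{1,2,3}. in_X \<alpha> s0 s (v j)" and \<sigma>: "\<sigma> permutes {1,2,3}"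
    let ?R1 = "\<Prod>j\<in>{1,2,3}. X_norm 0 s0 s (v (\<sigma> j))"
    let ?R2 = "Linf_norm (H_norm (-23/14)) s0 s (v (\<sigma> 1)) * Linf_norm L2_norm s0 s (v (\<sigma> 2)) * Linf_norm L2_norm s0 s (v (\<sigma> 3))"
    have R1: "0 \<le> ?R1" by (intro prod_nonneg) (simp add: X_norm_nonneg)
    have R2: "0 \<le> ?R2" by (intro mult_nonneg_nonneg Linf_norm_nonneg)
    have "L2_norm (trilin s0 s (v 1) (v 2) (v 3)) \<le> C1 * ((s - s0) * ?R1 + ?R2)"
    proof (cases "s0 = s")
      case True
      then show ?thesis using R2 C1 by (simp add: trilin_trivial_interval)
    next
      case False
      then have s': "s0 < s" using s by simp
      have L: "Linf_norm L2_norm s0 s (v j) = Linf_norm (H_norm 0) s0 s (v j)" if "j \<in> {1,2,3}" for j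
        using X that assms(2) by (intro Linf_L2_norm[of \<alpha>]) (auto simp: in_X_def)
      have im: "\<sigma> ` {1,2,3} = {1,2,3}" by (rule permutes_image[OF \<sigma>])
      have inj: "inj \<sigma>" by (rule permutes_inj[OF \<sigma>])
      have mem: "\<sigma> 1 \<in> {1,2,3}" "\<sigma> 2 \<in> {1,2,3}" "\<sigma> 3 \<in> {1,2,3}" using im by blast+
      have ne: "\<sigma> 1 \<noteq> \<sigma> 2" "\<sigma> 1 \<noteq> \<sigma> 3" "\<sigma> 2 \<noteq> \<sigma> 3" using inj_eq[OF inj] by auto
      have P: "?R1 = X_norm 0 s0 s (v 1) * X_norm 0 s0 s (v 2) * X_norm 0 s0 s (v 3)"
      proof -
        have "?R1 = (\<Prod>j\<in>{1,2,3}. X_norm 0 s0 s (v j))"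
          using prod.permute[OF \<sigma>, of "\<lambda>j. X_norm 0 s0 s (v j)"] by (simp add: o_def)
        then show ?thesis by (simp add: mult.assoc)
      qed
      have N: "?R2 = Linf_norm (H_norm nr) s0 s (v 1) * Linf_norm (H_norm 0) s0 s (v 2) * Linf_norm (H_norm 0) s0 s (v 3) \<or>
        ?R2 = Linf_norm (H_norm 0) s0 s (v 1) * Linf_norm (H_norm nr) s0 s (v 2) * Linf_norm (H_norm 0) s0 s (v 3) \<or>
        ?R2 = Linf_norm (H_norm 0) s0 s (v 1) * Linf_norm (H_norm 0) s0 s (v 2) * Linf_norm (H_norm nr) s0 s (v 3)"
        unfolding L[OF mem(2)] L[OF mem(3)] using mem ne by (auto simp: mult_ac)
      show ?thesis unfolding P C1_def by (rule time_dependent_estimate(2)[OF assms(2) s' _ _ _ N]) (use X in auto)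
    qed
    also have "\<dots> \<le> (C1 + C2) * ((s - s0) * ?R1 + ?R2)"
    proof (rule mult_right_mono)
      show "0 \<le> (s - s0) * ?R1 + ?R2"
        by (rule add_nonneg_nonneg[OF mult_nonneg_nonneg[OF _ R1] R2]) (use s in simp)
    qed (use C2 in simp)
    finally show "L2_norm (trilin s0 s (v 1) (v 2) (v 3))
          \<le> (C1 + C2) * \<bar>s - s0\<bar> * ?R1
            + (C1 + C2) * Linf_norm (H_norm (-23/14)) s0 s (v (\<sigma> 1))
                * Linf_norm L2_norm s0 s (v (\<sigma> 2)) * Linf_norm L2_norm s0 s (v (\<sigma> 3))"
      using s by (simp only: distrib_left mult.assoc abs_of_nonneg diff_ge_0_iff_ge)
  next
    fix s0 s :: real and v :: "nat \<Rightarrow> real \<Rightarrow> functional" and w :: "nat \<Rightarrow> functional"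
    assume s: "s0 \<le> s" and sK: "\<bar>s - s0\<bar> \<le> K" and X: "\<forall>j\<in>{1,2,3}. in_X \<alpha> s0 s (v j)"
      and w: "\<forall>j\<in>{1,2,3}. \<forall>t\<in>{s0..s}. v j t = w j"
    have H: "0 \<le> H_norm \<alpha> (w 1) * H_norm \<alpha> (w 2) * H_norm \<alpha> (w 3)"
      by (intro mult_nonneg_nonneg H_norm_nonneg)
    have "L2_norm (trilin s0 s (v 1) (v 2) (v 3)) \<le> C2 * ((s - s0) powr \<alpha> * (H_norm \<alpha> (w 1) * H_norm \<alpha> (w 2) * H_norm \<alpha> (w 3)))"
    proof (cases "s0 = s")
      case True then show ?thesis by (simp add: trilin_trivial_interval)
    next
      case False
      then show ?thesis unfolding C2_def using s sK X w assms by (intro constant_estimate) (auto simp: in_X_def)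
    qed
    also have "\<dots> \<le> (C1 + C2) * ((s - s0) powr \<alpha> * (H_norm \<alpha> (w 1) * H_norm \<alpha> (w 2) * H_norm \<alpha> (w 3)))"
      using C1 H by (intro mult_right_mono mult_nonneg_nonneg[OF powr_ge_zero]) auto
    finally show "L2_norm (trilin s0 s (v 1) (v 2) (v 3)) \<le> (C1 + C2) * \<bar>s - s0\<bar> powr \<alpha> * (\<Prod>j\<in>{1,2,3}. H_norm \<alpha> (w j))"
      using s by (simp add: mult_ac)
  qed
qed

end
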